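(* Let $\mu=1$, let $x_0>0$ and let $S=S_{x_0}$ be the set of initial data defined in the context. Let $\omega>0$ and $\epsilon>0$. Then there exists some $\delta>0$ so that for any $u_0\in S$ satisfying $$\inf_{\theta,h\in\mathbb R}\|u_0(\cdot+h)^2-e^{2i\theta}\phi_\omega^2\|_{L^1\cap\dot H^1}\le\delta,$$ we have the estimate $$\sup_{t\in[0,T]}\left(\inf_{\theta,h\in\mathbb R}\|u(t,\cdot+h)^2-e^{-2it\omega+2i\theta}\phi_\omega^2\|_{L^1\cap\dot H^1}\right)\le\epsilon,$$ where $u$ is the solution with initial data $u_0$, and $T>0$ its lifespan, given by the local well-posedness theorem recalled in the context.
   Context: Here $\phi_\omega(x)=\sqrt{2\omega}\cos\left(\frac x{\sqrt2}\right)\mathbf 1_{(-\pi/\sqrt2,\,\pi/\sqrt2)}(x)$ and $\|q\|_{L^1\cap\dot H^1}=\|q\|_{L^1}+\|q_x\|_{L^2}$. The equation is $iu_t=\bar u(uu_x)_x+\mu|u|^2u$, $u(0,x)=u_0(x)$, for $u:[0,T]\times\mathbb R\to\mathbb C$, with mass $M[u]=\int|u|^2dx$, momentum $P[u]=\operatorname{Im}\int u\bar u_xdx$ and energy $H[u]=\int|uu_x|^2dx-\frac\mu2\int|u|^4dx$. Function spaces. Fourier transform $\hat f(\xi)=\frac1{\sqrt{2\pi}}\int f(x)e^{-ix\xi}dx$, $\langle\xi\rangle=\sqrt{1+|\xi|^2}$, $\|f\|_{H^s}^2=\int\langle\xi\rangle^{2s}|\hat f(\xi)|^2d\xi$, and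 $\|f\|_{Z^s}=\|f\|_{L^\infty}+\|f_y\|_{H^{s-\frac12}}$. For $m:\mathbb R\to\mathbb C$, $m(D_y)$ is the Fourier multiplier with symbol $m(\xi)$. For $\tau>0$ and a Banach space $X$ of tempered distributions on $\mathbb R$, $AX_\tau$ is the space of $f\in X$ with finite norm $\|f\|_{AX_\tau}=\|e^{\tau D_y}f\|_X+\|e^{-\tau D_y}f\|_X$. The set $S=S_{x_0}$: with $I=(-x_0,x_0)$, $S$ is the set of $u_0\in L^2(\mathbb R)$ that are non-zero and smooth on $I$, supported on $\bar I$, and satisfy $\frac1{|u_0|}\notin L^1((-x_0,0))\cup L^1((0,x_0))$, so that if $y_0(x)=\int_0^x\frac1{|u_0(\zeta)|}d\zeta$ for $x\in I$ (a diffeomorphism of $I$ onto $\mathbb R$) and $U_0(y_0(x))=u_0(x)$, then there exist some $0<s\le\frac12$ and $0<\tau_0\le1$ with $U_0\in AH^s_{\tau_0}$ and $\frac{\bar U_0\,\partial_yU_0}{|U_0|^2}\in AZ^s_{\tau_0}$. Local well-posedness theorem (provides $u$ and $T$): for any $u_0\in S$ there exists $T>0$ and a unique $u\in C([0,T];L^2)$ solving the equation with $u(0)=u_0$ in the sense of distributions with $u\in C([0,T]\times\mathbb R)$ and $u_x,(\frac12u^2)_{xx}\in C([0,T];L^\infty)$; for all $t\in[0,T]$, $u(t)$ is non-zero and smooth on $I$, supported on $\bar I$, and $M[u(t)]=M[u_0]$, $P[u(t)]=P[u_0]$, $H[u(t)]=H[u_0]$. *)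

theory Defs
  imports "HOL-Analysis.Analysis" "HOL-Probability.Essential_Supremum"
begin

section \<open>Smooth functions, test functions, Schwartz functions\<close>

text \<open>For open \<open>S\<close>: \<open>f\<close> is $C^n$ on \<open>S\<close>, i.e. it is differentiable and all its directional
  derivatives are $C^{n-1}$. The domain may be \<open>real\<close> or \<open>real \<times> real\<close>.\<close>

primrec Ck_on :: "nat \<Rightarrow> 'a::euclidean_space set \<Rightarrow> ('a \<Rightarrow> complex) \<Rightarrow> bool" where
  "Ck_on 0 S f \<longleftrightarrow> continuous_on S f"
| "Ck_on (Suc n) S f \<longleftrightarrow>
     (\<forall>x\<in>S. f differentiable (at x)) \<and> (\<forall>v. Ck_on n S (\<lambda>x. frechet_derivative f (at x) v))"

definition smooth_on :: "'a::euclidean_space set \<Rightarrow> ('a \<Rightarrow> complex) \<Rightarrow> bool" where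
  "smooth_on S f \<longleftrightarrow> (\<forall>n. Ck_on n S f)"

definition test_functions :: "'a::euclidean_space set \<Rightarrow> ('a \<Rightarrow> complex) set" where
  "test_functions \<Omega> = {\<phi>. smooth_on UNIV \<phi> \<and>
     compact (closure {x. \<phi> x \<noteq> 0}) \<and> closure {x. \<phi> x \<noteq> 0} \<subseteq> \<Omega>}"

definition ddx :: "(real \<Rightarrow> complex) \<Rightarrow> real \<Rightarrow> complex" where
  "ddx f = (\<lambda>x. vector_derivative f (at x))"

definition schwartz :: "(real \<Rightarrow> complex) set" where
  "schwartz = {\<phi>. smooth_on UNIV \<phi> \<and>
     (\<forall>k n. \<exists>C. \<forall>x. \<bar>x\<bar> ^ k * norm ((ddx ^^ n) \<phi> x) \<le> C)}"

section \<open>Lebesgue norms and weak derivatives on the real line\<close>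

text \<open>Norms take values in \<open>ennreal\<close>, with value \<open>\<infinity>\<close> outside the space.\<close>

definition L1_norm :: "(real \<Rightarrow> complex) \<Rightarrow> ennreal" where
  "L1_norm f = (\<integral>\<^sup>+ x. ennreal (norm (f x)) \<partial>lborel)"

definition L2_norm :: "(real \<Rightarrow> complex) \<Rightarrow> ennreal" where
  "L2_norm f = (let J = (\<integral>\<^sup>+ x. ennreal ((norm (f x))\<^sup>2) \<partial>lborel)
                in if J < \<infinity> then ennreal (sqrt (enn2real J)) else \<infinity>)"

definition Linf_norm :: "(real \<Rightarrow> complex) \<Rightarrow> ennreal" where
  "Linf_norm f = esssup lborel (\<lambda>x. ennreal (norm (f x)))"

definition locally_integrable :: "(real \<Rightarrow> complex) \<Rightarrow> bool" where
  "locally_integrable f \<longleftrightarrow> (\<forall>a b. set_integrable lborel {a..b} f)"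

definition has_weak_deriv :: "nat \<Rightarrow> (real \<Rightarrow> complex) \<Rightarrow> (real \<Rightarrow> complex) \<Rightarrow> bool" where
  "has_weak_deriv n f g \<longleftrightarrow> locally_integrable f \<and> locally_integrable g \<and>
     (\<forall>\<phi>\<in>test_functions UNIV.
        (LBINT x. f x * (ddx ^^ n) \<phi> x) = (-1) ^ n * (LBINT x. g x * \<phi> x))"

text \<open>A representative of the \<open>n\<close>-th weak derivative, which is unique almost everywhere; it is only
  used below under integrals and norms that do not depend on the representative.\<close>

definition weak_deriv :: "nat \<Rightarrow> (real \<Rightarrow> complex) \<Rightarrow> real \<Rightarrow> complex" where
  "weak_deriv n f = (SOME g. has_weak_deriv n f g)"

definition L1_H1dot_norm :: "(real \<Rightarrow> complex) \<Rightarrow> ennreal" where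
  "L1_H1dot_norm q = L1_norm q +
     (if \<exists>g. has_weak_deriv 1 q g then L2_norm (weak_deriv 1 q) else \<infinity>)"

section \<open>Tempered distributions, Fourier multipliers and the spaces of analytic functions\<close>

text \<open>A tempered distribution is a functional on Schwartz functions; its values on
  other functions are irrelevant. The pairing of functions is bilinear (no conjugation).\<close>

type_synonym distr = "(real \<Rightarrow> complex) \<Rightarrow> complex"

definition tempered :: "distr \<Rightarrow> bool" where
  "tempered T \<longleftrightarrow>
     (\<forall>\<phi>\<in>schwartz. \<forall>\<psi>\<in>schwartz. \<forall>a b. T (\<lambda>x. a * \<phi> x + b * \<psi> x) = a * T \<phi> + b * T \<psi>) \<and>
     (\<exists>C N. \<forall>\<phi>\<in>schwartz.
        norm (T \<phi>) \<le> C * (\<Sum>k\<le>N. \<Sum>n\<le>N. SUP x. \<bar>x\<bar> ^ k * norm ((ddx ^^ n) \<phi> x)))"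

definition distr_of :: "(real \<Rightarrow> complex) \<Rightarrow> distr" where
  "distr_of f = (\<lambda>\<phi>. LBINT x. f x * \<phi> x)"

definition represents :: "(real \<Rightarrow> complex) \<Rightarrow> distr \<Rightarrow> bool" where
  "represents f T \<longleftrightarrow> f \<in> borel_measurable lborel \<and>
     (\<forall>\<phi>\<in>schwartz. integrable lborel (\<lambda>x. f x * \<phi> x) \<and> T \<phi> = distr_of f \<phi>)"

definition fourier :: "(real \<Rightarrow> complex) \<Rightarrow> real \<Rightarrow> complex" where
  "fourier f = (\<lambda>\<xi>. complex_of_real (1 / sqrt (2 * pi)) *
     (LBINT x. f x * exp (- \<i> * complex_of_real (x * \<xi>))))"

definition fourier_distr :: "distr \<Rightarrow> distr" where
  "fourier_distr T = (\<lambda>\<phi>. T (fourier \<phi>))"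

definition deriv_distr :: "distr \<Rightarrow> distr" where
  "deriv_distr T = (\<lambda>\<phi>. - T (ddx \<phi>))"

text \<open>\<open>G = m(D) T\<close> for a smooth, possibly exponentially growing symbol \<open>m\<close>: \<open>G\<close> is tempered and
  its Fourier transform equals \<open>m\<close> times that of \<open>T\<close>. The identity is tested against
  compactly supported functions, since multiplication by \<open>m\<close> need not preserve \<^const>\<open>schwartz\<close>.\<close>

definition is_multiplier :: "(real \<Rightarrow> complex) \<Rightarrow> distr \<Rightarrow> distr \<Rightarrow> bool" where
  "is_multiplier m T G \<longleftrightarrow> tempered G \<and>
     (\<forall>\<phi>\<in>test_functions UNIV. fourier_distr G \<phi> = fourier_distr T (\<lambda>\<xi>. m \<xi> * \<phi> \<xi>))"

text \<open>In the following norms of distributions the infimum ranges over objects that are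
  unique (almost everywhere, respectively on \<^const>\<open>schwartz\<close>) if they exist; if there are none, it is \<open>\<infinity>\<close>.\<close>

definition Linf_norm_distr :: "distr \<Rightarrow> ennreal" where
  "Linf_norm_distr T = (INF f\<in>{f. represents f T}. Linf_norm f)"

definition Hs_norm :: "real \<Rightarrow> distr \<Rightarrow> ennreal" where
  "Hs_norm s T = (INF g\<in>{g. represents g (fourier_distr T)}.
     L2_norm (\<lambda>\<xi>. complex_of_real (sqrt (1 + \<xi>\<^sup>2) powr s) * g \<xi>))"

definition Zs_norm :: "real \<Rightarrow> distr \<Rightarrow> ennreal" where
  "Zs_norm s T = Linf_norm_distr T + Hs_norm (s - 1/2) (deriv_distr T)"

definition A_norm :: "(distr \<Rightarrow> ennreal) \<Rightarrow> real \<Rightarrow> distr \<Rightarrow> ennreal" where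
  "A_norm X \<tau> T =
     (INF G\<in>{G. is_multiplier (\<lambda>\<xi>. complex_of_real (exp (\<tau> * \<xi>))) T G}. X G) +
     (INF G\<in>{G. is_multiplier (\<lambda>\<xi>. complex_of_real (exp (- \<tau> * \<xi>))) T G}. X G)"

text \<open>A space \<open>X\<close> is given by its norm.\<close>

definition in_A :: "(distr \<Rightarrow> ennreal) \<Rightarrow> real \<Rightarrow> (real \<Rightarrow> complex) \<Rightarrow> bool" where
  "in_A X \<tau> f \<longleftrightarrow> represents f (distr_of f) \<and> tempered (distr_of f) \<and>
     X (distr_of f) < \<infinity> \<and> A_norm X \<tau> (distr_of f) < \<infinity>"

section \<open>The initial data\<close>

definition nonzero_smooth_supported :: "real \<Rightarrow> (real \<Rightarrow> complex) \<Rightarrow> bool" where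
  "nonzero_smooth_supported x0 f \<longleftrightarrow>
     (\<forall>x\<in>{-x0<..<x0}. f x \<noteq> 0) \<and> smooth_on {-x0<..<x0} f \<and> {x. f x \<noteq> 0} \<subseteq> {-x0..x0}"

definition y0 :: "(real \<Rightarrow> complex) \<Rightarrow> real \<Rightarrow> real" where
  "y0 u0 x = (LBINT \<zeta>=ereal 0..ereal x. 1 / norm (u0 \<zeta>))"

definition initial_data :: "real \<Rightarrow> (real \<Rightarrow> complex) set" where
  "initial_data x0 = {u0.
     u0 \<in> borel_measurable lborel \<and> L2_norm u0 < \<infinity> \<and>
     nonzero_smooth_supported x0 u0 \<and>
     \<not> set_integrable lborel {-x0<..<0} (\<lambda>x. 1 / norm (u0 x)) \<and>
     \<not> set_integrable lborel {0<..<x0} (\<lambda>x. 1 / norm (u0 x)) \<and>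
     (\<exists>U0. (\<forall>x\<in>{-x0<..<x0}. U0 (y0 u0 x) = u0 x) \<and>
        (\<exists>s \<tau>0. 0 < s \<and> s \<le> 1/2 \<and> 0 < \<tau>0 \<and> \<tau>0 \<le> 1 \<and>
           in_A (Hs_norm s) \<tau>0 U0 \<and>
           in_A (Zs_norm s) \<tau>0 (\<lambda>y. cnj (U0 y) * ddx U0 y / complex_of_real ((norm (U0 y))\<^sup>2))))}"

section \<open>The equation\<close>

definition mass :: "(real \<Rightarrow> complex) \<Rightarrow> real" where
  "mass f = (LBINT x. (norm (f x))\<^sup>2)"

definition momentum :: "(real \<Rightarrow> complex) \<Rightarrow> real" where
  "momentum f = Im (LBINT x. f x * cnj (weak_deriv 1 f x))"

definition energy :: "real \<Rightarrow> (real \<Rightarrow> complex) \<Rightarrow> real" where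
  "energy \<mu> f = (LBINT x. (norm (f x * weak_deriv 1 f x))\<^sup>2) - \<mu> / 2 * (LBINT x. norm (f x) ^ 4)"

text \<open>\<open>f \<in> C([0,T]; X)\<close>, where the space \<open>X\<close> of functions is given by its norm.\<close>

definition continuous_into ::
  "((real \<Rightarrow> complex) \<Rightarrow> ennreal) \<Rightarrow> real \<Rightarrow> (real \<Rightarrow> real \<Rightarrow> complex) \<Rightarrow> bool" where
  "continuous_into X T f \<longleftrightarrow>
     (\<forall>t\<in>{0..T}. f t \<in> borel_measurable lborel \<and> X (f t) < \<infinity> \<and>
        ((\<lambda>s. X (\<lambda>x. f s x - f t x)) \<longlongrightarrow> 0) (at t within {0..T}))"

text \<open>The equation $i u_t = \bar u (u u_x)_x + \mu |u|^2 u$ on $(0,T) \times \mathbb R$ in the sense of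
  distributions, where $(u u_x)_x$ is the weak derivative $(\frac12 u^2)_{xx}$. The integral is
  iterated because the chosen representative of $(\frac12 u^2)_{xx}(t)$ need not be
  jointly measurable in $(t,x)$.\<close>

definition solves_equation :: "real \<Rightarrow> real \<Rightarrow> (real \<Rightarrow> real \<Rightarrow> complex) \<Rightarrow> bool" where
  "solves_equation \<mu> T u \<longleftrightarrow> (\<forall>\<phi>\<in>test_functions ({0<..<T} \<times> UNIV).
     (LBINT t. LBINT x. - \<i> * u t x * vector_derivative (\<lambda>s. \<phi> (s, x)) (at t)) =
     (LBINT t. LBINT x. (cnj (u t x) * weak_deriv 2 (\<lambda>z. (u t z)\<^sup>2 / 2) x
        + complex_of_real (\<mu> * (norm (u t x))\<^sup>2) * u t x) * \<phi> (t, x)))"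

text \<open>\<open>u\<close> is a solution on \<open>[0,T]\<close> with initial data \<open>u0\<close> as provided by the local
  well-posedness theorem.\<close>

definition lwp_solution ::
  "real \<Rightarrow> real \<Rightarrow> (real \<Rightarrow> complex) \<Rightarrow> real \<Rightarrow> (real \<Rightarrow> real \<Rightarrow> complex) \<Rightarrow> bool" where
  "lwp_solution \<mu> x0 u0 T u \<longleftrightarrow>
     continuous_into L2_norm T u \<and>
     solves_equation \<mu> T u \<and>
     (AE x in lborel. u 0 x = u0 x) \<and>
     continuous_on ({0..T} \<times> UNIV) (\<lambda>(t, x). u t x) \<and>
     (\<forall>t\<in>{0..T}. has_weak_deriv 1 (u t) (weak_deriv 1 (u t))) \<and>
     continuous_into Linf_norm T (\<lambda>t. weak_deriv 1 (u t)) \<and>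
     (\<forall>t\<in>{0..T}. has_weak_deriv 2 (\<lambda>x. (u t x)\<^sup>2 / 2) (weak_deriv 2 (\<lambda>x. (u t x)\<^sup>2 / 2))) \<and>
     continuous_into Linf_norm T (\<lambda>t. weak_deriv 2 (\<lambda>x. (u t x)\<^sup>2 / 2)) \<and>
     (\<forall>t\<in>{0..T}. nonzero_smooth_supported x0 (u t) \<and>
        mass (u t) = mass u0 \<and> momentum (u t) = momentum u0 \<and> energy \<mu> (u t) = energy \<mu> u0)"

definition compacton :: "real \<Rightarrow> real \<Rightarrow> complex" where
  "compacton \<omega> x = complex_of_real
     (sqrt (2 * \<omega>) * cos (x / sqrt 2) * indicator {- pi / sqrt 2<..<pi / sqrt 2} x)"

end

theory Submission
  imports Defs "HOL-Computational_Algebra.Polynomial"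
begin

text \<open>
  In terms of $q = u^2$ the mass is $\int |q|$ and the energy is $E(q) = \frac14\int |q_x|^2 - \frac12\int |q|^2$,
  and the claim reduces to the orbital stability of $Q = \phi_\omega^2$ as a minimiser of \<open>E\<close> at fixed mass; no
  continuity in time is needed. Let $A = \max |q| = |q(0)|$, $\rho = |q|$, $m = \int \rho$, and let \<open>L\<close> be the length of the
  support of \<open>Q\<close>. Completing the square on each side of the maximum (a Bogomolny argument) gives the identity
  $$4 E(q) + \frac{2 m^2}{L} = \frac L2\Bigl(A - \frac{2m}{L}\Bigr)^2
    + \int \Bigl| q_x + \mathrm{sgn}(x) \sqrt{2\rho(A-\rho)}\,\frac{q}{\rho} \Bigr|^2 dx .$$
  If the left-hand side is small, then \<open>A\<close> is determined by the mass, and after a rotation making $q(0)$ positive,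
  the real part of \<open>q\<close> is almost a supersolution of the equation $R' = -\sqrt{2R(A-R)}$ solved by the compacton.
  A Gronwall argument bounds it from below by the compacton; as the masses agree, \<open>q\<close> is close to \<open>Q\<close> in \<open>L\<^sup>2\<close>,
  hence in \<open>L\<^sup>1\<close> since the supports are bounded. Finally $-\frac12 Q'' - Q = -\omega$ on the support of \<open>Q\<close>, so the expansion of the energy
  at \<open>Q\<close> upgrades this to closeness of the derivatives.
\<close>

section \<open>Bump functions and the fundamental lemma of the calculus of variations\<close>

text \<open>The obstacle is that a vanishing Bogomolny integral does not single out the compacton: a
  profile that stays at its maximum on an interval before it descends also makes it vanish. Only the
  term with the mass excludes such a plateau. This is why the differential inequality yields a lower
  bound only, and the opposite bound has to come from comparing integrals. The square root is the
  one for which the cross term of the square is an exact derivative of a function of |q|. There is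
  no minimising sequence and no compactness argument: the translation is the position of the maximum
  of |q|, the rotation is the phase there, and apart from one appeal to continuity all constants are
  explicit.

  The remaining work is to reach \<open>q\<close>. The energy is written with
  \<open>weak_deriv\<close>, an arbitrary choice of representative, whereas the argument
  differentiates classically inside the support and needs a bounded derivative up to its ends. The
  fundamental lemma on compact subintervals identifies the two derivatives, and it needs bump
  functions of all orders of smoothness.\<close>

lemma tendsto_poly_div_exp_0: "((\<lambda>t::real. t ^ k * poly p t / exp t) \<longlongrightarrow> 0) at_top"
proof (induction p arbitrary: k)
  case 0
  then show ?case by simp
next
  case (pCons a p)
  \<comment> \<open>The Horner step raises the power of t by one, which is why k is kept
    arbitrary.\<close>
  have "((\<lambda>t::real. a * (t ^ k / exp t) + t ^ Suc k * poly p t / exp t) \<longlongrightarrow> a * 0 + 0) at_top"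
    by (intro tendsto_intros tendsto_power_div_exp_0 pCons.IH)
  then show ?case
    by (simp add: field_simps)
qed

text \<open>Functions $p(1/x)\,e^{-1/x}$ extended by zero; the family is closed under differentiation, which gives smoothness at \<open>0\<close>.\<close>

definition flat :: "real poly \<Rightarrow> real \<Rightarrow> real" where
  "flat p x = (if x > 0 then poly p (1 / x) * exp (- (1 / x)) else 0)"

text \<open>With t = 1/x one has dt/dx = - t^2, so p(t) e^{-t} differentiates in x to t^2 (p(t) -
  p'(t)) e^{-t}; the factor \<open>[:0, 0, 1:]\<close> is t^2.\<close>

definition flat_deriv :: "real poly \<Rightarrow> real poly" where
  "flat_deriv p = [:0, 0, 1:] * (p - pderiv p)"

lemma DERIV_flat: "(flat p has_real_derivative flat (flat_deriv p) x) (at x)"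
proof -
  consider "x > 0" | "x < 0" | "x = 0" by linarith
  then show ?thesis
  proof cases
    case 1
    have "((\<lambda>x. poly p (1 / x) * exp (- (1 / x))) has_real_derivative flat (flat_deriv p) x) (at x)"
      using 1 by (auto intro!: derivative_eq_intros
          simp: flat_def flat_deriv_def power2_eq_square field_simps)
    then show ?thesis
      by (rule has_field_derivative_transform_within_open[where S="{0<..}"])
        (use 1 in \<open>auto simp: flat_def\<close>)
  next
    case 2
    have "((\<lambda>x. 0) has_real_derivative flat (flat_deriv p) x) (at x)"
      using 2 by (simp add: flat_def)
    then show ?thesis
      by (rule has_field_derivative_transform_within_open[where S="{..<0}"])
        (use 2 in \<open>auto simp: flat_def\<close>)
  next
    case 3
    have "((\<lambda>h. flat p h / h) \<longlongrightarrow> 0) (at_right 0)"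
    proof -
      have "filterlim (\<lambda>h::real. 1 / h) at_top (at_right 0)"
        using filterlim_inverse_at_top_right by (simp add: inverse_eq_divide)
      from filterlim_compose[OF tendsto_poly_div_exp_0[of 1 p] this]
      have "((\<lambda>h::real. (1/h) * poly p (1/h) / exp (1/h)) \<longlongrightarrow> 0) (at_right 0)"
        by simp
      then show ?thesis
        by (rule Lim_transform_eventually)
          (auto simp: flat_def eventually_at_filter exp_minus field_simps intro!: always_eventually)
    qed
    moreover have "((\<lambda>h. flat p h / h) \<longlongrightarrow> 0) (at_left 0)"
      by (rule Lim_transform_eventually[OF tendsto_const])
        (auto simp: flat_def eventually_at_filter)
    ultimately have "((\<lambda>h. flat p h / h) \<longlongrightarrow> 0) (at 0)"
      by (simp add: filterlim_split_at)
    then show ?thesis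
      using 3 by (simp add: DERIV_def flat_def)
  qed
qed

text \<open>The product rule leaves the set of single products of flat functions but not their span,
  so smoothness becomes an induction over the order of the derivative.\<close>

inductive bump_span :: "real \<Rightarrow> real \<Rightarrow> real \<Rightarrow> (real \<Rightarrow> real) \<Rightarrow> bool" for c d N where
  base: "bump_span c d N (\<lambda>x. r * (flat p (N * (x - c)) * flat q (N * (d - x))))"
| add: "bump_span c d N f \<Longrightarrow> bump_span c d N g \<Longrightarrow> bump_span c d N (\<lambda>x. f x + g x)"

text \<open>A derivative in direction v is v times the ordinary one, and \<open>Ck_on\<close> asks
  for every direction.\<close>

lemma bump_span_scale:
  "bump_span c d N f \<Longrightarrow> bump_span c d N (\<lambda>x. k * f x)"
proof (induction rule: bump_span.induct)
  case (base r p q)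
  then show ?case
    using bump_span.base[of c d N "k * r" p q] by (simp add: mult.assoc)
next
  case (add f g)
  then show ?case
    using bump_span.add[OF add.IH] by (simp add: distrib_left)
qed

lemma bump_span_DERIV:
  "bump_span c d N f \<Longrightarrow> \<exists>f'. bump_span c d N f' \<and> (\<forall>x. (f has_real_derivative f' x) (at x))"
proof (induction rule: bump_span.induct)
  case (base r p q)
  let ?f' = "\<lambda>x. r * N * (flat (flat_deriv p) (N * (x - c)) * flat q (N * (d - x)))
      + - r * N * (flat p (N * (x - c)) * flat (flat_deriv q) (N * (d - x)))"
  have "bump_span c d N ?f'"
    by (intro bump_span.intros)
  moreover have "((\<lambda>x. r * (flat p (N * (x - c)) * flat q (N * (d - x)))) has_real_derivative ?f' x) (at x)" for x
    by (auto intro!: derivative_eq_intros DERIV_chain2[OF DERIV_flat] simp: algebra_simps)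
  ultimately show ?case by blast
next
  case (add f g)
  then obtain f' g' where "bump_span c d N f'" "bump_span c d N g'"
    "\<forall>x. (f has_real_derivative f' x) (at x)" "\<forall>x. (g has_real_derivative g' x) (at x)" by blast
  then show ?case
    by (intro exI[of _ "\<lambda>x. f' x + g' x"]) (auto intro: bump_span.add derivative_intros)
qed

lemma Ck_on_bump_span: "bump_span c d N f \<Longrightarrow> Ck_on n UNIV (\<lambda>x. complex_of_real (f x))"
proof (induction n arbitrary: f)
  case 0
  then obtain f' where "\<And>x. (f has_real_derivative f' x) (at x)"
    using bump_span_DERIV by blast
  then have "continuous_on UNIV f"
    by (meson DERIV_isCont continuous_at_imp_continuous_on)
  then show ?case
    by (auto intro!: continuous_intros)
next
  case (Suc n)
  then obtain f' where f': "bump_span c d N f'" "\<And>x. (f has_real_derivative f' x) (at x)"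
    using bump_span_DERIV by blast
  have der: "((\<lambda>x. complex_of_real (f x)) has_derivative (\<lambda>v. complex_of_real (v * f' x))) (at x)" for x
    using f'(2)[of x] by (auto intro!: derivative_eq_intros simp: has_field_derivative_def mult.commute)
  have "frechet_derivative (\<lambda>x. complex_of_real (f x)) (at x) v = complex_of_real (v * f' x)" for x v
    using frechet_derivative_at[OF der[of x]] by metis
  moreover have "Ck_on n UNIV (\<lambda>x. complex_of_real (v * f' x))" for v
    by (rule Suc.IH[OF bump_span_scale[OF f'(1)]])
  moreover have "(\<lambda>x. complex_of_real (f x)) differentiable (at x)" for x
    using der by (rule differentiableI)
  ultimately show ?case by simp
qed

text \<open>On (c, d) this is exp(-1/(N (x - c)) - 1/(N (d - x))). The support does not depend on N
  and the values lie in [0, 1], so letting N tend to infinity recovers the indicator of the interval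
  by dominated convergence, without a mollifier.\<close>

definition bump :: "real \<Rightarrow> real \<Rightarrow> real \<Rightarrow> real \<Rightarrow> real" where
  "bump c d N x = flat 1 (N * (x - c)) * flat 1 (N * (d - x))"

lemma bump_eq_0: "N > 0 \<Longrightarrow> x \<notin> {c<..<d} \<Longrightarrow> bump c d N x = 0"
  by (auto simp: bump_def flat_def zero_less_mult_iff)

lemma bump_in_test_functions:
  assumes "N > 0"
  shows "(\<lambda>x. complex_of_real (bump c d N x)) \<in> test_functions UNIV"
proof -
  have "bump_span c d N (bump c d N)"
    using bump_span.base[of c d N 1 1 1] by (simp add: bump_def[abs_def])
  moreover have "x \<in> {c..d}" if "bump c d N x \<noteq> 0" for x
    using bump_eq_0[OF assms, of x c d] that by fastforce
  then have "{x. complex_of_real (bump c d N x) \<noteq> 0} \<subseteq> {c..d}"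
    by auto
  then have "compact (closure {x. complex_of_real (bump c d N x) \<noteq> 0})"
    by (meson bounded_closed_interval bounded_subset compact_closure)
  ultimately show ?thesis
    using Ck_on_bump_span by (auto simp: test_functions_def smooth_on_def)
qed

lemma bump_bounds: "0 \<le> bump c d N x" "bump c d N x \<le> 1"
  by (auto simp: bump_def flat_def intro!: mult_le_one)

lemma tendsto_bump: "(\<lambda>n. bump c d (real (Suc n)) x) \<longlonglongrightarrow> indicator {c<..<d} x"
proof (cases "x \<in> {c<..<d}")
  case True
  have *: "(\<lambda>n. exp (- (1 / (real (Suc n) * y)))) \<longlonglongrightarrow> 1" for y :: real
  proof -
    have "(\<lambda>n. exp (- (1 / real (Suc n) * (1 / y)))) \<longlonglongrightarrow> exp (- (0 * (1 / y)))"
      by (intro tendsto_intros LIMSEQ_Suc[OF lim_1_over_n])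
    then show ?thesis by simp
  qed
  have "(\<lambda>n. exp (- (1 / (real (Suc n) * (x - c)))) * exp (- (1 / (real (Suc n) * (d - x))))) \<longlonglongrightarrow> 1 * 1"
    by (intro tendsto_mult *)
  moreover have "bump c d (real (Suc n)) x = exp (- (1 / (real (Suc n) * (x - c)))) * exp (- (1 / (real (Suc n) * (d - x))))" for n
    using True by (auto simp: bump_def flat_def zero_less_mult_iff)
  ultimately show ?thesis using True by simp
next
  case False
  then show ?thesis by (simp add: bump_eq_0)
qed

lemma fundamental_lemma_interval:
  fixes h :: "real \<Rightarrow> complex"
  assumes int: "set_integrable lborel {c..d} h"
    and test: "\<And>\<phi>. \<phi> \<in> test_functions UNIV \<Longrightarrow> (\<And>x. x \<notin> {c<..<d} \<Longrightarrow> \<phi> x = 0) \<Longrightarrow>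
      (LBINT x. h x * \<phi> x) = 0"
  shows "AE x in lborel. x \<in> {c..d} \<longrightarrow> h x = 0"
proof -
  define H where "H x = indicator {c..d} x *\<^sub>R h x" for x
  have H: "integrable lborel H"
    using int unfolding set_integrable_def H_def .
  have sub: "(LBINT x. indicator {l<..<u} x *\<^sub>R H x) = 0" if "c \<le> l" "u \<le> d" for l u
  proof -
    have "(\<lambda>n. LBINT x. bump l u (real (Suc n)) x *\<^sub>R H x) \<longlonglongrightarrow> (LBINT x. indicator {l<..<u} x *\<^sub>R H x)"
    proof (rule integral_dominated_convergence[where w="\<lambda>x. norm (H x)"])
      have "continuous_on UNIV (bump l u (real (Suc n)))" for n
        unfolding bump_def[abs_def]
        by (intro continuous_at_imp_continuous_on ballI continuous_intros
            isCont_o2[OF _ DERIV_isCont[OF DERIV_flat]])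
      then show "(\<lambda>x. bump l u (real (Suc n)) x *\<^sub>R H x) \<in> borel_measurable lborel" for n
        using H by (intro borel_measurable_scaleR) (auto intro: borel_measurable_continuous_onI)
    next
      show "AE x in lborel. norm (bump l u (real (Suc n)) x *\<^sub>R H x) \<le> norm (H x)" for n
        using bump_bounds by (auto intro!: AE_I2 mult_left_le_one_le)
    next
      show "AE x in lborel. (\<lambda>n. bump l u (real (Suc n)) x *\<^sub>R H x) \<longlonglongrightarrow> indicator {l<..<u} x *\<^sub>R H x"
        by (intro AE_I2 tendsto_scaleR tendsto_bump tendsto_const)
    qed (use H in auto)
    moreover have "(LBINT x. bump l u (real (Suc n)) x *\<^sub>R H x) = 0" for n
    proof -
      have z: "bump l u (real (Suc n)) x = 0" if "x \<notin> {c<..<d}" for x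
        using that \<open>c \<le> l\<close> \<open>u \<le> d\<close> by (intro bump_eq_0) auto
      have "(LBINT x. bump l u (real (Suc n)) x *\<^sub>R H x) =
          (LBINT x. h x * complex_of_real (bump l u (real (Suc n)) x))"
      proof (rule Bochner_Integration.integral_cong[OF refl])
        fix x show "bump l u (real (Suc n)) x *\<^sub>R H x = h x * complex_of_real (bump l u (real (Suc n)) x)"
          using z[of x] by (cases "x \<in> {c<..<d}") (auto simp: H_def scaleR_conv_of_real)
      qed
      also have "\<dots> = 0"
        using z by (intro test bump_in_test_functions) auto
      finally show ?thesis .
    qed
    ultimately show ?thesis
      by (simp add: LIMSEQ_const_iff)
  qed
  have Icc: "(LBINT x:{l..u}. H x) = 0" for l u
  proof -
    have "(LBINT x:{l..u}. H x) = (LBINT x. indicator {max l c<..<min u d} x *\<^sub>R H x)"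
      unfolding set_lebesgue_integral_def
    proof (rule integral_cong_AE)
      \<comment> \<open>Closed and open intervals differ by their end points; cutting at c and d
        leads back to \<open>sub\<close>.\<close>
      have "AE x in lborel. x \<noteq> max l c \<and> x \<noteq> min u d"
        by (auto simp: AE_conj_iff intro!: AE_lborel_singleton)
      then show "AE x in lborel. indicator {l..u} x *\<^sub>R H x = indicator {max l c<..<min u d} x *\<^sub>R H x"
        by eventually_elim (auto simp: H_def indicator_def max_def min_def)
    qed (use H in auto)
    also have "\<dots> = 0" by (rule sub) auto
    finally show ?thesis .
  qed
  have UN: "(LBINT x. H x) = 0"
  proof -
    have "(LBINT x. H x) = (LBINT x:{c..d}. H x)"
      unfolding set_lebesgue_integral_def
      by (rule Bochner_Integration.integral_cong) (auto simp: H_def indicator_def)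
    then show ?thesis using Icc by simp
  qed
  have int_set: "set_integrable lborel A H" if "A \<in> sets borel" for A
    using that H unfolding set_integrable_def by (intro integrable_mult_indicator) auto
  have all: "(LBINT x:A. H x) = 0" if "A \<in> sets borel" for A
  proof -
    have "Int_stable (range (\<lambda>(a, b). {a..b::real}))"
      by (auto simp: Int_stable_def)
    moreover have "range (\<lambda>(a, b). {a..b::real}) \<subseteq> Pow UNIV" by simp
    moreover have "A \<in> sigma_sets UNIV (range (\<lambda>(a, b). {a..b::real}))"
      using that by (simp add: borel_eq_atLeastAtMost)
    ultimately show ?thesis
    proof (induction rule: sigma_sets_induct_disjoint)
      case (basic A)
      then show ?case using Icc by auto
    next
      case empty
      then show ?case by (simp add: set_lebesgue_integral_def)
    next
      case (compl A)
      have "A \<in> sets borel" using compl by (simp add: borel_eq_atLeastAtMost)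
      then have "(LBINT x:UNIV. H x) = (LBINT x:A. H x) + (LBINT x:UNIV - A. H x)"
        using set_integral_Un[of A "UNIV - A" lborel H] int_set by auto
      then show ?case using compl UN by (simp add: set_lebesgue_integral_def)
    next
      case (union A)
      have "A i \<in> sigma_sets UNIV (range (\<lambda>(a, b). {a..b::real}))" for i
        using union by blast
      then have "\<And>i. A i \<in> sets borel" by (simp add: borel_eq_atLeastAtMost)
      then have "(LBINT x:(\<Union>i. A i). H x) = (\<Sum>i. (LBINT x:A i. H x))"
        using union int_set
        by (intro lebesgue_integral_countable_add) (auto simp: disjoint_family_on_def)
      then show ?case using union by simp
    qed
  qed
  have "AE x in lborel. H x = 0"
    by (rule sigma_finite_measure.density_zero[OF sigma_finite_lborel H]) (use all in auto)
  then show ?thesis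
    by eventually_elim (simp add: H_def indicator_def)
qed

section \<open>Weak derivatives\<close>

lemma integrable_bounded_Icc:
  fixes f :: "real \<Rightarrow> 'a::{banach, second_countable_topology}"
  assumes "f \<in> borel_measurable borel" "\<And>x. norm (f x) \<le> C" "\<And>x. x \<notin> {a..b} \<Longrightarrow> f x = 0"
  shows "integrable lborel f"
proof (rule Bochner_Integration.integrable_bound)
  show "integrable lborel (\<lambda>x. C * indicator {a..b} x :: real)"
    by (intro integrable_mult_right integrable_real_indicator) (auto simp: emeasure_lborel_Icc_eq)
  show "AE x in lborel. norm (f x) \<le> norm (C * indicator {a..b} x :: real)"
    using assms(2,3) by (auto intro!: AE_I2 simp: indicator_def intro: order_trans[OF _ abs_ge_self])
qed (use assms in auto)

text \<open>The exceptional set serves products of a profile with the compacton: the ends of the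
  support of the profile may lie inside that of the compacton, and differentiability can fail there.
  An integrand that vanishes off the interval turns the formula on the interval into one over the
  line.\<close>

lemma LBINT_FTC_strong:
  fixes H H' :: "real \<Rightarrow> 'a::euclidean_space"
  assumes "finite S" "a \<le> b" "continuous_on {a..b} H"
    and "\<And>x. x \<in> {a<..<b} - S \<Longrightarrow> (H has_vector_derivative H' x) (at x)"
    and int: "integrable lborel H'" and "\<And>x. x \<notin> {a<..<b} \<Longrightarrow> H' x = 0"
  shows "(LBINT x. H' x) = H b - H a"
proof -
  have "(H' has_integral (H b - H a)) {a..b}"
    using assms by (intro fundamental_theorem_of_calculus_interior_strong[OF \<open>finite S\<close>]) auto
  moreover have "(H' has_integral (LBINT x. H' x)) {a..b}"
  proof -
    have "((\<lambda>x. if x \<in> {a..b} then H' x else 0) has_integral (LBINT x. H' x)) UNIV"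
      using has_integral_integral_lborel[OF int]
      by (rule has_integral_eq[rotated]) (use assms(6) in force)
    then show ?thesis
      unfolding has_integral_restrict_UNIV .
  qed
  ultimately show ?thesis
    by (rule has_integral_unique[symmetric])
qed

lemmas LBINT_FTC = LBINT_FTC_strong[OF finite.emptyI, unfolded Diff_empty]

lemma test_functionD:
  assumes "\<phi> \<in> test_functions (UNIV :: real set)"
  shows "(\<phi> has_vector_derivative ddx \<phi> x) (at x)"
    and "continuous_on UNIV \<phi>" and "continuous_on UNIV (ddx \<phi>)"
proof -
  have 1: "Ck_on 1 UNIV \<phi>"
    using assms by (auto simp: test_functions_def smooth_on_def)
  have diff: "\<phi> differentiable (at x)" for x
    using 1 by simp
  show der: "(\<phi> has_vector_derivative ddx \<phi> x) (at x)" for x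
    using diff[of x] by (simp add: ddx_def vector_derivative_works)
  have "frechet_derivative \<phi> (at x) 1 = ddx \<phi> x" for x
    using frechet_derivative_at[OF der[of x, unfolded has_vector_derivative_def]]
    by (metis scaleR_one)
  moreover have "continuous_on UNIV (\<lambda>x. frechet_derivative \<phi> (at x) 1)"
    using 1 by simp
  ultimately show "continuous_on UNIV (ddx \<phi>)" by (simp only:)
  show "continuous_on UNIV \<phi>"
    using der by (meson continuous_at_imp_continuous_on has_vector_derivative_continuous)
qed

lemma test_function_support:
  assumes "\<phi> \<in> test_functions (UNIV :: real set)"
  shows "\<exists>M. \<forall>x. x \<notin> {-M..M} \<longrightarrow> \<phi> x = 0 \<and> ddx \<phi> x = 0"
proof -
  have comp: "compact (closure {x. \<phi> x \<noteq> 0})"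
    using assms by (auto simp: test_functions_def)
  then obtain M where "\<forall>x\<in>closure {x. \<phi> x \<noteq> 0}. norm x \<le> M"
    using compact_imp_bounded bounded_iff by blast
  then have z: "\<phi> x = 0" if "x \<notin> {-M..M}" for x
    using closure_subset[of "{x. \<phi> x \<noteq> 0}"] that by (force simp: abs_le_iff)
  have "ddx \<phi> x = 0" if "x \<notin> {-M..M}" for x
  proof -
    have "(\<phi> has_vector_derivative 0) (at x)"
      by (rule has_vector_derivative_transform_within_open[of "\<lambda>_. 0" _ _ "- {-M..M}"])
        (use that z in auto)
    then show ?thesis
      using test_functionD(1)[OF assms] vector_derivative_unique_at by blast
  qed
  with z show ?thesis by blast
qed

lemma integrable_mult_test:
  assumes "locally_integrable f" "continuous_on UNIV \<phi>" "\<And>x. x \<notin> {-M..M} \<Longrightarrow> \<phi> x = 0"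
  shows "integrable lborel (\<lambda>x. f x * \<phi> x :: complex)"
proof -
  have "compact (\<phi> ` {-M..M})"
    using assms(2) by (intro compact_continuous_image) (auto intro: continuous_on_subset)
  then obtain C where C: "\<And>x. x \<in> {-M..M} \<Longrightarrow> norm (\<phi> x) \<le> C"
    using compact_imp_bounded bounded_iff by (metis imageI)
  have f: "integrable lborel (\<lambda>x. indicator {-M..M} x *\<^sub>R f x)"
    using assms(1) unfolding locally_integrable_def set_integrable_def by blast
  have "integrable lborel (\<lambda>x. indicator {-M..M} x *\<^sub>R f x * \<phi> x)"
  proof (rule Bochner_Integration.integrable_bound)
    show "integrable lborel (\<lambda>x. C *\<^sub>R (indicator {-M..M} x *\<^sub>R f x))"
      using f by (rule integrable_scaleR_right)
    show "AE x in lborel. norm (indicator {-M..M} x *\<^sub>R f x * \<phi> x) \<le> norm (C *\<^sub>R (indicator {-M..M} x *\<^sub>R f x))"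
    proof (rule AE_I2)
      fix x show "norm (indicator {-M..M} x *\<^sub>R f x * \<phi> x) \<le> norm (C *\<^sub>R (indicator {-M..M} x *\<^sub>R f x))"
      proof (cases "x \<in> {-M..M}")
        case True
        then show ?thesis
          using C[OF True] mult_right_mono[of "norm (\<phi> x)" "\<bar>C\<bar>" "norm (f x)"] by (simp add: norm_mult mult.commute)
      qed simp
    qed
    show "(\<lambda>x. indicator {-M..M} x *\<^sub>R f x * \<phi> x) \<in> borel_measurable lborel"
      using f assms(2) by (intro borel_measurable_times) (auto intro: borel_measurable_continuous_onI)
  qed
  moreover have "indicator {-M..M} x *\<^sub>R f x * \<phi> x = f x * \<phi> x" for x
    using assms(3)[of x] by (auto simp: indicator_def)
  ultimately show ?thesis by simp
qed

lemma AE_real_countable_Icc: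
  assumes "\<And>n::nat. AE x in lborel. x \<in> {a n..b n} \<longrightarrow> P x"
    and "\<And>x. x \<in> S \<Longrightarrow> \<exists>n. a n \<le> x \<and> x \<le> b n"
  shows "AE x in lborel. x \<in> S \<longrightarrow> P (x::real)"
proof -
  have "AE x in lborel. \<forall>n. x \<in> {a n..b n} \<longrightarrow> P x"
    unfolding AE_all_countable using assms(1) by blast
  then show ?thesis
    by eventually_elim (use assms(2) in force)
qed

text \<open>Since \<open>weak_deriv\<close> is an arbitrary choice, an explicitly known weak
  derivative can replace it only through this uniqueness. The difference of two candidates
  annihilates every test function, and the fundamental lemma applies on each [-n, n].\<close>

lemma has_weak_deriv_1_unique:
  assumes "has_weak_deriv 1 f g" "has_weak_deriv 1 f g'"
  shows "AE x in lborel. g x = g' x"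
proof -
  have "AE x in lborel. x \<in> {-real n..real n} \<longrightarrow> g x - g' x = 0" for n
  proof (rule fundamental_lemma_interval)
    have loc: "locally_integrable g" "locally_integrable g'"
      using assms by (auto simp: has_weak_deriv_def)
    then show "set_integrable lborel {-real n..real n} (\<lambda>x. g x - g' x)"
      unfolding locally_integrable_def by auto
    fix \<phi> :: "real \<Rightarrow> complex" assume \<phi>: "\<phi> \<in> test_functions UNIV"
    note M = test_functionD[OF \<phi>]
    obtain K where K: "\<And>x. x \<notin> {-K..K} \<Longrightarrow> \<phi> x = 0" "\<And>x. x \<notin> {-K..K} \<Longrightarrow> ddx \<phi> x = 0"
      using test_function_support[OF \<phi>] by blast
    have "(LBINT x. g x * \<phi> x) = (LBINT x. g' x * \<phi> x)"
      using assms \<phi> by (simp add: has_weak_deriv_def)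
    then show "(LBINT x. (g x - g' x) * \<phi> x) = 0"
      using integrable_mult_test[OF loc(1) M(2) K(1)] integrable_mult_test[OF loc(2) M(2) K(1)]
      by (simp add: left_diff_distrib)
  qed
  then have "AE x in lborel. x \<in> UNIV \<longrightarrow> g x - g' x = 0"
    by (rule AE_real_countable_Icc[where a="\<lambda>n. - real n"]) (meson abs_le_iff minus_le_iff real_arch_simple)
  then show ?thesis by simp
qed

text \<open>Weak derivatives are local: for a test function vanishing off (c, d) the fundamental
  theorem on [c, d] integrates by parts without boundary terms, whatever \<open>f\<close> does
  outside.\<close>

lemma weak_deriv_eq_deriv_Icc:
  assumes "has_weak_deriv 1 f g" "c < d" "continuous_on {c..d} f"
    and der: "\<And>x. x \<in> {c<..<d} \<Longrightarrow> (f has_vector_derivative f' x) (at x)"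
    and cont': "continuous_on {c..d} f'"
  shows "AE x in lborel. x \<in> {c..d} \<longrightarrow> g x = f' x"
proof -
  have loc: "locally_integrable f" "locally_integrable g"
    using assms(1) by (auto simp: has_weak_deriv_def)
  have gint: "set_integrable lborel {c..d} g" using loc by (auto simp: locally_integrable_def)
  have f'int: "set_integrable lborel {c..d} f'"
    using cont' by (rule borel_integrable_atLeastAtMost')
  have "AE x in lborel. x \<in> {c..d} \<longrightarrow> g x - f' x = 0"
  proof (rule fundamental_lemma_interval)
    show "set_integrable lborel {c..d} (\<lambda>x. g x - f' x)"
      using gint f'int by simp
    fix \<phi> :: "real \<Rightarrow> complex"
    assume \<phi>: "\<phi> \<in> test_functions UNIV" and zero: "\<And>x. x \<notin> {c<..<d} \<Longrightarrow> \<phi> x = 0"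
    note M = test_functionD[OF \<phi>]
  obtain K where K: "\<And>x. x \<notin> {-K..K} \<Longrightarrow> \<phi> x = 0" "\<And>x. x \<notin> {-K..K} \<Longrightarrow> ddx \<phi> x = 0"
    using test_function_support[OF \<phi>] by blast
    have zero': "ddx \<phi> x = 0" if "x \<notin> {c<..<d}" for x
    proof -
      have out: "ddx \<phi> x = 0" if "x \<in> {..<c} \<union> {d<..}" for x
      proof -
        have "(\<phi> has_vector_derivative 0) (at x)"
          by (rule has_vector_derivative_transform_within_open[of "\<lambda>_. 0" _ _ "{..<c} \<union> {d<..}"])
            (use that zero in auto)
        then show ?thesis using M(1) vector_derivative_unique_at by blast
      qed
      \<comment> \<open>At c and d themselves the derivative vanishes as a limit from
        outside.\<close>
      have "closure ({..<c} \<union> {d<..}) \<subseteq> {x. ddx \<phi> x = 0}"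
        using out M(3) by (intro closure_minimal closed_Collect_eq) auto
      then show ?thesis using that by (auto simp: closure_Un not_less)
    qed
    \<comment> \<open>Extension by zero makes \<open>f'\<close> locally integrable on the line, as
      \<open>integrable_mult_test\<close> requires.\<close>
    define F where "F x = indicator {c..d} x *\<^sub>R f' x" for x
    have Fl: "locally_integrable F"
      unfolding locally_integrable_def
    proof (intro allI)
      fix a b
      have "integrable lborel F" using f'int by (simp add: set_integrable_def F_def[abs_def])
      then show "set_integrable lborel {a..b} F"
        unfolding set_integrable_def by (intro integrable_mult_indicator) auto
    qed
    have F\<phi>: "F x * \<phi> x = f' x * \<phi> x" for x
      using zero[of x] by (auto simp: F_def indicator_def)
    have i: "integrable lborel (\<lambda>x. f' x * \<phi> x)" "integrable lborel (\<lambda>x. g x * \<phi> x)"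
        "integrable lborel (\<lambda>x. f x * ddx \<phi> x)"
      using integrable_mult_test[OF Fl M(2) K(1)] integrable_mult_test[OF loc(2) M(2) K(1)]
        integrable_mult_test[OF loc(1) M(3) K(2)] by (simp_all add: F\<phi>)
    have "(LBINT x. f x * ddx \<phi> x + f' x * \<phi> x) = f d * \<phi> d - f c * \<phi> c"
    proof (rule LBINT_FTC)
      show "continuous_on {c..d} (\<lambda>x. f x * \<phi> x)"
        using assms M(2) by (auto intro!: continuous_intros intro: continuous_on_subset)
      show "((\<lambda>x. f x * \<phi> x) has_vector_derivative f x * ddx \<phi> x + f' x * \<phi> x) (at x)"
        if "x \<in> {c<..<d}" for x
        using has_vector_derivative_mult[OF der[OF that] M(1)] .
    qed (use i assms(2) zero zero' in auto)
    then have "(LBINT x. f x * ddx \<phi> x) = - (LBINT x. f' x * \<phi> x)"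
      using zero i by (simp add: eq_neg_iff_add_eq_0)
    moreover have "(LBINT x. f x * ddx \<phi> x) = - (LBINT x. g x * \<phi> x)"
      using assms(1) \<phi> by (simp add: has_weak_deriv_def)
    ultimately show "(LBINT x. (g x - f' x) * \<phi> x) = 0"
      using i by (simp add: left_diff_distrib)
  qed
  then show ?thesis by simp
qed

section \<open>Profiles\<close>

text \<open>Squares $q = u(t)^2$ of solutions, on the interval \<open>(a, b)\<close> on which they do not vanish. The
  function \<open>q'\<close> is the derivative there and is set to \<open>0\<close> elsewhere.\<close>

definition profile :: "real \<Rightarrow> real \<Rightarrow> (real \<Rightarrow> complex) \<Rightarrow> (real \<Rightarrow> complex) \<Rightarrow> bool" where
  "profile a b q q' \<longleftrightarrow> a < b \<and> continuous_on UNIV q \<and> continuous_on {a<..<b} q' \<and>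
     bounded (range q') \<and>
     (\<forall>x\<in>{a<..<b}. q x \<noteq> 0 \<and> (q has_vector_derivative q' x) (at x)) \<and>
     (\<forall>x. x \<notin> {a<..<b} \<longrightarrow> q x = 0 \<and> q' x = 0)"

lemma profileD:
  assumes "profile a b q q'"
  shows "a < b" "continuous_on S q" "continuous_on {a<..<b} q'"
    "\<And>x. x \<in> {a<..<b} \<Longrightarrow> q x \<noteq> 0"
    "\<And>x. x \<in> {a<..<b} \<Longrightarrow> (q has_vector_derivative q' x) (at x)"
    "\<And>x. x \<notin> {a<..<b} \<Longrightarrow> q x = 0" "\<And>x. x \<notin> {a<..<b} \<Longrightarrow> q' x = 0"
  using assms continuous_on_subset[of UNIV q S] by (auto simp: profile_def)

lemma profile_measurable [measurable_dest]:
  assumes "profile a b q q'"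
  shows "q \<in> borel_measurable borel" "q' \<in> borel_measurable borel"
proof -
  show "q \<in> borel_measurable borel"
    using profileD(2)[OF assms] by (rule borel_measurable_continuous_onI)
  have "(\<lambda>x. indicator {a<..<b} x *\<^sub>R q' x) \<in> borel_measurable borel"
    using profileD(3)[OF assms] by (intro borel_measurable_continuous_on_indicator) auto
  moreover have "indicator {a<..<b} x *\<^sub>R q' x = q' x" for x
    using profileD(7)[OF assms, of x] by (auto simp: indicator_def)
  ultimately show "q' \<in> borel_measurable borel" by simp
qed

lemma profile_bounded:
  assumes "profile a b q q'"
  shows "\<exists>C\<ge>0. \<forall>x. norm (q x) \<le> C \<and> norm (q' x) \<le> C"
proof -
  obtain C1 where C1: "\<And>x. norm (q' x) \<le> C1"
    using assms by (auto simp: profile_def bounded_iff)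
  have "compact (q ` {a..b})"
    using profileD(2)[OF assms] by (intro compact_continuous_image) auto
  then obtain C2 where C2: "\<And>x. x \<in> {a..b} \<Longrightarrow> norm (q x) \<le> C2"
    using compact_imp_bounded bounded_iff by (metis imageI)
  have "norm (q x) \<le> max 0 C2" for x
    using C2[of x] profileD(6)[OF assms, of x] by (cases "x \<in> {a..b}") auto
  then show ?thesis
    using C1 by (intro exI[of _ "max (max 0 C2) C1"]) (auto intro: order_trans simp: le_max_iff_disj)
qed

text \<open>\<open>q\<close> is continuous and zero at both ends of its support, so no singular part
  arises there even if \<open>q'\<close> jumps; the boundary terms of the integration by parts
  vanish.\<close>

lemma profile_has_weak_deriv:
  assumes p: "profile a b q q'"
  shows "has_weak_deriv 1 q q'"
  unfolding has_weak_deriv_def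
proof (intro conjI ballI)
  obtain C where C: "C \<ge> 0" "\<And>x. norm (q x) \<le> C" "\<And>x. norm (q' x) \<le> C"
    using profile_bounded[OF p] by blast
  note m = profile_measurable[OF p]
  have "integrable lborel q" "integrable lborel q'"
    using C m profileD(6,7)[OF p] by (auto intro!: integrable_bounded_Icc[of _ C a b])
  then show loc: "locally_integrable q" "locally_integrable q'"
    unfolding locally_integrable_def set_integrable_def
    by (auto intro!: integrable_mult_indicator)
  fix \<phi> :: "real \<Rightarrow> complex" assume \<phi>: "\<phi> \<in> test_functions UNIV"
  note M = test_functionD[OF \<phi>]
  obtain K where K: "\<And>x. x \<notin> {-K..K} \<Longrightarrow> \<phi> x = 0" "\<And>x. x \<notin> {-K..K} \<Longrightarrow> ddx \<phi> x = 0"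
    using test_function_support[OF \<phi>] by blast
  have i: "integrable lborel (\<lambda>x. q' x * \<phi> x)" "integrable lborel (\<lambda>x. q x * ddx \<phi> x)"
    using integrable_mult_test[OF loc(2) M(2) K(1)] integrable_mult_test[OF loc(1) M(3) K(2)] by simp_all
  have "(LBINT x. q x * ddx \<phi> x + q' x * \<phi> x) = q b * \<phi> b - q a * \<phi> a"
  proof (rule LBINT_FTC)
    show "continuous_on {a..b} (\<lambda>x. q x * \<phi> x)"
      using profileD(2)[OF p] M(2) by (auto intro!: continuous_intros intro: continuous_on_subset)
    show "((\<lambda>x. q x * \<phi> x) has_vector_derivative q x * ddx \<phi> x + q' x * \<phi> x) (at x)"
      if "x \<in> {a<..<b}" for x
      using has_vector_derivative_mult[OF profileD(5)[OF p that] M(1)] .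
  qed (use i profileD[OF p] in auto)
  then show "(LBINT x. q x * (ddx ^^ 1) \<phi> x) = (- 1) ^ 1 * (LBINT x. q' x * \<phi> x)"
    using profileD(6)[OF p] i by (simp add: eq_neg_iff_add_eq_0)
qed

lemma has_weak_deriv_1_diff_cmult:
  assumes "has_weak_deriv 1 f g" "has_weak_deriv 1 F G"
  shows "has_weak_deriv 1 (\<lambda>x. f x - z * F x) (\<lambda>x. g x - z * G x)"
  unfolding has_weak_deriv_def
proof (intro conjI ballI)
  have loc: "locally_integrable f" "locally_integrable g" "locally_integrable F" "locally_integrable G"
    using assms by (auto simp: has_weak_deriv_def)
  then show "locally_integrable (\<lambda>x. f x - z * F x)" "locally_integrable (\<lambda>x. g x - z * G x)"
    by (auto simp: locally_integrable_def)
  fix \<phi> :: "real \<Rightarrow> complex" assume \<phi>: "\<phi> \<in> test_functions UNIV"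
  note M = test_functionD[OF \<phi>]
  obtain K where K: "\<And>x. x \<notin> {-K..K} \<Longrightarrow> \<phi> x = 0" "\<And>x. x \<notin> {-K..K} \<Longrightarrow> ddx \<phi> x = 0"
    using test_function_support[OF \<phi>] by blast
  have "(LBINT x. f x * ddx \<phi> x) = - (LBINT x. g x * \<phi> x)"
      "(LBINT x. F x * ddx \<phi> x) = - (LBINT x. G x * \<phi> x)"
    using assms \<phi> by (simp_all add: has_weak_deriv_def)
  then show "(LBINT x. (f x - z * F x) * (ddx ^^ 1) \<phi> x) = (- 1) ^ 1 * (LBINT x. (g x - z * G x) * \<phi> x)"
    using integrable_mult_test[OF loc(1) M(3) K(2)] integrable_mult_test[OF loc(3) M(3) K(2)]
      integrable_mult_test[OF loc(2) M(2) K(1)] integrable_mult_test[OF loc(4) M(2) K(1)]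
    by (simp add: left_diff_distrib mult.assoc)
qed

text \<open>Needed because the initial datum is known to agree with the solution at time 0 only
  almost everywhere.\<close>

lemma has_weak_deriv_cong_AE:
  assumes "f \<in> borel_measurable borel" "F \<in> borel_measurable borel" "AE x in lborel. f x = F x"
    and wd: "has_weak_deriv 1 f g"
  shows "has_weak_deriv 1 F g"
  unfolding has_weak_deriv_def
proof (intro conjI ballI)
  show "locally_integrable F"
    unfolding locally_integrable_def
  proof (intro allI)
    fix a b
    have "set_integrable lborel {a..b} f"
      using wd by (simp add: has_weak_deriv_def locally_integrable_def)
    then show "set_integrable lborel {a..b} F"
      unfolding set_integrable_def
      by (rule integrable_cong_AE_imp) (use assms in auto)
  qed
  show "locally_integrable g" using wd by (simp add: has_weak_deriv_def)
  fix \<phi> :: "real \<Rightarrow> complex" assume \<phi>: "\<phi> \<in> test_functions UNIV"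
  have [measurable]: "ddx \<phi> \<in> borel_measurable borel"
    by (intro borel_measurable_continuous_onI test_functionD[OF \<phi>])
  have "(LBINT x. F x * ddx \<phi> x) = (LBINT x. f x * ddx \<phi> x)"
    by (rule integral_cong_AE) (use assms in auto)
  then show "(LBINT x. F x * (ddx ^^ 1) \<phi> x) = (- 1) ^ 1 * (LBINT x. g x * \<phi> x)"
    using wd \<phi> by (simp add: has_weak_deriv_def)
qed

text \<open>A norm with values in \<open>ennreal\<close>, built on a chosen weak derivative, becomes
  a sum of two real integrals of classical expressions. The function \<open>w\<close> is free on a
  null set for the sake of the initial datum.\<close>

lemma L1_H1dot_norm_profile_diff:
  assumes p: "profile a b q q'" and P: "profile c d Q Q'"
    and w: "w \<in> borel_measurable borel" "AE x in lborel. w x = q x - z * Q x"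
  shows "L1_H1dot_norm w = ennreal (LBINT x. norm (q x - z * Q x)) +
    ennreal (sqrt (LBINT x. (norm (q' x - z * Q' x))\<^sup>2))"
proof -
  note [measurable] = profile_measurable[OF p] profile_measurable[OF P] w(1)
  obtain C where C: "C \<ge> 0" "\<And>x. norm (q x) \<le> C" "\<And>x. norm (q' x) \<le> C"
    using profile_bounded[OF p] by blast
  obtain D where D: "D \<ge> 0" "\<And>x. norm (Q x) \<le> D" "\<And>x. norm (Q' x) \<le> D"
    using profile_bounded[OF P] by blast
  have bd: "norm (x - z * y) \<le> C + norm z * D" if "norm x \<le> C" "norm y \<le> D" for x y
    using that norm_triangle_ineq4[of x "z * y"] mult_left_mono[of "norm y" D "norm z"]
    by (simp add: norm_mult)
  have out: "q x = 0 \<and> Q x = 0 \<and> q' x = 0 \<and> Q' x = 0" if "x \<notin> {min a c..max b d}" for x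
  proof -
    have "x \<notin> {a<..<b}" "x \<notin> {c<..<d}" using that by auto
    then show ?thesis using profileD(6,7)[OF p] profileD(6,7)[OF P] by blast
  qed
  have i1: "integrable lborel (\<lambda>x. norm (q x - z * Q x))"
    using bd C(2) D(2) out
    by (intro integrable_bounded_Icc[of _ "C + norm z * D" "min a c" "max b d"])
      (simp_all del: atLeastAtMost_iff)
  have i2: "integrable lborel (\<lambda>x. (norm (q' x - z * Q' x))\<^sup>2)"
    using bd C(3) D(3) out
    by (intro integrable_bounded_Icc[of _ "(C + norm z * D)\<^sup>2" "min a c" "max b d"])
      (simp_all del: atLeastAtMost_iff add: power_mono)
  have L1: "L1_norm w = ennreal (LBINT x. norm (q x - z * Q x))"
  proof -
    have "L1_norm w = (\<integral>\<^sup>+ x. ennreal (norm (q x - z * Q x)) \<partial>lborel)"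
      unfolding L1_norm_def using w(2) by (intro nn_integral_cong_AE) auto
    then show ?thesis using i1 by (simp add: nn_integral_eq_integral)
  qed
  have "has_weak_deriv 1 (\<lambda>x. q x - z * Q x) (\<lambda>x. q' x - z * Q' x)"
    by (intro has_weak_deriv_1_diff_cmult profile_has_weak_deriv[OF p] profile_has_weak_deriv[OF P])
  then have wd: "has_weak_deriv 1 w (\<lambda>x. q' x - z * Q' x)"
    by (rule has_weak_deriv_cong_AE[rotated 3]) (use w in auto)
  then have "has_weak_deriv 1 w (weak_deriv 1 w)"
    unfolding weak_deriv_def by (rule someI[of "has_weak_deriv 1 w"])
  with wd have "AE x in lborel. weak_deriv 1 w x = q' x - z * Q' x"
    by (intro has_weak_deriv_1_unique)
  then have "(\<integral>\<^sup>+ x. ennreal ((norm (weak_deriv 1 w x))\<^sup>2) \<partial>lborel) =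
      (\<integral>\<^sup>+ x. ennreal ((norm (q' x - z * Q' x))\<^sup>2) \<partial>lborel)"
    by (intro nn_integral_cong_AE) auto
  also have "\<dots> = ennreal (LBINT x. (norm (q' x - z * Q' x))\<^sup>2)"
    using i2 by (simp add: nn_integral_eq_integral)
  finally have "L2_norm (weak_deriv 1 w) = ennreal (sqrt (LBINT x. (norm (q' x - z * Q' x))\<^sup>2))"
    by (simp add: L2_norm_def Let_def)
  then show ?thesis
    using L1 wd by (auto simp: L1_H1dot_norm_def)
qed

section \<open>Translates of profiles, and the square of a solution as a profile\<close>

lemma profile_shift:
  assumes "profile a b q q'"
  shows "profile (a - h) (b - h) (\<lambda>x. q (x + h)) (\<lambda>x. q' (x + h))"
  unfolding profile_def
proof (intro conjI ballI allI impI)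
  show "continuous_on UNIV (\<lambda>x. q (x + h))"
    by (rule continuous_on_compose2[OF profileD(2)[OF assms, of UNIV]]) (auto intro!: continuous_intros)
  show "continuous_on {a - h<..<b - h} (\<lambda>x. q' (x + h))"
    by (rule continuous_on_compose2[OF profileD(3)[OF assms]]) (auto intro!: continuous_intros)
  show "bounded (range (\<lambda>x. q' (x + h)))"
    using assms by (rule_tac bounded_subset[of "range q'"]) (auto simp: profile_def)
  fix x assume "x \<in> {a - h<..<b - h}"
  then have x: "x + h \<in> {a<..<b}" by auto
  show "q (x + h) \<noteq> 0" using profileD(4)[OF assms x] .
  show "((\<lambda>x. q (x + h)) has_vector_derivative q' (x + h)) (at x)"
    using vector_diff_chain_at[of "\<lambda>x. x + h" 1 x q "q' (x + h)"] profileD(5)[OF assms x]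
    by (simp add: o_def has_vector_derivative_add_const)
qed (use profileD[OF assms] in auto)

text \<open>Inside the interval \<open>f\<close> is smooth, so its classical derivative agrees with
  \<open>g\<close> almost everywhere and inherits the essential bound of \<open>g\<close>; by
  continuity the bound holds everywhere, which makes q' = 2 f f' bounded. The second conclusion
  translates the energy density of \<open>f\<close> into that of its square.\<close>

lemma square_profile:
  assumes "x0 > 0" and cont: "continuous_on UNIV f" and nss: "nonzero_smooth_supported x0 f"
    and wd: "has_weak_deriv 1 f g" and fin: "Linf_norm g < \<infinity>" and meas: "g \<in> borel_measurable lborel"
  obtains q' where "profile (- x0) x0 (\<lambda>x. (f x)\<^sup>2) q'"
    "AE x in lborel. 4 * (norm (f x * g x))\<^sup>2 = (norm (q' x))\<^sup>2"
proof -
  have nz: "f x \<noteq> 0" if "x \<in> {-x0<..<x0}" for x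
    using nss that by (auto simp: nonzero_smooth_supported_def)
  have C1: "Ck_on 1 {-x0<..<x0} f"
    using nss by (simp add: nonzero_smooth_supported_def smooth_on_def)
  have zero: "f x = 0" if "x \<notin> {-x0<..<x0}" for x
  proof -
    \<comment> \<open>The support condition leaves the values at the two end points open; continuity
      from outside makes them zero.\<close>
    have "{..<-x0} \<union> {x0<..} \<subseteq> {x. f x = 0}"
    proof
      fix x assume "x \<in> {..<-x0} \<union> {x0<..}"
      then have "x \<notin> {-x0..x0}" by auto
      then show "x \<in> {x. f x = 0}"
        using nss by (auto simp: nonzero_smooth_supported_def)
    qed
    then have "closure ({..<-x0} \<union> {x0<..}) \<subseteq> {x. f x = 0}"
      using cont by (intro closure_minimal closed_Collect_eq) auto
    then show ?thesis using that by (auto simp: closure_Un not_less)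
  qed
  define f' where "f' = ddx f"
  have der: "(f has_vector_derivative f' x) (at x)" if "x \<in> {-x0<..<x0}" for x
    using C1 that by (simp add: f'_def ddx_def vector_derivative_works)
  have cont': "continuous_on {-x0<..<x0} f'"
  proof -
    have "frechet_derivative f (at x) 1 = f' x" if "x \<in> {-x0<..<x0}" for x
      using frechet_derivative_at[OF der[OF that, unfolded has_vector_derivative_def]]
      by (metis scaleR_one)
    moreover have "continuous_on {-x0<..<x0} (\<lambda>x. frechet_derivative f (at x) 1)"
      using C1 by simp
    ultimately show ?thesis
      using continuous_on_cong by (metis (no_types, lifting))
  qed
  have ae: "AE x in lborel. x \<in> {-x0<..<x0} \<longrightarrow> g x = f' x"
  \<comment> \<open>The margins x0/(n + 2) shrink to zero; the 2 keeps them below x0 already for n =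
    0.\<close>
  proof (rule AE_real_countable_Icc[where a="\<lambda>n. - x0 + x0 / (real n + 2)" and b="\<lambda>n. x0 - x0 / (real n + 2)"])
    fix n :: nat
    let ?e = "x0 / (real n + 2)"
    have e: "0 < ?e" "?e < x0" using \<open>x0 > 0\<close> by (auto simp: field_simps intro: add_pos_nonneg)
    show "AE x in lborel. x \<in> {-x0 + ?e..x0 - ?e} \<longrightarrow> g x = f' x"
    proof (cases "-x0 + ?e < x0 - ?e")
      case True
      then show ?thesis
        using e der by (intro weak_deriv_eq_deriv_Icc[OF wd] continuous_on_subset[OF cont]
            continuous_on_subset[OF cont']) auto
    next
      case False
      then have "{-x0 + ?e..x0 - ?e} \<subseteq> {-x0 + ?e}" by auto
      with AE_lborel_singleton[of "-x0 + ?e"] show ?thesis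
        by (auto elim!: eventually_mono)
    qed
  next
    fix x assume "x \<in> {-x0<..<x0}"
    then obtain n where "n > 0" "x0 / real n < x0 - \<bar>x\<bar>"
    proof -
      have pos: "x0 - \<bar>x\<bar> > 0" using \<open>x \<in> _\<close> by auto
      obtain n where "x0 / (x0 - \<bar>x\<bar>) < real n" using reals_Archimedean2 by blast
      then have *: "x0 < real n * (x0 - \<bar>x\<bar>)"
        using pos by (simp add: pos_divide_less_eq)
      then have "n > 0" using \<open>x0 > 0\<close> by (intro gr0I) auto
      then show ?thesis
        using * by (intro that[of n]) (auto simp: pos_divide_less_eq mult.commute)
    qed
    moreover have "x0 / (real n + 2) \<le> x0 / real n"
      using \<open>n > 0\<close> \<open>x0 > 0\<close> by (intro divide_left_mono) auto
    ultimately show "\<exists>n::nat. - x0 + x0 / (real n + 2) \<le> x \<and> x \<le> x0 - x0 / (real n + 2)"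
      by (intro exI[of _ n]) auto
  qed
  obtain C where C: "AE x in lborel. norm (g x) \<le> C" "C \<ge> 0"
  proof -
    have "AE x in lborel. ennreal (norm (g x)) \<le> Linf_norm g"
      unfolding Linf_norm_def by (rule esssup_AE)
    moreover obtain C where "Linf_norm g = ennreal C" "C \<ge> 0"
      using fin by (cases "Linf_norm g") auto
    ultimately show ?thesis by (intro that[of C]) auto
  qed
  have bd: "norm (f' x) \<le> C" if "x \<in> {-x0<..<x0}" for x
  proof (rule ccontr)
    \<comment> \<open>The set where the bound fails is open by continuity of \<open>f'\<close> and
      null by \<open>ae\<close>, hence empty.\<close>
    let ?U = "{x \<in> {-x0<..<x0}. C < norm (f' x)}"
    assume "\<not> norm (f' x) \<le> C"
    then have "x \<in> ?U" using that by auto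
    moreover have op: "open ?U"
    proof -
      have "open ({-x0<..<x0} \<inter> (\<lambda>x. norm (f' x)) -` {C<..})"
        using cont' by (intro continuous_open_preimage continuous_intros) auto
      moreover have "{-x0<..<x0} \<inter> (\<lambda>x. norm (f' x)) -` {C<..} = ?U" by auto
      ultimately show ?thesis by simp
    qed
    moreover have "AE x in lborel. x \<notin> ?U"
      using ae C(1) by eventually_elim auto
    then have "?U \<in> null_sets lborel"
      using op by (subst AE_iff_null_sets) auto
    then have "negligible ?U"
      by (simp add: negligible_iff_null_sets null_sets_completionI)
    ultimately show False
      using open_not_negligible[OF op] by blast
  qed
  define q' where "q' x = (if x \<in> {-x0<..<x0} then 2 * f x * f' x else 0)" for x
  have "compact (f ` {-x0..x0})"
    using cont by (intro compact_continuous_image) (auto intro: continuous_on_subset)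
  then obtain K where K: "\<And>x. x \<in> {-x0..x0} \<Longrightarrow> norm (f x) \<le> K"
    using compact_imp_bounded bounded_iff by (metis imageI)
  show ?thesis
  proof
    show "profile (- x0) x0 (\<lambda>x. (f x)\<^sup>2) q'"
      unfolding profile_def
    proof (intro conjI ballI allI impI)
      show "continuous_on {-x0<..<x0} q'"
      proof -
        have "continuous_on {-x0<..<x0} (\<lambda>x. 2 * f x * f' x)"
          by (intro continuous_intros cont' continuous_on_subset[OF cont]) auto
        then show ?thesis
          by (rule continuous_on_eq) (simp add: q'_def)
      qed
      have "norm (q' x) \<le> 2 * K * C" for x
      proof (cases "x \<in> {-x0<..<x0}")
        case True
        moreover have "norm (f x) \<le> K" using K[of x] True by auto
        moreover have "0 \<le> K" using calculation(2) norm_ge_zero order_trans by blast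
        ultimately show ?thesis
          using bd[OF True] by (auto simp: q'_def norm_mult intro!: mult_mono)
      next
        case False
        have "0 \<le> K" using K[of 0] norm_ge_zero[of "f 0"] \<open>x0 > 0\<close> by (smt (verit) atLeastAtMost_iff)
        then show ?thesis using False C(2) by (auto simp: q'_def)
      qed
      then show "bounded (range q')" unfolding bounded_iff by auto
      show "((\<lambda>x. (f x)\<^sup>2) has_vector_derivative q' x) (at x)" if "x \<in> {-x0<..<x0}" for x
        using has_vector_derivative_mult[OF der[OF that] der[OF that]] that
        by (simp add: q'_def power2_eq_square algebra_simps)
      show "continuous_on UNIV (\<lambda>x. (f x)\<^sup>2)"
        using cont by (intro continuous_intros)
    qed (use \<open>x0 > 0\<close> nz zero in \<open>auto simp: q'_def\<close>)
    show "AE x in lborel. 4 * (norm (f x * g x))\<^sup>2 = (norm (q' x))\<^sup>2"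
      using ae by eventually_elim (auto simp: q'_def norm_mult power_mult_distrib zero)
  qed
qed

text \<open>These functions are integrable and closed under sums, products and norms, so
  integrability of an expression in profiles reduces to the rules collected in
  \<open>bounded_support_intros\<close>.\<close>

definition bounded_support :: "(real \<Rightarrow> 'a::real_normed_vector) \<Rightarrow> bool" where
  "bounded_support f \<longleftrightarrow> f \<in> borel_measurable borel \<and> bounded (range f) \<and> bounded {x. f x \<noteq> 0}"

lemma bounded_supportI:
  assumes "f \<in> borel_measurable borel" "\<And>x. norm (f x) \<le> C" "\<And>x. x \<notin> {a..b} \<Longrightarrow> f x = 0"
  shows "bounded_support f"
proof -
  have "{x. f x \<noteq> 0} \<subseteq> {a..b}" using assms(3) by blast
  then have "bounded {x. f x \<noteq> 0}"
    by (rule bounded_subset[OF bounded_closed_interval])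
  moreover have "bounded (range f)"
    using assms(2) by (auto simp: bounded_iff)
  ultimately show ?thesis
    using assms(1) by (simp add: bounded_support_def)
qed

lemma integrable_bounded_support:
  fixes f :: "real \<Rightarrow> 'a::{banach, second_countable_topology}"
  assumes "bounded_support f"
  shows "integrable lborel f"
proof -
  obtain C where C: "\<And>x. norm (f x) \<le> C"
    using assms by (auto simp: bounded_support_def bounded_iff)
  obtain M where "\<forall>x. f x \<noteq> 0 \<longrightarrow> \<bar>x\<bar> \<le> M"
    using assms by (auto simp: bounded_support_def bounded_iff)
  then have "f x = 0" if "x \<notin> {-M..M}" for x
    using that by (cases "f x = 0") (auto simp: abs_le_iff minus_le_iff)
  then show ?thesis
    using assms C by (intro integrable_bounded_Icc[of f C "-M" M]) (simp_all add: bounded_support_def)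
qed

text \<open>The linear bound forces F 0 = 0, so the support does not grow.\<close>

lemma bounded_support_map:
  assumes f: "bounded_support f" and F: "F \<in> borel_measurable borel"
    and K: "\<And>y. norm (F y) \<le> K * norm y"
  shows "bounded_support (\<lambda>x. F (f x))"
  unfolding bounded_support_def
proof (intro conjI)
  show "(\<lambda>x. F (f x)) \<in> borel_measurable borel"
    using f F by (auto simp: bounded_support_def)
  obtain C where C: "\<forall>x. norm (f x) \<le> C"
    using f by (auto simp: bounded_support_def bounded_iff)
  have "norm (F (f x)) \<le> \<bar>K\<bar> * C" for x
  proof -
    have "norm (F (f x)) \<le> \<bar>K\<bar> * norm (f x)"
      by (rule order_trans[OF K mult_right_mono]) auto
    also have "\<dots> \<le> \<bar>K\<bar> * C"
      using C by (intro mult_left_mono) auto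
    finally show ?thesis .
  qed
  then show "bounded (range (\<lambda>x. F (f x)))"
    unfolding bounded_iff by blast
  have "F 0 = 0" using K[of 0] by simp
  then have "{x. F (f x) \<noteq> 0} \<subseteq> {x. f x \<noteq> 0}" by force
  then show "bounded {x. F (f x) \<noteq> 0}"
    using f bounded_subset by (auto simp: bounded_support_def)
qed

lemma bounded_support_norm: "bounded_support f \<Longrightarrow> bounded_support (\<lambda>x. norm (f x))"
  by (rule bounded_support_map[where F=norm and K=1]) simp_all

lemma bounded_support_Re: "bounded_support f \<Longrightarrow> bounded_support (\<lambda>x. Re (f x))"
  by (rule bounded_support_map[where F=Re and K=1]) (simp_all add: abs_Re_le_cmod)

lemma bounded_support_of_real: "bounded_support f \<Longrightarrow> bounded_support (\<lambda>x. complex_of_real (f x))"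
  by (rule bounded_support_map[where F=complex_of_real and K=1]) simp_all

lemma bounded_support_cmult:
  fixes f :: "real \<Rightarrow> 'a::{real_normed_algebra, second_countable_topology}"
  shows "bounded_support f \<Longrightarrow> bounded_support (\<lambda>x. c * f x)"
  by (rule bounded_support_map[where F="\<lambda>y. c * y" and K="norm c"]) (simp_all add: norm_mult_ineq)

lemma bounded_support_add:
  fixes f :: "real \<Rightarrow> 'a::{real_normed_vector, second_countable_topology}"
  assumes "bounded_support f" "bounded_support g"
  shows "bounded_support (\<lambda>x. f x + g x)"
  unfolding bounded_support_def
proof (intro conjI)
  show "(\<lambda>x. f x + g x) \<in> borel_measurable borel"
    using assms by (auto simp: bounded_support_def)
  show "bounded (range (\<lambda>x. f x + g x))"
    using assms by (intro bounded_plus_comp) (auto simp: bounded_support_def)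
  show "bounded {x. f x + g x \<noteq> 0}"
    using assms by (rule_tac bounded_subset[of "{x. f x \<noteq> 0} \<union> {x. g x \<noteq> 0}"]) (auto simp: bounded_support_def)
qed

lemma bounded_support_diff:
  fixes f :: "real \<Rightarrow> 'a::{real_normed_vector, second_countable_topology}"
  assumes "bounded_support f" "bounded_support g"
  shows "bounded_support (\<lambda>x. f x - g x)"
proof -
  have "bounded_support (\<lambda>x. - g x)"
    by (rule bounded_support_map[OF assms(2), where K=1]) simp_all
  from bounded_support_add[OF assms(1) this] show ?thesis by simp
qed

lemma bounded_support_mult:
  fixes f g :: "real \<Rightarrow> 'a::{real_normed_algebra, second_countable_topology}"
  assumes "bounded_support f" "bounded_support g"
  shows "bounded_support (\<lambda>x. f x * g x)"
  unfolding bounded_support_def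
proof (intro conjI)
  show "(\<lambda>x. f x * g x) \<in> borel_measurable borel"
    using assms by (auto simp: bounded_support_def)
  obtain C D where "\<forall>x. norm (f x) \<le> C" "\<forall>x. norm (g x) \<le> D"
    using assms by (auto simp: bounded_support_def bounded_iff)
  then have CD: "norm (f x) \<le> C" "norm (g x) \<le> D" for x by auto
  have "norm (f x * g x) \<le> C * D" for x
    using order_trans[OF norm_ge_zero CD(1)]
    by (intro order_trans[OF norm_mult_ineq] mult_mono CD) auto
  then show "bounded (range (\<lambda>x. f x * g x))"
    unfolding bounded_iff by blast
  show "bounded {x. f x * g x \<noteq> 0}"
    using assms by (rule_tac bounded_subset[of "{x. f x \<noteq> 0}"]) (auto simp: bounded_support_def)
qed

lemma bounded_support_power2:
  fixes f :: "real \<Rightarrow> 'a::{real_normed_algebra_1, second_countable_topology}"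
  shows "bounded_support f \<Longrightarrow> bounded_support (\<lambda>x. (f x)\<^sup>2)"
  unfolding power2_eq_square by (intro bounded_support_mult)

lemma bounded_support_indicator:
  "bounded_support (indicator {a..b} :: real \<Rightarrow> real)" "bounded_support (indicator {a<..<b} :: real \<Rightarrow> real)"
  by (auto intro!: bounded_supportI[of _ 1 a b] simp: indicator_def)

lemmas bounded_support_intros = bounded_support_norm bounded_support_Re bounded_support_of_real
  bounded_support_cmult bounded_support_add bounded_support_diff bounded_support_mult
  bounded_support_power2 bounded_support_indicator

lemma profile_bounded_support:
  assumes "profile a b q q'"
  shows "bounded_support q" "bounded_support q'"
proof -
  obtain C where "\<forall>x. norm (q x) \<le> C \<and> norm (q' x) \<le> C"
    using profile_bounded[OF assms] by blast
  then show "bounded_support q" "bounded_support q'"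
    using profile_measurable[OF assms] profileD(6,7)[OF assms]
    by (auto intro!: bounded_supportI[of _ C a b])
qed

lemma profile_has_vector_derivative:
  assumes "profile a b q q'" "x \<notin> {a, b}"
  shows "(q has_vector_derivative q' x) (at x)"
proof (cases "x \<in> {a<..<b}")
  case True
  then show ?thesis using profileD(5)[OF assms(1)] by simp
next
  case False
  have "(q has_vector_derivative 0) (at x)"
    by (rule has_vector_derivative_transform_within_open[of "\<lambda>_. 0" _ _ "- {a..b}"])
      (use False assms(2) profileD(6)[OF assms(1)] in auto)
  then show ?thesis using profileD(7)[OF assms(1) False] by simp
qed

section \<open>The compacton and the expansion of the energy\<close>

text \<open>Half the width of the support of the compacton.\<close>

definition hw :: real where "hw = pi / sqrt 2"

lemma hw_pos: "hw > 0" by (simp add: hw_def)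

lemma sqrt2_hw: "sqrt 2 * hw = pi" by (simp add: hw_def)

lemma abs_less_hw_iff: "\<bar>sqrt 2 * x\<bar> < pi \<longleftrightarrow> x \<in> {-hw<..<hw}"
  unfolding hw_def by (auto simp: abs_less_iff field_simps)

text \<open>The height is 2 \<omega> while the width does not depend on \<omega>; hence the
  compacton of height A is \<open>csq (A / 2)\<close>, on the same support.\<close>

definition csq :: "real \<Rightarrow> real \<Rightarrow> real" where
  "csq \<omega> x = (if x \<in> {-hw<..<hw} then \<omega> * (1 + cos (sqrt 2 * x)) else 0)"

definition csq' :: "real \<Rightarrow> real \<Rightarrow> real" where
  "csq' \<omega> x = (if x \<in> {-hw<..<hw} then - (sqrt 2 * \<omega> * sin (sqrt 2 * x)) else 0)"

lemma compacton_sq: "\<omega> > 0 \<Longrightarrow> (compacton \<omega> x)\<^sup>2 = complex_of_real (csq \<omega> x)"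
proof -
  assume \<omega>: "\<omega> > 0"
  have "cos (2 * (x / sqrt 2)) = 2 * (cos (x / sqrt 2))\<^sup>2 - 1" by (rule cos_double_cos)
  moreover have "2 * (x / sqrt 2) = sqrt 2 * x"
    by (simp add: real_divide_square_eq field_simps)
  ultimately have "1 + cos (sqrt 2 * x) = 2 * (cos (x / sqrt 2))\<^sup>2" by simp
  then have "(sqrt (2 * \<omega>) * cos (x / sqrt 2) * indicator {- pi / sqrt 2<..<pi / sqrt 2} x)\<^sup>2 = csq \<omega> x"
    using \<omega> by (simp add: csq_def hw_def power_mult_distrib indicator_def)
  then show ?thesis
    by (simp only: compacton_def of_real_power[symmetric])
qed

lemma csq_bounds:
  assumes "\<omega> \<ge> 0"
  shows "0 \<le> csq \<omega> x" "csq \<omega> x \<le> 2 * \<omega>"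
proof -
  have "-1 \<le> cos (sqrt 2 * x)" "cos (sqrt 2 * x) \<le> 1" by auto
  then show "0 \<le> csq \<omega> x" "csq \<omega> x \<le> 2 * \<omega>"
    using mult_left_mono[of "cos (sqrt 2 * x)" 1 \<omega>] mult_left_mono[of "-1" "cos (sqrt 2 * x)" \<omega>] assms by (auto simp: csq_def distrib_left)
qed

text \<open>The cosine is -1 at both clamped ends, so one formula covers the line and continuity of
  \<open>csq\<close> can be read off.\<close>

lemma csq_clamp: "csq \<omega> x = \<omega> * (1 + cos (max (-pi) (min pi (sqrt 2 * x))))"
proof -
  consider "\<bar>sqrt 2 * x\<bar> < pi" | "sqrt 2 * x \<ge> pi" | "sqrt 2 * x \<le> - pi" by linarith
  then show ?thesis
  proof cases
    case 1
    then have "max (-pi) (min pi (sqrt 2 * x)) = sqrt 2 * x" by linarith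
    with 1 show ?thesis by (simp only: csq_def abs_less_hw_iff if_True)
  next
    case 2
    then have "max (-pi) (min pi (sqrt 2 * x)) = pi" using pi_gt_zero by linarith
    moreover have "x \<notin> {-hw<..<hw}" using 2 abs_less_hw_iff[of x] by linarith
    ultimately show ?thesis by (simp add: csq_def del: greaterThanLessThan_iff)
  next
    case 3
    then have "max (-pi) (min pi (sqrt 2 * x)) = -pi" using pi_gt_zero by linarith
    moreover have "x \<notin> {-hw<..<hw}" using 3 abs_less_hw_iff[of x] by linarith
    ultimately show ?thesis by (simp add: csq_def del: greaterThanLessThan_iff)
  qed
qed

lemma csq_profile:
  assumes "\<omega> > 0"
  shows "profile (-hw) hw (\<lambda>x. complex_of_real (csq \<omega> x)) (\<lambda>x. complex_of_real (csq' \<omega> x))"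
  unfolding profile_def
proof (intro conjI ballI allI impI)
  show "continuous_on UNIV (\<lambda>x. complex_of_real (csq \<omega> x))"
    unfolding csq_clamp by (intro continuous_intros)
  have "continuous_on {-hw<..<hw} (\<lambda>x. complex_of_real (- (sqrt 2 * \<omega> * sin (sqrt 2 * x))))"
    by (intro continuous_intros)
  then show "continuous_on {-hw<..<hw} (\<lambda>x. complex_of_real (csq' \<omega> x))"
    by (rule continuous_on_eq) (simp add: csq'_def)
  have "\<bar>sin (sqrt 2 * x)\<bar> \<le> 1" for x by simp
  then have "norm (complex_of_real (csq' \<omega> x)) \<le> sqrt 2 * \<omega>" for x
    using assms mult_left_mono[of "\<bar>sin (sqrt 2 * x)\<bar>" 1 "sqrt 2 * \<omega>"] by (auto simp: csq'_def abs_mult)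
  then show "bounded (range (\<lambda>x. complex_of_real (csq' \<omega> x)))"
    unfolding bounded_iff by blast
  fix x assume x: "x \<in> {-hw<..<hw}"
  show "complex_of_real (csq \<omega> x) \<noteq> 0"
  proof -
    have "\<bar>sqrt 2 * x\<bar> < pi" using x abs_less_hw_iff by blast
    then have "cos (sqrt 2 * x) \<noteq> -1"
      using cos_monotone_0_pi[of "\<bar>sqrt 2 * x\<bar>" pi] cos_abs_real[of "sqrt 2 * x"] by auto
    then have "csq \<omega> x \<noteq> 0" using assms x by (simp add: csq_def)
    then show ?thesis by (simp only: of_real_eq_0_iff not_False_eq_True)
  qed
  have "((\<lambda>x. \<omega> * (1 + cos (sqrt 2 * x))) has_real_derivative csq' \<omega> x) (at x)"
    using x by (auto simp: csq'_def intro!: derivative_eq_intros)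
  then have "(csq \<omega> has_real_derivative csq' \<omega> x) (at x)"
    by (rule has_field_derivative_transform_within_open[where S="{-hw<..<hw}"]) (use x in \<open>auto simp: csq_def\<close>)
  then show "((\<lambda>x. complex_of_real (csq \<omega> x)) has_vector_derivative complex_of_real (csq' \<omega> x)) (at x)"
    by (rule has_vector_derivative_of_real)
qed (use hw_pos in \<open>auto simp: csq_def csq'_def\<close>)

lemma bounded_support_csq:
  assumes "\<omega> > 0"
  shows "bounded_support (csq \<omega>)" "bounded_support (csq' \<omega>)"
  using bounded_support_Re[OF profile_bounded_support(1)[OF csq_profile[OF assms]]]
    bounded_support_Re[OF profile_bounded_support(2)[OF csq_profile[OF assms]]] by simp_all

lemma LBINT_csq:
  assumes "\<omega> > 0"
  shows "(LBINT x. csq \<omega> x) = 2 * hw * \<omega>"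
proof -
  have "(LBINT x. csq \<omega> x) = (\<lambda>x. \<omega> * (x + sin (sqrt 2 * x) / sqrt 2)) hw - (\<lambda>x. \<omega> * (x + sin (sqrt 2 * x) / sqrt 2)) (-hw)"
  proof (rule LBINT_FTC[where H="\<lambda>x. \<omega> * (x + sin (sqrt 2 * x) / sqrt 2)"])
    show "continuous_on {-hw..hw} (\<lambda>x. \<omega> * (x + sin (sqrt 2 * x) / sqrt 2))"
      by (intro continuous_intros) auto
    show "((\<lambda>x. \<omega> * (x + sin (sqrt 2 * x) / sqrt 2)) has_vector_derivative csq \<omega> x) (at x)"
      if "x \<in> {-hw<..<hw}" for x
      using that unfolding has_real_derivative_iff_has_vector_derivative[symmetric]
      by (auto simp: csq_def intro!: derivative_eq_intros)
    show "integrable lborel (csq \<omega>)"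
      by (rule integrable_bounded_support[OF bounded_support_csq(1)[OF assms]])
  qed (use hw_pos in \<open>auto simp: csq_def\<close>)
  moreover have "sin (sqrt 2 * - hw) = 0"
    by (simp add: sqrt2_hw)
  ultimately show ?thesis
    by (simp add: sqrt2_hw)
qed

section \<open>The energy of profiles\<close>

definition profile_energy :: "(real \<Rightarrow> complex) \<Rightarrow> (real \<Rightarrow> complex) \<Rightarrow> real" where
  "profile_energy q q' = (LBINT x. (norm (q' x))\<^sup>2) / 4 - (LBINT x. (norm (q x))\<^sup>2) / 2"

text \<open>Integration by parts, using $Q'' + 2Q = 2\omega$ on the support of \<open>Q = csq \<omega>\<close> and $Q' = 0$ at its end points.\<close>

lemma LBINT_deriv_csq:
  assumes p: "profile a b q q'" and "\<omega> > 0"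
  shows "(LBINT x. Re (cnj z * q' x) * csq' \<omega> x) =
    2 * (LBINT x. Re (cnj z * q x) * csq \<omega> x) - 2 * \<omega> * (LBINT x. indicator {-hw<..<hw} x * Re (cnj z * q x))"
proof -
  note bs = bounded_support_csq[OF \<open>\<omega> > 0\<close>] profile_bounded_support[OF p]
  let ?G = "\<lambda>x. Re (cnj z * q' x) * csq' \<omega> x - 2 * (Re (cnj z * q x) * csq \<omega> x)
      + 2 * \<omega> * (indicator {-hw<..<hw} x * Re (cnj z * q x))"
  \<comment> \<open>\<open>?H\<close> carries the sine without cut-off, hence is continuous up to
    the ends; its derivative inside is \<open>?G\<close> once Q'' is replaced by 2 \<omega> - 2
    Q.\<close>
  let ?H = "\<lambda>x. Re (cnj z * q x) * - (sqrt 2 * \<omega> * sin (sqrt 2 * x))"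
  have i: "integrable lborel ?G"
    by (intro integrable_bounded_support bounded_support_intros bs)
  have "(LBINT x. ?G x) = ?H hw - ?H (-hw)"
  proof (rule LBINT_FTC_strong[where S="{a, b}" and H="?H" and a="-hw" and b=hw])
    show "continuous_on {-hw..hw} ?H"
      by (intro continuous_intros profileD(2)[OF p])
    fix x assume x: "x \<in> {-hw<..<hw} - {a, b}"
    have "((\<lambda>x. Re (cnj z * q x)) has_vector_derivative Re (cnj z * q' x)) (at x)"
      using x by (intro bounded_linear.has_vector_derivative[OF bounded_linear_Re]
          has_vector_derivative_mult_right profile_has_vector_derivative[OF p]) auto
    then have d: "((\<lambda>x. Re (cnj z * q x)) has_real_derivative Re (cnj z * q' x)) (at x)"
      by (simp add: has_real_derivative_iff_has_vector_derivative)
    show "(?H has_vector_derivative ?G x) (at x)"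
      unfolding has_real_derivative_iff_has_vector_derivative[symmetric]
    proof (rule DERIV_cong[OF DERIV_mult[OF d]])
      show "((\<lambda>x. - (sqrt 2 * \<omega> * sin (sqrt 2 * x))) has_real_derivative - (2 * \<omega> * cos (sqrt 2 * x))) (at x)"
        by (auto intro!: derivative_eq_intros)
    qed (use x in \<open>simp add: csq_def csq'_def algebra_simps\<close>)
  qed (use i hw_pos in \<open>auto simp: csq_def csq'_def\<close>)
  also have "\<dots> = 0" by (simp add: sqrt2_hw)
  also have "(LBINT x. ?G x) = (LBINT x. Re (cnj z * q' x) * csq' \<omega> x)
      - 2 * (LBINT x. Re (cnj z * q x) * csq \<omega> x) + 2 * \<omega> * (LBINT x. indicator {-hw<..<hw} x * Re (cnj z * q x))"
  proof -
    have "integrable lborel (\<lambda>x. Re (cnj z * q' x) * csq' \<omega> x)" "integrable lborel (\<lambda>x. Re (cnj z * q x) * csq \<omega> x)"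
      "integrable lborel (\<lambda>x. indicator {-hw<..<hw} x * Re (cnj z * q x))"
      by (intro integrable_bounded_support bounded_support_intros bs)+
    then show ?thesis
      by (subst Bochner_Integration.integral_add Bochner_Integration.integral_diff,
          simp_all only: integrable_mult_right integral_mult_right_zero Bochner_Integration.integrable_diff
            Bochner_Integration.integral_diff)
  qed
  finally show ?thesis by simp
qed

lemma norm_diff_unit_mult:
  assumes "norm z = 1"
  shows "(norm (w - z * complex_of_real r))\<^sup>2 = (norm w)\<^sup>2 + r\<^sup>2 - 2 * (Re (cnj z * w) * r)"
proof -
  have "Re z * Re z + Im z * Im z = 1"
    using assms cmod_power2[of z] by (simp add: power2_eq_square)
  then have "(Re z * Re z + Im z * Im z) * (r * r) = r * r" by simp
  then show ?thesis
    unfolding cmod_power2 by (simp add: power2_eq_square algebra_simps)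
qed

text \<open>The energy is quadratic, so its expansion at z Q is exact, and integration by parts
  turns the linear part into the integral of \<open>Re (cnj z * q)\<close> over the support of Q,
  which is at most the mass. It serves twice: to bound the derivative of the difference by the
  energy, and to bound the energy of data near the compacton.\<close>

lemma energy_expansion:
  assumes p: "profile a b q q'" and \<omega>: "\<omega> > 0" and z: "norm z = 1"
  shows "(LBINT x. (norm (q' x - z * complex_of_real (csq' \<omega> x)))\<^sup>2) =
    4 * profile_energy q q' + 2 * (LBINT x. (norm (q x - z * complex_of_real (csq \<omega> x)))\<^sup>2)
    + 4 * \<omega> * (LBINT x. indicator {-hw<..<hw} x * Re (cnj z * q x)) - 4 * hw * \<omega>\<^sup>2"
proof -
  note bs = bounded_support_csq[OF \<open>\<omega> > 0\<close>] profile_bounded_support[OF p]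
  have 1: "(LBINT x. (norm (q' x - z * complex_of_real (csq' \<omega> x)))\<^sup>2) =
      (LBINT x. (norm (q' x))\<^sup>2) + (LBINT x. (csq' \<omega> x)\<^sup>2) - 2 * (LBINT x. Re (cnj z * q' x) * csq' \<omega> x)"
  proof -
    have "integrable lborel (\<lambda>x. (norm (q' x))\<^sup>2)" "integrable lborel (\<lambda>x. (csq' \<omega> x)\<^sup>2)"
      "integrable lborel (\<lambda>x. Re (cnj z * q' x) * csq' \<omega> x)"
      by (intro integrable_bounded_support bounded_support_intros bs)+
    then show ?thesis
      unfolding norm_diff_unit_mult[OF z]
      by (subst Bochner_Integration.integral_diff Bochner_Integration.integral_add,
          simp_all only: integrable_mult_right integral_mult_right_zero Bochner_Integration.integrable_add
            Bochner_Integration.integral_add)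
  qed
  have 2: "(LBINT x. (norm (q x - z * complex_of_real (csq \<omega> x)))\<^sup>2) =
      (LBINT x. (norm (q x))\<^sup>2) + (LBINT x. (csq \<omega> x)\<^sup>2) - 2 * (LBINT x. Re (cnj z * q x) * csq \<omega> x)"
  proof -
    have "integrable lborel (\<lambda>x. (norm (q x))\<^sup>2)" "integrable lborel (\<lambda>x. (csq \<omega> x)\<^sup>2)"
      "integrable lborel (\<lambda>x. Re (cnj z * q x) * csq \<omega> x)"
      by (intro integrable_bounded_support bounded_support_intros bs)+
    then show ?thesis
      unfolding norm_diff_unit_mult[OF z]
      by (subst Bochner_Integration.integral_diff Bochner_Integration.integral_add,
          simp_all only: integrable_mult_right integral_mult_right_zero Bochner_Integration.integrable_add
            Bochner_Integration.integral_add)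
  qed
  have "(LBINT x. indicator {-hw<..<hw} x * csq \<omega> x) = 2 * hw * \<omega>"
    unfolding LBINT_csq[OF \<omega>, symmetric] by (rule Bochner_Integration.integral_cong) (auto simp: csq_def)
  \<comment> \<open>The same integration by parts with q = Q. Equivalently Q has energy - hw
    \<omega>^2, the reference value in all later energy bounds.\<close>
  then have 3: "(LBINT x. (csq' \<omega> x)\<^sup>2) = 2 * (LBINT x. (csq \<omega> x)\<^sup>2) - 4 * hw * \<omega>\<^sup>2"
    using LBINT_deriv_csq[OF csq_profile[OF \<omega>] \<omega>, of 1] LBINT_csq[OF \<omega>]
    by (simp add: power2_eq_square)
  show ?thesis
    using LBINT_deriv_csq[OF p \<omega>, of z] unfolding 1 2 3 profile_energy_def by algebra
qed

section \<open>The equation of the compacton\<close>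

text \<open>The graph of sqrt(2 r (A - r)) is half an ellipse with half-axes A/2 and A/sqrt 2, of
  area pi A^2/(4 sqrt 2) = hw A^2/4. The cut-off by \<open>max\<close> continues the integrand past
  both ends, so that \<open>G\<close> is differentiable also at r = A, a value that |q| takes at
  interior points.\<close>

lemma sqrt_integral_value:
  fixes A :: real
  assumes "A > 0"
  obtains G where "\<And>r. r \<in> {-1<..<A + 1} \<Longrightarrow> (G has_real_derivative sqrt (2 * max 0 (r * (A - r)))) (at r)"
    "G A - G 0 = hw * A\<^sup>2 / 4"
proof -
  have "continuous_on {-1..A + 1} (\<lambda>r. sqrt (2 * max 0 (r * (A - r))))"
    by (intro continuous_intros)
  then obtain G where G: "\<And>r. r \<in> {-1..A + 1} \<Longrightarrow>
      (G has_vector_derivative sqrt (2 * max 0 (r * (A - r)))) (at r within {-1..A + 1})"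
    using antiderivative_continuous by blast
  have der: "(G has_real_derivative sqrt (2 * max 0 (r * (A - r)))) (at r)" if "r \<in> {-1<..<A + 1}" for r
  proof -
    have "at r within {-1..A + 1} = at r"
      using that by (intro at_within_interior) (simp add: interior_atLeastAtMost_real)
    then show ?thesis
      using G[of r] that by (simp add: has_real_derivative_iff_has_vector_derivative)
  qed
  \<comment> \<open>\<open>c\<close> maps [0, A] affinely onto [-1, 1] and \<open>P\<close> is the
    usual primitive with arcsin. Its terms are singular at the ends, so it is compared with
    \<open>G\<close> inside only and matched at the ends by continuity.\<close>
  define c where "c r = 2 * r / A - 1" for r
  define P where "P r = A\<^sup>2 / (4 * sqrt 2) * (c r * sqrt (1 - (c r)\<^sup>2) + arcsin (c r))" for r
  have c01: "-1 \<le> c r" "c r \<le> 1" if "0 \<le> r" "r \<le> A" for r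
    using that assms by (auto simp: c_def field_simps)
  have derP: "(P has_real_derivative sqrt (2 * max 0 (r * (A - r)))) (at r)" if "0 < r" "r < A" for r
  proof -
    have c: "-1 < c r" "c r < 1"
      using that assms by (auto simp: c_def field_simps)
    have sq: "(c r)\<^sup>2 < 1"
      using c by (simp add: abs_square_less_1 abs_less_iff)
    have dc: "(c has_real_derivative 2 / A) (at r)"
      unfolding c_def using assms by (auto intro!: derivative_eq_intros)
    let ?s = "sqrt (1 - (c r)\<^sup>2)"
    have s: "?s > 0" "?s * ?s = 1 - (c r)\<^sup>2"
      using sq by auto
    have ds: "((\<lambda>r. sqrt (1 - (c r)\<^sup>2)) has_real_derivative (- (2 * c r * (2 / A))) * (inverse ?s / 2)) (at r)"
    proof -
      have "((\<lambda>r. 1 - (c r)\<^sup>2) has_real_derivative - (2 * c r * (2 / A))) (at r)"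
        by (auto intro!: derivative_eq_intros dc)
      from DERIV_chain2[OF DERIV_real_sqrt this] sq show ?thesis by (simp add: mult.commute)
    qed
    have da: "((\<lambda>r. arcsin (c r)) has_real_derivative inverse ?s * (2 / A)) (at r)"
      using DERIV_chain2[OF DERIV_arcsin[OF c] dc] .
    have "(P has_real_derivative A\<^sup>2 / (4 * sqrt 2) * ((2 / A) * ?s + (- (2 * c r * (2 / A))) * (inverse ?s / 2) * c r + inverse ?s * (2 / A))) (at r)"
      unfolding P_def by (intro DERIV_cmult DERIV_add DERIV_mult dc ds da)
    moreover have "A\<^sup>2 / (4 * sqrt 2) * ((2 / A) * ?s + (- (2 * c r * (2 / A))) * (inverse ?s / 2) * c r + inverse ?s * (2 / A))
        = A / sqrt 2 * ?s"
    proof -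
      have "(2 / A) * ?s + (- (2 * c r * (2 / A))) * (inverse ?s / 2) * c r + inverse ?s * (2 / A)
          = (2 / A) * (?s + inverse ?s * (1 - (c r)\<^sup>2))"
      proof -
        have "k * s + (- (2 * c * k)) * (i / 2) * c + i * k = k * (s + i * (1 - c\<^sup>2))" for k s i c :: real
          by (simp add: field_simps power2_eq_square)
        then show ?thesis .
      qed
      also have "inverse ?s * (1 - (c r)\<^sup>2) = ?s"
        using s by (simp add: field_simps)
      finally show ?thesis using assms by (simp add: field_simps power2_eq_square)
    qed
    moreover have "A / sqrt 2 * ?s = sqrt (2 * max 0 (r * (A - r)))"
    proof -
      have "2 * max 0 (r * (A - r)) = (A / sqrt 2)\<^sup>2 * (1 - (c r)\<^sup>2)"
        using that assms by (simp add: c_def power2_eq_square field_simps max_def)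
      then show ?thesis
        using assms by (simp add: real_sqrt_mult)
    qed
    ultimately show ?thesis by simp
  qed
  have "G A - P A = G 0 - P 0"
  proof (rule DERIV_isconst_end[OF assms, of "\<lambda>r. G r - P r"])
    have "continuous_on {0..A} G"
      by (intro continuous_at_imp_continuous_on ballI DERIV_isCont[OF der]) auto
    moreover have "continuous_on {0..A} P"
      unfolding P_def c_def using c01[unfolded c_def] by (intro continuous_intros) (use assms in auto)
    ultimately show "continuous_on {0..A} (\<lambda>r. G r - P r)"
      by (intro continuous_intros)
    show "((\<lambda>r. G r - P r) has_real_derivative 0) (at r)" if "0 < r" "r < A" for r
      using DERIV_diff[OF der derP] that by simp
  qed
  moreover have "P A - P 0 = hw * A\<^sup>2 / 4"
    using assms by (simp add: P_def c_def hw_def field_simps)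
  ultimately have "G A - G 0 = hw * A\<^sup>2 / 4" by simp
  with der show ?thesis by (rule that)
qed

text \<open>The positive part has a corner, its square has none; this allows a Gronwall argument for
  the square of a positive part.\<close>

lemma DERIV_pos_part_sq:
  assumes "(f has_real_derivative D) (at x)"
  shows "((\<lambda>x. (max (f x) 0)\<^sup>2) has_real_derivative 2 * max (f x) 0 * D) (at x)"
proof -
  have "((\<lambda>y::real. (max y 0)\<^sup>2) has_real_derivative 2 * max y 0) (at y)" for y
  proof -
    consider "y > 0" | "y < 0" | "y = 0" by linarith
    then show ?thesis
    proof cases
      case 1
      have "((\<lambda>y::real. y\<^sup>2) has_real_derivative 2 * max y 0) (at y)"
        using 1 by (auto intro!: derivative_eq_intros)
      then show ?thesis
        by (rule has_field_derivative_transform_within_open[where S="{0<..}"]) (use 1 in auto)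
    next
      case 2
      have "((\<lambda>y::real. 0) has_real_derivative 2 * max y 0) (at y)"
        using 2 by simp
      then show ?thesis
        by (rule has_field_derivative_transform_within_open[where S="{..<0}"]) (use 2 in auto)
    next
      case 3
      have "((\<lambda>h::real. (max h 0)\<^sup>2 / h) \<longlongrightarrow> 0) (at 0)"
      proof (rule Lim_null_comparison)
        show "((\<lambda>h::real. \<bar>h\<bar>) \<longlongrightarrow> 0) (at 0)"
          by (rule tendsto_eq_intros | simp)+
        show "\<forall>\<^sub>F h in at 0. norm ((max h 0)\<^sup>2 / h) \<le> \<bar>h :: real\<bar>"
          by (intro always_eventually) (auto simp: max_def power2_eq_square)
      qed
      then show ?thesis using 3 by (simp add: DERIV_def)
    qed
  qed
  from DERIV_chain2[OF this assms] show ?thesis .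
qed

lemma abs_cos_diff_le: "\<bar>cos x - cos y\<bar> \<le> \<bar>x - y :: real\<bar>"
proof -
  have "norm (cos x - cos y) \<le> 1 * norm (x - y)"
    by (rule field_differentiable_bound[of UNIV cos "\<lambda>x. - sin x"])
      (auto intro!: derivative_eq_intros)
  then show ?thesis by simp
qed

text \<open>With $R = \mathrm{Re}\,q \le \rho = |q|$ this turns the equation for \<open>q\<close> into a differential inequality for \<open>R\<close> alone.\<close>

lemma sqrt_parabola_ratio_le:
  fixes A \<rho> R :: real
  assumes "0 < \<rho>" "\<rho> \<le> A" "R \<le> \<rho>"
  shows "sqrt (2 * (\<rho> * (A - \<rho>))) / \<rho> * R \<le> sqrt (2 * (max R 0 * (A - max R 0)))"
proof (cases "R > 0")
  case False
  then have "sqrt (2 * (\<rho> * (A - \<rho>))) / \<rho> * R \<le> 0"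
    using assms by (intro mult_nonneg_nonpos) auto
  then show ?thesis using False by simp
next
  case True
  have "(sqrt (2 * (\<rho> * (A - \<rho>))) / \<rho> * R)\<^sup>2 = 2 * (\<rho> * (A - \<rho>)) / \<rho>\<^sup>2 * R\<^sup>2"
    using assms by (simp add: power_mult_distrib power_divide)
  also have "\<dots> = 2 * ((A - \<rho>) * R) * R / \<rho>"
    using assms by (simp add: field_simps power2_eq_square)
  \<comment> \<open>For R > 0 this says that (A - r)/r decreases in r.\<close>
  also have "\<dots> \<le> 2 * (\<rho> * (A - R)) * R / \<rho>"
  proof -
    have "A * R \<le> A * \<rho>" using assms by (intro mult_left_mono) auto
    then have "(A - \<rho>) * R \<le> \<rho> * (A - R)" by (simp add: algebra_simps)
    then show ?thesis
      using True assms by (intro divide_right_mono mult_right_mono) auto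
  qed
  also have "\<dots> = 2 * (max R 0 * (A - max R 0))"
    using True assms by (simp add: field_simps)
  finally show ?thesis by (rule real_le_rsqrt)
qed

text \<open>The square root is not Lipschitz at \<open>R = A\<close>, where the initial value problem for the compacton has several
  solutions. Comparing with the compacton shifted by \<open>\<eta>\<close> avoids this end point; at the other one the square root
  is increasing in \<open>R\<close>, which is the favourable sign.\<close>

lemma sqrt_parabola_one_sided_Lipschitz:
  fixes A B R \<eta> \<theta> :: real
  assumes "A > 0" "0 < \<eta>" "\<eta> < pi / 2" "\<eta> \<le> \<theta>" "\<theta> \<le> pi"
    and B: "B = A / 2 * (1 + cos \<theta>)" and "R < B"
  shows "sqrt (2 * (max R 0 * (A - max R 0))) - A / sqrt 2 * sin \<theta> \<le> 2 * sqrt 2 / sin \<eta> * (B - R)"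
proof -
  define r where "r = max R 0"
  have sin\<theta>: "sin \<theta> \<ge> 0" using assms by (intro sin_ge_zero) auto
  have sin\<eta>: "sin \<eta> > 0" using assms by (intro sin_gt_zero) auto
  have B0: "0 \<le> B" "B \<le> A"
  proof -
    have "0 \<le> 1 + cos \<theta>" "1 + cos \<theta> \<le> 2"
      using cos_ge_minus_one[of \<theta>] cos_le_one[of \<theta>] by linarith+
    then have "0 \<le> A / 2 * (1 + cos \<theta>)" "A / 2 * (1 + cos \<theta>) \<le> A / 2 * 2"
      using \<open>A > 0\<close> by (auto intro!: mult_nonneg_nonneg mult_left_mono)
    then show "0 \<le> B" "B \<le> A" unfolding B by simp_all
  qed
  have r: "0 \<le> r" "r \<le> B" "B - r \<le> B - R" using \<open>R < B\<close> B0 by (auto simp: r_def)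
  \<comment> \<open>The compacton solves the equation exactly: the square root at height B is the
    absolute slope at phase \<theta>.\<close>
  have gB: "sqrt (2 * (B * (A - B))) = A / sqrt 2 * sin \<theta>"
  proof -
    have "2 * (B * (A - B)) = (A / sqrt 2 * sin \<theta>)\<^sup>2"
      unfolding B by (simp add: power_mult_distrib power_divide sin_squared_eq) (simp add: power2_eq_square field_simps)
    then show ?thesis using \<open>A > 0\<close> sin\<theta> by simp
  qed
  show ?thesis
  \<comment> \<open>As B(A - B) - r(A - r) = (B - r)(A - B - r), in the first case the root at r
    does not exceed the one at B.\<close>
  proof (cases "B + r \<le> A")
    case True
    have "0 \<le> (B - r) * (A - B - r)"
      using True r by (intro mult_nonneg_nonneg) auto
    then have "r * (A - r) \<le> B * (A - B)"
      by (simp add: algebra_simps)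
    then have "sqrt (2 * (r * (A - r))) \<le> A / sqrt 2 * sin \<theta>"
      unfolding gB[symmetric] by simp
    moreover have "0 \<le> 2 * sqrt 2 / sin \<eta> * (B - R)"
      using sin\<eta> \<open>R < B\<close> by simp
    ultimately show ?thesis by (simp add: r_def)
  next
    case False
    \<comment> \<open>Now B > A/2, so \<theta> lies in [\<eta>, pi/2) and the root at B is bounded
      below by a multiple of sin \<eta>. Dividing the difference of the squares by the sum of the
      roots gives a bound in which A cancels; the constant depends on \<eta> alone.\<close>
    then have "cos \<theta> > 0"
    proof -
      have "A < 2 * B" using False r by linarith
      then have "0 < A * cos \<theta>" unfolding B by (simp add: algebra_simps)
      then show ?thesis using \<open>A > 0\<close> by (simp add: zero_less_mult_iff)
    qed
    then have "\<theta> < pi / 2"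
      using assms cos_monotone_0_pi_le[of "pi / 2" \<theta>] by force
    then have "sin \<eta> \<le> sin \<theta>"
      using assms by (intro sin_monotone_2pi_le) auto
    define g where "g = A / sqrt 2 * sin \<eta>"
    have g: "0 < g" "g \<le> A / sqrt 2 * sin \<theta>"
      using \<open>A > 0\<close> sin\<eta> \<open>sin \<eta> \<le> sin \<theta>\<close> by (auto simp: g_def intro!: divide_right_mono mult_left_mono)
    define s where "s = sqrt (2 * (r * (A - r)))"
    define t where "t = A / sqrt 2 * sin \<theta>"
    have s2: "s * s = 2 * (r * (A - r))" "s \<ge> 0"
      using r B0 by (auto simp: s_def)
    have t2: "t * t = 2 * (B * (A - B))" "t \<ge> g"
    proof -
      show "t * t = 2 * (B * (A - B))"
        unfolding t_def gB[symmetric] using B0 by simp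
      show "t \<ge> g" using g by (simp add: t_def)
    qed
    have "(s - t) * (s + t) \<le> 2 * A * (B - r)"
    proof -
      have "(s - t) * (s + t) = 2 * (B - r) * (B + r - A)"
        using s2 t2 by (simp add: algebra_simps)
      also have "\<dots> \<le> 2 * (B - r) * A"
        using r B0 by (intro mult_left_mono) auto
      finally show ?thesis by (simp add: algebra_simps)
    qed
    have "s - t \<le> 2 * A * (B - r) / g"
    proof (cases "s \<ge> t")
      case True
      have "(s - t) * g \<le> (s - t) * (s + t)"
        using True s2 t2 by (intro mult_left_mono) auto
      then have "(s - t) * g \<le> 2 * A * (B - r)" using \<open>(s - t) * (s + t) \<le> _\<close> by linarith
      then show ?thesis using g by (simp add: pos_le_divide_eq)
    next
      case False
      moreover have "0 \<le> 2 * A * (B - r) / g" using r g \<open>A > 0\<close> by auto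
      ultimately show ?thesis by linarith
    qed
    also have "\<dots> = 2 * sqrt 2 / sin \<eta> * (B - r)"
      using \<open>A > 0\<close> sin\<eta> by (simp add: g_def field_simps)
    also have "\<dots> \<le> 2 * sqrt 2 / sin \<eta> * (B - R)"
      using r sin\<eta> by (intro mult_left_mono) auto
    finally show ?thesis by (simp add: s_def t_def r_def)
  qed
qed

section \<open>The energy deficit\<close>

text \<open>For the compacton Q of height A, |Q'| equals \<open>slope A Q\<close>.\<close>

definition slope :: "real \<Rightarrow> real \<Rightarrow> real" where
  "slope A \<rho> = sqrt (2 * (\<rho> * (A - \<rho>)))"

text \<open>Only the side x > 0 is integrated; the left side is the right side of the reflected
  profile, so no sign function is needed. On (0, b) the denominator is non-zero for a profile whose
  support contains 0.\<close>

definition right_deficit :: "real \<Rightarrow> real \<Rightarrow> (real \<Rightarrow> complex) \<Rightarrow> (real \<Rightarrow> complex) \<Rightarrow> real" where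
  "right_deficit A b q q' =
     (LBINT x. indicator {0<..<b} x * (norm (q' x + complex_of_real (slope A (norm (q x)) / norm (q x)) * q x))\<^sup>2)"

lemma right_deficit_nonneg: "0 \<le> right_deficit A b q q'"
  unfolding right_deficit_def by (intro Bochner_Integration.integral_nonneg) auto

lemma bounded_support_slope:
  assumes p: "profile a b q q'" and A: "\<And>x. norm (q x) \<le> A"
  shows "bounded_support (\<lambda>x. slope A (norm (q x)))"
    "bounded_support (\<lambda>x. complex_of_real (slope A (norm (q x)) / norm (q x)) * q x)"
proof -
  note [measurable] = profile_measurable[OF p]
  have A0: "0 \<le> A" using A order_trans[OF norm_ge_zero] by blast
  have bd: "0 \<le> slope A (norm (q x)) \<and> slope A (norm (q x)) \<le> sqrt (2 * (A * A))" for x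
    unfolding slope_def using A[of x] A0
    by (auto intro!: mult_mono)
  have z: "slope A (norm (q x)) = 0" if "x \<notin> {a..b}" for x
  proof -
    have "q x = 0" using profileD(6)[OF p, of x] that by auto
    then show ?thesis by (simp add: slope_def)
  qed
  show "bounded_support (\<lambda>x. slope A (norm (q x)))"
    using bd z by (intro bounded_supportI[of _ "sqrt (2 * (A * A))" a b]) (auto simp: slope_def)
  show "bounded_support (\<lambda>x. complex_of_real (slope A (norm (q x)) / norm (q x)) * q x)"
  proof (rule bounded_supportI[of _ "sqrt (2 * (A * A))" a b])
    show "norm (complex_of_real (slope A (norm (q x)) / norm (q x)) * q x) \<le> sqrt (2 * (A * A))" for x
      using bd[of x] by (cases "q x = 0") (auto simp: norm_mult norm_divide)
  qed (use z in \<open>auto simp: slope_def\<close>)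
qed

lemma profile_norm_deriv:
  assumes p: "profile a b q q'" and x: "x \<in> {a<..<b}"
  shows "((\<lambda>x. norm (q x)) has_real_derivative Re (cnj (q x) * q' x) / norm (q x)) (at x)"
proof -
  have "(norm has_derivative (\<lambda>h. h \<bullet> sgn (q x))) (at (q x))"
    using has_derivative_norm[OF profileD(4)[OF p x]] by (simp add: inner_commute)
  from has_derivative_compose[OF profileD(5)[OF p x, unfolded has_vector_derivative_def] this]
  have "((\<lambda>x. norm (q x)) has_derivative (\<lambda>h. (h *\<^sub>R q' x) \<bullet> sgn (q x))) (at x)" .
  moreover have "(\<lambda>h. (h *\<^sub>R q' x) \<bullet> sgn (q x)) = (*) (Re (cnj (q x) * q' x) / norm (q x))"
    by (rule ext) (simp add: inner_complex_def sgn_div_norm algebra_simps add_divide_distrib divide_inverse)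
  ultimately show ?thesis
    by (simp only: has_field_derivative_def)
qed

text \<open>The cross term of the square is 2 \<open>slope\<close>(|q|) times the derivative of |q|,
  that is the derivative of 2 G(|q|). As |q| runs from A at 0 to 0 at b, it contributes -2 (G A - G
  0) = - hw A^2/2 whatever happens in between.\<close>

lemma right_deficit_eq:
  assumes p: "profile a b q q'" and ab: "a < 0" "0 < b"
    and A: "A > 0" "\<And>x. norm (q x) \<le> A" and q0: "norm (q 0) = A"
  shows "right_deficit A b q q' =
    (LBINT x. indicator {0<..<b} x * ((norm (q' x))\<^sup>2 + 2 * (norm (q x) * (A - norm (q x))))) - hw * A\<^sup>2 / 2"
proof -
  note bs = profile_bounded_support[OF p] bounded_support_slope[OF p A(2)]
  obtain G where G: "\<And>r. r \<in> {-1<..<A + 1} \<Longrightarrow> (G has_real_derivative sqrt (2 * max 0 (r * (A - r)))) (at r)"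
    and GA: "G A - G 0 = hw * A\<^sup>2 / 4"
    using sqrt_integral_value[OF A(1)] by blast
  have G': "(G has_real_derivative slope A (norm (q x))) (at (norm (q x)))" for x
    using G[of "norm (q x)"] A(2)[of x] by (auto simp: slope_def max_def split: if_splits)
      (smt (verit) norm_ge_zero mult_nonneg_nonneg)
  let ?s = "\<lambda>x. slope A (norm (q x))"
  let ?e = "\<lambda>x. (norm (q' x + complex_of_real (?s x / norm (q x)) * q x))\<^sup>2"
  let ?f = "\<lambda>x. (norm (q' x))\<^sup>2 + 2 * (norm (q x) * (A - norm (q x)))"
  have key: "?e x = ?f x + 2 * (?s x * (Re (cnj (q x) * q' x) / norm (q x)))" if "x \<in> {a<..<b}" for x
  proof -
    have nz: "norm (q x) > 0" using profileD(4)[OF p that] by simp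
    have s2: "(?s x)\<^sup>2 = 2 * (norm (q x) * (A - norm (q x)))"
      using A(2)[of x] by (simp add: slope_def)
    define k where "k = ?s x / norm (q x)"
    have "?e x = (norm (q' x))\<^sup>2 + k\<^sup>2 * (norm (q x))\<^sup>2 + 2 * (k * Re (cnj (q x) * q' x))"
      unfolding k_def[symmetric] cmod_power2 by (simp add: power2_eq_square algebra_simps)
    also have "k\<^sup>2 * (norm (q x))\<^sup>2 = (?s x)\<^sup>2"
      using nz by (simp add: k_def power_divide)
    finally show ?thesis by (simp add: s2 k_def)
  qed
  let ?D = "\<lambda>x. indicator {0<..<b} x * ?e x - indicator {0<..<b} x * ?f x"
  have i1: "integrable lborel (\<lambda>x. indicator {0<..<b} x * ?e x)"
    by (intro integrable_bounded_support bounded_support_intros bs)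
  have i2: "integrable lborel (\<lambda>x. indicator {0<..<b} x * ?f x)"
  proof -
    have "bounded_support (\<lambda>x. indicator {0<..<b} x * ((norm (q' x))\<^sup>2 + 2 * (A * norm (q x) - (norm (q x))\<^sup>2)))"
      by (intro bounded_support_intros bs)
    then show ?thesis
      by (intro integrable_bounded_support) (simp add: power2_eq_square algebra_simps)
  qed
  have "(LBINT x. ?D x) = 2 * G (norm (q b)) - 2 * G (norm (q 0))"
  proof (rule LBINT_FTC[where H="\<lambda>x. 2 * G (norm (q x))"])
    have "continuous_on {0..A} G"
      by (intro continuous_at_imp_continuous_on ballI DERIV_isCont[OF G]) auto
    moreover have "continuous_on {0..b} (\<lambda>x. norm (q x))"
      by (intro continuous_on_norm profileD(2)[OF p])
    ultimately have "continuous_on {0..b} (\<lambda>x. G (norm (q x)))"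
      by (rule continuous_on_compose2) (use A(2) in auto)
    then show "continuous_on {0..b} (\<lambda>x. 2 * G (norm (q x)))"
      by (rule continuous_on_mult_left)
    show "((\<lambda>x. 2 * G (norm (q x))) has_vector_derivative ?D x) (at x)" if x: "x \<in> {0<..<b}" for x
    proof -
      have xab: "x \<in> {a<..<b}" using x ab by auto
      have "((\<lambda>x. 2 * G (norm (q x))) has_real_derivative 2 * (?s x * (Re (cnj (q x) * q' x) / norm (q x)))) (at x)"
        by (rule DERIV_cmult[OF DERIV_chain2[OF G' profile_norm_deriv[OF p xab]]])
      then show ?thesis
        using x key[OF xab] by (simp add: has_real_derivative_iff_has_vector_derivative)
    qed
  qed (use ab i1 i2 in auto)
  also have "q b = 0" using profileD(6)[OF p, of b] by simp
  finally show ?thesis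
    using i1 i2 q0 GA by (simp add: right_deficit_def)
qed

section \<open>Both sides of the maximum\<close>

lemma profile_reflect:
  assumes p: "profile a b q q'"
  shows "profile (-b) (-a) (\<lambda>x. q (-x)) (\<lambda>x. - q' (-x))"
  unfolding profile_def
proof (intro conjI ballI allI impI)
  show "continuous_on UNIV (\<lambda>x. q (-x))"
    by (rule continuous_on_compose2[OF profileD(2)[OF p, of UNIV]]) (auto intro!: continuous_intros)
  show "continuous_on {-b<..<-a} (\<lambda>x. - q' (-x))"
    by (rule continuous_on_minus, rule continuous_on_compose2[OF profileD(3)[OF p]])
      (auto intro!: continuous_intros)
  obtain C where "\<forall>x. norm (q' x) \<le> C"
    using profile_bounded[OF p] by blast
  then show "bounded (range (\<lambda>x. - q' (-x)))"
    by (auto simp: bounded_iff)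
  fix x assume "x \<in> {-b<..<-a}"
  then have x: "- x \<in> {a<..<b}" by auto
  show "q (-x) \<noteq> 0" using profileD(4)[OF p x] .
  have "(uminus has_vector_derivative (-1 :: real)) (at x)"
    by (auto intro!: derivative_eq_intros)
  from vector_diff_chain_at[OF this profileD(5)[OF p x]]
  show "((\<lambda>x. q (-x)) has_vector_derivative - q' (-x)) (at x)"
    by (simp add: o_def)
qed (use profileD[OF p] in auto)

text \<open>The sum is left linear in the mass; the square in A is completed only in
  \<open>L2_stability\<close>, where the mass is known to be near that of the compacton.\<close>

lemma deficit_sum:
  assumes p: "profile a b q q'" and ab: "a < 0" "0 < b"
    and A: "A > 0" "\<And>x. norm (q x) \<le> A" and q0: "norm (q 0) = A"
  shows "right_deficit A b q q' + right_deficit A (-a) (\<lambda>x. q (-x)) (\<lambda>x. - q' (-x)) =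
    4 * profile_energy q q' + 2 * A * (LBINT x. norm (q x)) - hw * A\<^sup>2"
proof -
  note bs = profile_bounded_support[OF p]
  let ?f = "\<lambda>x. (norm (q' x))\<^sup>2 + 2 * (norm (q x) * (A - norm (q x)))"
  have f: "bounded_support ?f"
  proof -
    have "bounded_support (\<lambda>x. (norm (q' x))\<^sup>2 + 2 * (A * norm (q x) - (norm (q x))\<^sup>2))"
      by (intro bounded_support_intros bs)
    then show ?thesis
      by (simp add: power2_eq_square algebra_simps)
  qed
  have "right_deficit A (-a) (\<lambda>x. q (-x)) (\<lambda>x. - q' (-x)) = (LBINT x. indicator {0<..<-a} x * ?f (-x)) - hw * A\<^sup>2 / 2"
    using right_deficit_eq[OF profile_reflect[OF p], of A] ab A q0 by simp
  also have "(LBINT x. indicator {0<..<-a} x * ?f (-x)) = (LBINT x. indicator {a<..<0} x * ?f x)"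
  proof -
    have *: "(LBINT x. indicator {a<..<0} x * ?f x) = (LBINT x. indicator {a<..<0} (-x) * ?f (-x))"
      using lborel_integral_real_affine[of "-1" "\<lambda>x. indicator {a<..<0} x * ?f x" 0] by simp
    have "indicator {a<..<0} (-x) = (indicator {0<..<-a} x :: real)" for x
      by (auto simp: indicator_def)
    then have "(LBINT x. indicator {a<..<0} (-x) * ?f (-x)) = (LBINT x. indicator {0<..<-a} x * ?f (-x))"
      by simp
    with * show ?thesis by simp
  qed
  also have "(LBINT x. indicator {a<..<0} x * ?f x) = (LBINT x. ?f x) - (LBINT x. indicator {0<..<b} x * ?f x)"
  proof -
    have "(LBINT x. ?f x) = (LBINT x. indicator {a<..<0} x * ?f x + indicator {0<..<b} x * ?f x)"
    proof (rule integral_cong_AE)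
      show "AE x in lborel. ?f x = indicator {a<..<0} x * ?f x + indicator {0<..<b} x * ?f x"
        using AE_lborel_singleton[of 0]
      proof eventually_elim
        case (elim x)
        then show ?case
          using profileD(6,7)[OF p, of x] by (cases "x \<in> {a<..<b}") (auto simp: indicator_def)
      qed
    qed (use f in \<open>auto simp: bounded_support_def\<close>)
    also have "\<dots> = (LBINT x. indicator {a<..<0} x * ?f x) + (LBINT x. indicator {0<..<b} x * ?f x)"
      by (intro Bochner_Integration.integral_add integrable_bounded_support bounded_support_mult
          bounded_support_indicator f)
    finally show ?thesis by simp
  qed
  also have "(LBINT x. ?f x) = (LBINT x. (norm (q' x))\<^sup>2) + 2 * A * (LBINT x. norm (q x)) - 2 * (LBINT x. (norm (q x))\<^sup>2)"
  proof -
    have "integrable lborel (\<lambda>x. (norm (q' x))\<^sup>2)" "integrable lborel (\<lambda>x. (norm (q x))\<^sup>2)"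
      "integrable lborel (\<lambda>x. norm (q x))"
      by (intro integrable_bounded_support bounded_support_intros bs)+
    moreover have "?f x = (norm (q' x))\<^sup>2 + 2 * A * norm (q x) - 2 * (norm (q x))\<^sup>2" for x
      by (simp add: power2_eq_square algebra_simps)
    ultimately show ?thesis by simp
  qed
  finally show ?thesis
    using right_deficit_eq[OF p ab A q0] by (simp add: profile_energy_def)
qed

text \<open>A Gronwall estimate for the squared positive part of d = B - Re q, where B is the
  compacton of height A with its phase advanced by \<eta>. It starts from zero because B 0 is at
  most A = \<open>q 0\<close>. The defect of \<open>q\<close> in the equation enters through its
  squared norm, whose integral is the deficit, so the defect need not be small pointwise.\<close>

lemma right_lower_bound_inside:
  assumes p: "profile a b q q'" and ab: "a < 0" "0 < b"
    and A: "A > 0" "\<And>x. norm (q x) \<le> A" and q0: "q 0 = complex_of_real A"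
    and \<eta>: "0 < \<eta>" "\<eta> < pi / 2" and y: "0 \<le> y" "y \<le> b" "sqrt 2 * y + \<eta> \<le> pi"
  shows "A / 2 * (1 + cos (sqrt 2 * y + \<eta>)) - Re (q y)
    \<le> sqrt (exp ((4 * sqrt 2 / sin \<eta> + 1) * hw) * right_deficit A b q q')"
proof -
  note bs = profile_bounded_support[OF p] bounded_support_slope[OF p A(2)]
  define K where "K = 2 * sqrt 2 / sin \<eta>"
  \<comment> \<open>Chosen so that 2 d (K d + e) is at most L d^2 + e^2.\<close>
  define L where "L = 2 * K + 1"
  have sin\<eta>: "sin \<eta> > 0" using \<eta> by (intro sin_gt_zero) auto
  then have K: "K \<ge> 0" "L \<ge> 0" by (auto simp: K_def L_def)
  define B where "B x = A / 2 * (1 + cos (sqrt 2 * x + \<eta>))" for x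
  define d where "d x = B x - Re (q x)" for x
  define d' where "d' x = - (A / sqrt 2 * sin (sqrt 2 * x + \<eta>)) - Re (q' x)" for x
  define dp where "dp x = max (d x) 0" for x
  let ?e = "\<lambda>x. q' x + complex_of_real (slope A (norm (q x)) / norm (q x)) * q x"
  have dB: "(B has_real_derivative - (A / sqrt 2 * sin (sqrt 2 * x + \<eta>))) (at x)" for x
  proof -
    have "(B has_real_derivative A / 2 * (- sin (sqrt 2 * x + \<eta>) * sqrt 2)) (at x)"
      unfolding B_def by (auto intro!: derivative_eq_intros)
    moreover have "A / 2 * (- s * sqrt 2) = - (A / sqrt 2 * s)" for s
      by (simp add: real_div_sqrt field_simps)
    ultimately show ?thesis by simp
  qed
  have dd: "(d has_real_derivative d' x) (at x)" if "x \<in> {a<..<b}" for x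
  proof -
    have "((\<lambda>x. Re (q x)) has_real_derivative Re (q' x)) (at x)"
      using bounded_linear.has_vector_derivative[OF bounded_linear_Re profileD(5)[OF p that]]
      by (simp add: has_real_derivative_iff_has_vector_derivative)
    then show ?thesis
      unfolding d_def[abs_def] d'_def using dB by (intro DERIV_diff) auto
  qed
  \<comment> \<open>Nothing is needed where d is not positive. Where d > 0 one has Re q < B, so the
    ratio bound and then the one-sided Lipschitz bound apply.\<close>
  have main: "2 * dp x * d' x \<le> L * (dp x)\<^sup>2 + (norm (?e x))\<^sup>2" if x: "x \<in> {0<..<y}" for x
  proof (cases "d x > 0")
    case False
    then have "dp x = 0" by (simp add: dp_def)
    then show ?thesis by simp
  next
    case True
    then have dp: "dp x = d x" by (simp add: dp_def)
    have xab: "x \<in> {a<..<b}" using x y ab by auto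
    have nz: "0 < norm (q x)" using profileD(4)[OF p xab] by simp
    define \<theta> where "\<theta> = sqrt 2 * x + \<eta>"
    have \<theta>: "\<eta> \<le> \<theta>" "\<theta> \<le> pi"
    proof -
      have "sqrt 2 * x \<le> sqrt 2 * y" using x by simp
      moreover have "0 \<le> sqrt 2 * x" using x by simp
      ultimately show "\<eta> \<le> \<theta>" "\<theta> \<le> pi" using y(3) unfolding \<theta>_def by linarith+
    qed
    have 1: "slope A (norm (q x)) / norm (q x) * Re (q x) \<le> sqrt (2 * (max (Re (q x)) 0 * (A - max (Re (q x)) 0)))"
      unfolding slope_def by (rule sqrt_parabola_ratio_le[OF nz A(2) complex_Re_le_cmod])
    have 2: "sqrt (2 * (max (Re (q x)) 0 * (A - max (Re (q x)) 0))) - A / sqrt 2 * sin \<theta> \<le> K * d x"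
      unfolding K_def d_def
      by (rule sqrt_parabola_one_sided_Lipschitz[OF A(1) \<eta> \<theta>]) (use True in \<open>auto simp: B_def d_def \<theta>_def\<close>)
    have "Re (?e x) = Re (q' x) + slope A (norm (q x)) / norm (q x) * Re (q x)"
      by simp
    then have "d' x \<le> K * d x + norm (?e x)"
      using 1 2 abs_Re_le_cmod[of "?e x"] unfolding d'_def \<theta>_def[symmetric] by linarith
    then have "2 * d x * d' x \<le> 2 * d x * (K * d x + norm (?e x))"
      using True by (intro mult_left_mono) auto
    also have "\<dots> \<le> L * (d x)\<^sup>2 + (norm (?e x))\<^sup>2"
      using sum_squares_bound[of "d x" "norm (?e x)"] by (simp add: L_def power2_eq_square algebra_simps)
    finally show ?thesis by (simp add: dp)
  qed
  let ?w = "\<lambda>x. exp (- L * x)"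
  let ?D = "\<lambda>x. indicator {0<..<y} x * (?w x * (2 * dp x * d' x - L * (dp x)\<^sup>2))"
  have d0: "dp 0 = 0"
    using A(1) by (simp add: dp_def d_def B_def q0 mult_left_mono)
  have cont_d: "continuous_on {0..y} d"
    unfolding d_def[abs_def] B_def by (intro continuous_intros profileD(2)[OF p])
  have bsd: "bounded_support (\<lambda>x. indicator {0..y} x * h x)" if "continuous_on {0..y} h" for h :: "real \<Rightarrow> real"
  proof -
    have "compact (h ` {0..y})" using that by (intro compact_continuous_image) auto
    then obtain C where C: "\<And>x. x \<in> {0..y} \<Longrightarrow> norm (h x) \<le> C"
      using compact_imp_bounded bounded_iff by (metis imageI)
    have m: "(\<lambda>x. indicator {0..y} x *\<^sub>R h x) \<in> borel_measurable borel"
      using that by (intro borel_measurable_continuous_on_indicator) auto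
    show ?thesis
    proof (rule bounded_supportI[of _ "max 0 C" 0 y])
      show "norm (indicator {0..y} x * h x) \<le> max 0 C" for x
        using C[of x] by (cases "x \<in> {0..y}") auto
    qed (use m in auto)
  qed
  have iD: "integrable lborel ?D"
  proof -
    have b: "bounded_support (\<lambda>x. indicator {0..y} x * (?w x * 2 * dp x))"
      "bounded_support (\<lambda>x. indicator {0..y} x * - (A / sqrt 2 * sin (sqrt 2 * x + \<eta>)))"
      "bounded_support (\<lambda>x. indicator {0..y} x * (?w x * L * (dp x)\<^sup>2))"
      unfolding dp_def by (intro bsd continuous_intros cont_d; simp)+
    \<comment> \<open>The indicators of [0, y], equal to 1 on (0, y), give every continuous factor
      bounded support.\<close>
    have "?D x = indicator {0<..<y} x * (indicator {0..y} x * (?w x * 2 * dp x) * (indicator {0..y} x * - (A / sqrt 2 * sin (sqrt 2 * x + \<eta>)) - Re (q' x))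
        - indicator {0..y} x * (?w x * L * (dp x)\<^sup>2))" for x
      by (auto simp: indicator_def d'_def algebra_simps)
    moreover have "integrable lborel (\<lambda>x. indicator {0<..<y} x * (indicator {0..y} x * (?w x * 2 * dp x) * (indicator {0..y} x * - (A / sqrt 2 * sin (sqrt 2 * x + \<eta>)) - Re (q' x))
        - indicator {0..y} x * (?w x * L * (dp x)\<^sup>2)))"
      by (rule integrable_bounded_support, rule bounded_support_mult[OF bounded_support_indicator(2)],
          rule bounded_support_diff[OF bounded_support_mult[OF b(1) bounded_support_diff[OF b(2)]] b(3)],
          rule bounded_support_Re[OF bs(2)])
    ultimately show ?thesis by (simp only:)
  qed
  have "(LBINT x. ?D x) = ?w y * (dp y)\<^sup>2 - ?w 0 * (dp 0)\<^sup>2"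
  proof (rule LBINT_FTC[where H="\<lambda>x. ?w x * (dp x)\<^sup>2"])
    show "continuous_on {0..y} (\<lambda>x. ?w x * (dp x)\<^sup>2)"
      unfolding dp_def by (intro continuous_intros cont_d)
    show "((\<lambda>x. ?w x * (dp x)\<^sup>2) has_vector_derivative ?D x) (at x)" if x: "x \<in> {0<..<y}" for x
    proof -
      have xab: "x \<in> {a<..<b}" using x y ab by auto
      have 1: "((\<lambda>x. (dp x)\<^sup>2) has_real_derivative 2 * dp x * d' x) (at x)"
        unfolding dp_def by (rule DERIV_pos_part_sq[OF dd[OF xab]])
      have 2: "(?w has_real_derivative ?w x * - L) (at x)"
        by (auto intro!: derivative_eq_intros)
      have "((\<lambda>x. ?w x * (dp x)\<^sup>2) has_real_derivative ?D x) (at x)"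
        by (rule DERIV_cong[OF DERIV_mult[OF 2 1]]) (use x in \<open>simp add: algebra_simps\<close>)
      then show ?thesis by (simp add: has_real_derivative_iff_has_vector_derivative)
    qed
  qed (use y iD in auto)
  also have "\<dots> = ?w y * (dp y)\<^sup>2" by (simp add: d0)
  finally have "?w y * (dp y)\<^sup>2 = (LBINT x. ?D x)" by simp
  also have "\<dots> \<le> right_deficit A b q q'"
    unfolding right_deficit_def
  proof (rule integral_mono[OF iD])
    show "integrable lborel (\<lambda>x. indicator {0<..<b} x * (norm (?e x))\<^sup>2)"
      by (intro integrable_bounded_support bounded_support_intros bs)
    show "?D x \<le> indicator {0<..<b} x * (norm (?e x))\<^sup>2" for x
    proof (cases "x \<in> {0<..<y}")
      case True
      have "?w x * (2 * dp x * d' x - L * (dp x)\<^sup>2) \<le> ?w x * (norm (?e x))\<^sup>2"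
        using main[OF True] by (intro mult_left_mono) auto
      also have "\<dots> \<le> 1 * (norm (?e x))\<^sup>2"
        using True K by (intro mult_right_mono) auto
      finally show ?thesis using True y by (simp add: indicator_def)
    qed (auto simp: indicator_def)
  qed
  finally have "?w y * (dp y)\<^sup>2 \<le> right_deficit A b q q'" .
  then have "exp (L * y) * (?w y * (dp y)\<^sup>2) \<le> exp (L * y) * right_deficit A b q q'"
    by (intro mult_left_mono) auto
  moreover have "exp (L * y) * (?w y * (dp y)\<^sup>2) = (dp y)\<^sup>2"
    by (simp add: mult.assoc[symmetric] exp_add[symmetric])
  ultimately have "(dp y)\<^sup>2 \<le> exp (L * y) * right_deficit A b q q'" by linarith
  also have "\<dots> \<le> exp (L * hw) * right_deficit A b q q'"
  proof -
    \<comment> \<open>The phase constraint bounds y by hw, which makes the exponential independent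
      of the profile.\<close>
    have "sqrt 2 * y \<le> sqrt 2 * hw" using y \<eta> by (simp add: sqrt2_hw)
    then have "y \<le> hw" by simp
    then show ?thesis
      using K right_deficit_nonneg by (intro mult_right_mono) (auto intro: mult_left_mono)
  qed
  finally have "dp y \<le> sqrt (exp (L * hw) * right_deficit A b q q')"
    by (rule real_le_rsqrt)
  moreover have "d y \<le> dp y" by (simp add: dp_def)
  ultimately show ?thesis
    by (simp add: d_def B_def L_def K_def)
qed

text \<open>Beyond b the profile is zero while the comparison function decreases, so the estimate at
  b, where the profile is zero too, carries over.\<close>

lemma right_lower_bound:
  assumes p: "profile a b q q'" and ab: "a < 0" "0 < b"
    and A: "A > 0" "\<And>x. norm (q x) \<le> A" and q0: "q 0 = complex_of_real A"
    and \<eta>: "0 < \<eta>" "\<eta> < pi / 2" and y: "0 \<le> y" "sqrt 2 * y + \<eta> \<le> pi"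
  shows "A / 2 * (1 + cos (sqrt 2 * y + \<eta>)) - Re (q y)
    \<le> sqrt (exp ((4 * sqrt 2 / sin \<eta> + 1) * hw) * right_deficit A b q q')"
proof (cases "y \<le> b")
  case True
  then show ?thesis
    using right_lower_bound_inside[OF p ab A q0 \<eta>] y by blast
next
  case False
  then have "q y = 0" "q b = 0" using profileD(6)[OF p, of y] profileD(6)[OF p, of b] by auto
  have b: "sqrt 2 * b \<le> sqrt 2 * y" using False by simp
  have "cos (sqrt 2 * y + \<eta>) \<le> cos (sqrt 2 * b + \<eta>)"
    using b ab \<eta> y by (intro cos_monotone_0_pi_le) auto
  then have "A / 2 * (1 + cos (sqrt 2 * y + \<eta>)) \<le> A / 2 * (1 + cos (sqrt 2 * b + \<eta>))"
    using A(1) by (intro mult_left_mono) auto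
  moreover have "A / 2 * (1 + cos (sqrt 2 * b + \<eta>)) - Re (q b)
      \<le> sqrt (exp ((4 * sqrt 2 / sin \<eta> + 1) * hw) * right_deficit A b q q')"
    using b ab y(2) by (intro right_lower_bound_inside[OF p ab A q0 \<eta>]) linarith+
  ultimately show ?thesis
    using \<open>q y = 0\<close> \<open>q b = 0\<close> by simp
qed

lemma lower_bound:
  assumes p: "profile a b q q'" and ab: "a < 0" "0 < b"
    and A: "A > 0" "\<And>x. norm (q x) \<le> A" and q0: "q 0 = complex_of_real A"
    and D: "4 * profile_energy q q' + 2 * A * (LBINT x. norm (q x)) - hw * A\<^sup>2 \<le> D"
    and \<eta>: "0 < \<eta>" "\<eta> < pi / 2" and x: "sqrt 2 * \<bar>x\<bar> + \<eta> \<le> pi"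
  shows "A / 2 * (1 + cos (sqrt 2 * \<bar>x\<bar> + \<eta>)) - sqrt (exp ((4 * sqrt 2 / sin \<eta> + 1) * hw) * D) \<le> Re (q x)"
proof -
  have sum: "right_deficit A b q q' + right_deficit A (-a) (\<lambda>x. q (-x)) (\<lambda>x. - q' (-x)) \<le> D"
    using deficit_sum[OF p ab A] q0 A(1) D by simp
  have mono: "sqrt (exp ((4 * sqrt 2 / sin \<eta> + 1) * hw) * d) \<le> sqrt (exp ((4 * sqrt 2 / sin \<eta> + 1) * hw) * D)"
    if "d \<le> D" for d
    using that by (intro real_sqrt_le_mono mult_left_mono) auto
  show ?thesis
  proof (cases "x \<ge> 0")
    case True
    have "right_deficit A b q q' \<le> D"
      using sum right_deficit_nonneg[of A "-a" "\<lambda>x. q (-x)" "\<lambda>x. - q' (-x)"] by linarith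
    note mono[OF this]
    moreover have "A / 2 * (1 + cos (sqrt 2 * \<bar>x\<bar> + \<eta>)) - Re (q x)
        \<le> sqrt (exp ((4 * sqrt 2 / sin \<eta> + 1) * hw) * right_deficit A b q q')"
      using right_lower_bound[OF p ab A q0 \<eta>, of x] x True by simp
    ultimately show ?thesis by linarith
  next
    case False
    have "right_deficit A (-a) (\<lambda>x. q (-x)) (\<lambda>x. - q' (-x)) \<le> D"
      using sum right_deficit_nonneg[of A b q q'] by linarith
    note mono[OF this]
    moreover have "A / 2 * (1 + cos (sqrt 2 * \<bar>x\<bar> + \<eta>)) - Re (q x)
        \<le> sqrt (exp ((4 * sqrt 2 / sin \<eta> + 1) * hw) * right_deficit A (-a) (\<lambda>x. q (-x)) (\<lambda>x. - q' (-x)))"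
      using right_lower_bound[OF profile_reflect[OF p] _ _ A(1) _ _ \<eta>, of "-x"] x False ab A(2) q0 by simp
    ultimately show ?thesis by linarith
  qed
qed

text \<open>Pointwise |q - Q|^2 = (|q| - Q)(|q| + Q) + 2 Q (Q - Re q). The lower bound on Re q makes
  this at most 2 A (|q| - Q), up to a small constant on the support of Q, and |q| - Q integrates to
  a difference of masses. A one-sided bound thus becomes a two-sided one.\<close>

lemma L2_distance_bound:
  assumes p: "profile a b q q'" and ab: "a < 0" "0 < b"
    and A: "A > 0" "\<And>x. norm (q x) \<le> A" and q0: "q 0 = complex_of_real A"
    and D: "4 * profile_energy q q' + 2 * A * (LBINT x. norm (q x)) - hw * A\<^sup>2 \<le> D"
    and \<eta>: "0 < \<eta>" "\<eta> < pi / 2"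
    and \<kappa>_def: "\<kappa> = sqrt (exp ((4 * sqrt 2 / sin \<eta> + 1) * hw) * D)"
  shows "(LBINT x. (norm (q x - complex_of_real (csq (A / 2) x)))\<^sup>2)
    \<le> 2 * A * ((LBINT x. norm (q x)) - hw * A) + 2 * hw * (4 * A * \<kappa> + 5 * A\<^sup>2 * \<eta>)"
proof -
  have A2: "A / 2 > 0" using A(1) by simp
  note bs = profile_bounded_support[OF p] bounded_support_csq[OF A2]
  have "D \<ge> 0"
    using D deficit_sum[OF p ab A] right_deficit_nonneg[of A b q q'] q0 A(1)
      right_deficit_nonneg[of A "-a" "\<lambda>x. q (-x)" "\<lambda>x. - q' (-x)"] by simp
  then have \<kappa>: "\<kappa> \<ge> 0" by (simp add: \<kappa>_def)
  \<comment> \<open>4 A \<kappa> pays for the Gronwall error, 5 A^2 \<eta> for the phase shift and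
    for the strips near the ends of the support that the lower bound misses.\<close>
  define c where "c = 4 * A * \<kappa> + 5 * A\<^sup>2 * \<eta>"
  have pw: "(norm (q x - complex_of_real (csq (A / 2) x)))\<^sup>2 \<le> 2 * A * (norm (q x) - csq (A / 2) x) + c * indicator {-hw<..<hw} x" for x
  proof -
    define \<rho> where "\<rho> = norm (q x)"
    define Q where "Q = csq (A / 2) x"
    define R where "R = Re (q x)"
    have \<rho>: "0 \<le> \<rho>" "\<rho> \<le> A" "R \<le> \<rho>" "- \<rho> \<le> R"
      using A(2) abs_Re_le_cmod[of "q x"] by (auto simp: \<rho>_def R_def)
    have Q: "0 \<le> Q" "Q \<le> A" using csq_bounds[of "A / 2" x] A(1) by (auto simp: Q_def)
    have e: "(norm (q x - complex_of_real Q))\<^sup>2 = \<rho>\<^sup>2 + Q\<^sup>2 - 2 * (R * Q)"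
      using norm_diff_unit_mult[of 1 "q x" Q] by (simp add: \<rho>_def R_def)
    show ?thesis
    proof (cases "x \<in> {-hw<..<hw}")
      case False
      then have "Q = 0" by (auto simp: Q_def csq_def)
      moreover have "\<rho>\<^sup>2 \<le> 2 * A * \<rho>"
        using \<rho> mult_right_mono[of \<rho> "2 * A" \<rho>] by (simp add: power2_eq_square)
      ultimately show ?thesis using e False by (simp add: Q_def \<rho>_def)
    next
      case True
      define t where "t = sqrt 2 * \<bar>x\<bar>"
      have t: "0 \<le> t" "t \<le> pi"
        using True abs_less_hw_iff[of x] by (auto simp: t_def abs_mult)
      have Qt: "Q = A / 2 * (1 + cos t)"
        using True cos_abs_real[of "sqrt 2 * x"] by (simp add: Q_def csq_def t_def abs_mult)
      have "\<rho>\<^sup>2 + Q\<^sup>2 - 2 * (R * Q) \<le> 2 * A * (\<rho> - Q) + c"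
      proof (cases "t + \<eta> \<le> pi")
        case True
        \<comment> \<open>Undoing the phase shift costs A \<eta>/2, since the cosine is
          1-Lipschitz.\<close>
        define \<tau> where "\<tau> = A * \<eta> / 2 + \<kappa>"
        have \<tau>0: "\<tau> \<ge> 0" using A(1) \<eta> \<kappa> by (simp add: \<tau>_def)
        have "cos t - cos (t + \<eta>) \<le> \<eta>"
          using abs_cos_diff_le[of t "t + \<eta>"] \<eta> by simp
        then have "A / 2 * (cos t - cos (t + \<eta>)) \<le> A / 2 * \<eta>"
          using A(1) by (intro mult_left_mono) auto
        then have "Q - A * \<eta> / 2 \<le> A / 2 * (1 + cos (t + \<eta>))"
          unfolding Qt by (simp add: algebra_simps)
        moreover have "A / 2 * (1 + cos (t + \<eta>)) - \<kappa> \<le> R"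
          using lower_bound[OF p ab A q0 D \<eta>, of x] True by (simp add: t_def \<kappa>_def R_def)
        ultimately have R: "Q - \<tau> \<le> R" by (simp add: \<tau>_def)
        \<comment> \<open>This product is \<rho>^2 - Q^2 - 2 A (\<rho> - Q). As \<rho> and Q are at
          most A, it can be positive only for \<rho> < Q, and then Q - \<rho> is at most
          \<tau>.\<close>
        have "(\<rho> - Q) * (\<rho> + Q - 2 * A) \<le> \<tau> * (2 * A)"
        proof (cases "\<rho> \<ge> Q")
          case True
          then have "(\<rho> - Q) * (\<rho> + Q - 2 * A) \<le> 0"
            using \<rho> Q by (intro mult_nonneg_nonpos) auto
          moreover have "0 \<le> \<tau> * (2 * A)" using \<tau>0 A(1) by simp
          ultimately show ?thesis by linarith
        next
          case False
          have "(Q - \<rho>) * (2 * A - \<rho> - Q) \<le> \<tau> * (2 * A)"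
            using False R \<rho> Q \<tau>0 by (intro mult_mono) auto
          then show ?thesis by (simp add: algebra_simps)
        qed
        moreover have "Q * (Q - R) \<le> A * \<tau>"
          using R Q \<tau>0 A(1) mult_left_mono[of "Q - R" \<tau> Q] mult_right_mono[of Q A \<tau>] by simp
        moreover have "4 * A * \<tau> \<le> c"
          using A(1) \<eta> by (simp add: \<tau>_def c_def power2_eq_square algebra_simps)
        ultimately show ?thesis
          by (simp add: power2_eq_square algebra_simps)
      next
        case False
        \<comment> \<open>Close to the ends Q is at most A \<eta>/2. With \<rho>^2 at most 2 A
          \<rho>, the terms Q^2, - 2 R Q and 2 A Q add up to at most 5 A Q.\<close>
        have "cos t - cos pi \<le> \<eta>"
          using abs_cos_diff_le[of t pi] t False by simp
        then have "A / 2 * (1 + cos t) \<le> A / 2 * \<eta>"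
          using A(1) by (intro mult_left_mono) auto
        then have Q1: "Q \<le> A * \<eta> / 2" unfolding Qt by simp
        have "\<rho> * \<rho> \<le> 2 * A * \<rho>" using \<rho> by (intro mult_right_mono) auto
        moreover have "Q * Q \<le> A * Q" using Q by (intro mult_right_mono) auto
        moreover have "- (R * Q) \<le> A * Q" using \<rho> Q mult_right_mono[of "- R" A Q] by simp
        moreover have "5 * A * Q \<le> 5 * A * (A * \<eta> / 2)" using Q1 A(1) by (intro mult_left_mono) auto
        moreover have "5 * A * (A * \<eta> / 2) \<le> c"
          using A(1) \<kappa> \<eta> by (simp add: c_def power2_eq_square)
        ultimately show ?thesis
          by (simp add: power2_eq_square algebra_simps)
      qed
      then show ?thesis using e True by (simp add: Q_def \<rho>_def)
    qed
  qed
  have i: "integrable lborel (\<lambda>x. norm (q x))" "integrable lborel (csq (A / 2))"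
      "integrable lborel (indicator {-hw<..<hw} :: real \<Rightarrow> real)"
    by (intro integrable_bounded_support bounded_support_intros bs)+
  have "(LBINT x. (norm (q x - complex_of_real (csq (A / 2) x)))\<^sup>2)
      \<le> (LBINT x. 2 * A * (norm (q x) - csq (A / 2) x) + c * indicator {-hw<..<hw} x)"
    using pw by (intro integral_mono integrable_bounded_support bounded_support_intros bs)
  also have "\<dots> = 2 * A * ((LBINT x. norm (q x)) - (LBINT x. csq (A / 2) x)) + c * (LBINT x. indicator {-hw<..<hw} x)"
    using i by simp
  also have "(LBINT x. csq (A / 2) x) = hw * A"
    using LBINT_csq[OF A2] by simp
  also have "(LBINT x. indicator {-hw<..<hw} x :: real) = 2 * hw"
    using hw_pos by simp
  finally show ?thesis by (simp add: c_def mult.commute)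
qed

text \<open>The shift \<eta> is fixed before \<delta>: the Gronwall constant blows up as \<eta>
  tends to 0, but for fixed \<eta> it multiplies a quantity that vanishes with \<delta>.\<close>

lemma L2_stability:
  assumes \<omega>: "\<omega> > 0" and \<epsilon>: "\<epsilon> > 0"
  shows "\<exists>\<delta>>0. \<forall>a b q q' A. profile a b q q' \<and> a < 0 \<and> 0 < b \<and> 0 < A \<and> (\<forall>x. norm (q x) \<le> A) \<and>
    q 0 = complex_of_real A \<and> profile_energy q q' \<le> - hw * \<omega>\<^sup>2 + \<delta> \<and>
    \<bar>(LBINT x. norm (q x)) - 2 * hw * \<omega>\<bar> \<le> \<delta> \<longrightarrow>
    (LBINT x. (norm (q x - complex_of_real (csq \<omega> x)))\<^sup>2) \<le> \<epsilon>"
proof -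
  \<comment> \<open>At \<delta> = 0 the final bound \<Psi> reduces to 80 hw \<omega>^2 \<eta>, which
    has to be below \<epsilon>; the minimum with 1 keeps \<eta> below pi/2.\<close>
  define \<eta> where "\<eta> = min 1 (\<epsilon> / (160 * hw * \<omega>\<^sup>2))"
  have \<eta>: "0 < \<eta>" "\<eta> < pi / 2" "80 * hw * \<omega>\<^sup>2 * \<eta> < \<epsilon>"
  proof -
    have h: "0 < 160 * hw * \<omega>\<^sup>2" using \<omega> hw_pos by simp
    then show "0 < \<eta>" using \<epsilon> by (simp add: \<eta>_def)
    show "\<eta> < pi / 2" using pi_gt3 by (simp add: \<eta>_def)
    have "160 * hw * \<omega>\<^sup>2 * \<eta> \<le> 160 * hw * \<omega>\<^sup>2 * (\<epsilon> / (160 * hw * \<omega>\<^sup>2))"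
      using h by (intro mult_left_mono) (auto simp: \<eta>_def)
    also have "\<dots> = \<epsilon>" using \<omega> hw_pos by simp
    finally show "80 * hw * \<omega>\<^sup>2 * \<eta> < \<epsilon>" using \<epsilon> by simp
  qed
  define E where "E = exp ((4 * sqrt 2 / sin \<eta> + 1) * hw)"
  \<comment> \<open>Bounds that do not depend on the profile: \<open>D\<close> for the deficit,
    \<open>d\<close> for the distance of A from 2 \<omega>, \<open>M\<close> for A itself and \<Psi>
    for the squared distance in L^2.\<close>
  define D where "D \<delta> = 4 * \<delta> + 4 * \<omega> * \<delta> + \<delta>\<^sup>2 / hw" for \<delta>
  define d where "d \<delta> = sqrt (D \<delta> / hw) + \<delta> / hw" for \<delta>
  define M where "M \<delta> = 2 * \<omega> + d \<delta>" for \<delta>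
  define \<Psi> where "\<Psi> \<delta> = 4 * M \<delta> * (hw * sqrt (D \<delta> / hw)) + 4 * hw * (4 * M \<delta> * sqrt (E * D \<delta>) + 5 * (M \<delta>)\<^sup>2 * \<eta>)
      + 4 * hw * (d \<delta>)\<^sup>2" for \<delta>
  have "\<Psi> 0 < \<epsilon>"
    using \<eta>(3) by (simp add: \<Psi>_def M_def d_def D_def power2_eq_square algebra_simps)
  moreover have "isCont \<Psi> 0"
    unfolding \<Psi>_def[abs_def] M_def d_def D_def using hw_pos by (intro continuous_intros) auto
  ultimately have "\<forall>\<^sub>F \<delta> in at_right 0. \<Psi> \<delta> < \<epsilon>"
    by (metis continuous_within filterlim_at_split isCont_def order_tendstoD(2))
  then have "\<forall>\<^sub>F \<delta> in at_right (0::real). \<Psi> \<delta> < \<epsilon> \<and> 0 < \<delta>"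
    by (intro eventually_conj eventually_at_right_less)
  then obtain \<delta> where \<delta>: "\<Psi> \<delta> < \<epsilon>" "0 < \<delta>"
    using eventually_happens[of _ "at_right (0::real)"] by auto
  show ?thesis
  proof (intro exI[of _ \<delta>] conjI allI impI; (elim conjE)?)
    fix a b q q' A
    assume p: "profile a b q q'" and ab: "a < 0" "0 < b" and A: "0 < (A::real)" "\<forall>x. norm (q x) \<le> A"
      and q0: "q 0 = complex_of_real A" and en: "profile_energy q q' \<le> - hw * \<omega>\<^sup>2 + \<delta>"
      and ma: "\<bar>(LBINT x. norm (q x)) - 2 * hw * \<omega>\<bar> \<le> \<delta>"
    define m where "m = (LBINT x. norm (q x))"
    note bs = profile_bounded_support[OF p]
    have A': "\<And>x. norm (q x) \<le> A" using A(2) by blast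
    have m0: "0 \<le> m" unfolding m_def by (intro Bochner_Integration.integral_nonneg) auto
    have m2: "m\<^sup>2 / hw \<le> 4 * hw * \<omega>\<^sup>2 + 4 * \<omega> * \<delta> + \<delta>\<^sup>2 / hw"
    proof -
      have "m\<^sup>2 \<le> (2 * hw * \<omega> + \<delta>)\<^sup>2"
        using ma m0 by (intro power_mono) (auto simp: m_def)
      then have "m\<^sup>2 / hw \<le> (2 * hw * \<omega> + \<delta>)\<^sup>2 / hw"
        using hw_pos by (intro divide_right_mono) auto
      also have "\<dots> = 4 * hw * \<omega>\<^sup>2 + 4 * \<omega> * \<delta> + \<delta>\<^sup>2 / hw"
        using hw_pos by (simp add: field_simps power2_eq_square)
      finally show ?thesis .
    qed
    \<comment> \<open>The square in A is completed. The deficit is non-negative, which bounds the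
      square, and the square is non-negative, which bounds the deficit.\<close>
    have id: "4 * profile_energy q q' + 2 * A * m - hw * A\<^sup>2 = 4 * profile_energy q q' + m\<^sup>2 / hw - hw * (A - m / hw)\<^sup>2"
      using hw_pos by (simp add: field_simps power2_eq_square)
    have nn: "0 \<le> 4 * profile_energy q q' + 2 * A * m - hw * A\<^sup>2"
      using deficit_sum[OF p ab A(1) A'] right_deficit_nonneg[of A b q q'] q0 A(1)
        right_deficit_nonneg[of A "-a" "\<lambda>x. q (-x)" "\<lambda>x. - q' (-x)"] by (simp add: m_def)
    have up: "4 * profile_energy q q' + m\<^sup>2 / hw \<le> D \<delta>"
      using en m2 by (simp add: D_def)
    have sq: "0 \<le> hw * (A - m / hw)\<^sup>2" using hw_pos by simp
    have D1: "4 * profile_energy q q' + 2 * A * (LBINT x. norm (q x)) - hw * A\<^sup>2 \<le> D \<delta>"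
      using id up sq by (simp add: m_def)
    have "hw * (A - m / hw)\<^sup>2 \<le> D \<delta>"
      using id up nn by linarith
    then have "(A - m / hw)\<^sup>2 \<le> D \<delta> / hw"
      using hw_pos by (simp add: field_simps)
    then have Am: "\<bar>A - m / hw\<bar> \<le> sqrt (D \<delta> / hw)"
      using real_sqrt_le_mono by fastforce
    have m\<omega>: "\<bar>m / hw - 2 * \<omega>\<bar> \<le> \<delta> / hw"
    proof -
      have "\<bar>m / hw - 2 * \<omega>\<bar> = \<bar>m - 2 * hw * \<omega>\<bar> / hw"
        using hw_pos by (simp add: field_simps abs_if)
      then show ?thesis using ma hw_pos by (simp add: m_def divide_right_mono)
    qed
    have A\<omega>: "\<bar>A - 2 * \<omega>\<bar> \<le> d \<delta>"
      using Am m\<omega> unfolding d_def by linarith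
    have AM: "A \<le> M \<delta>" using A\<omega> by (simp add: M_def)
    have D0: "0 \<le> D \<delta>" using D1 nn by (simp add: m_def)
    have mA: "m - hw * A \<le> hw * sqrt (D \<delta> / hw)"
    proof -
      have "m - hw * A = hw * (m / hw - A)" using hw_pos by (simp add: field_simps)
      also have "\<dots> \<le> hw * sqrt (D \<delta> / hw)" using Am hw_pos by (intro mult_left_mono) auto
      finally show ?thesis .
    qed
    have A2: "A / 2 > 0" using A(1) by simp
    note bs = profile_bounded_support[OF p] bounded_support_csq[OF A2] bounded_support_csq[OF \<omega>]
    \<comment> \<open>Passing from height A to height 2 \<omega>: the supports coincide and the two
      compactons differ by at most |A - 2 \<omega>|.\<close>
    have pw: "(norm (q x - complex_of_real (csq \<omega> x)))\<^sup>2 \<le>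
        2 * (norm (q x - complex_of_real (csq (A / 2) x)))\<^sup>2 + 2 * (d \<delta>)\<^sup>2 * indicator {-hw<..<hw} x" for x
    proof -
      have "norm (q x - complex_of_real (csq \<omega> x)) \<le>
          norm (q x - complex_of_real (csq (A / 2) x)) + \<bar>csq (A / 2) x - csq \<omega> x\<bar>"
        using norm_triangle_ineq[of "q x - complex_of_real (csq (A / 2) x)" "complex_of_real (csq (A / 2) x - csq \<omega> x)"]
        unfolding norm_of_real by simp
      also have "\<bar>csq (A / 2) x - csq \<omega> x\<bar> \<le> d \<delta> * indicator {-hw<..<hw} x"
      proof (cases "x \<in> {-hw<..<hw}")
        case True
        have "csq (A / 2) x - csq \<omega> x = (A / 2 - \<omega>) * (1 + cos (sqrt 2 * x))"
          using True by (simp add: csq_def algebra_simps)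
        then have "\<bar>csq (A / 2) x - csq \<omega> x\<bar> = \<bar>A / 2 - \<omega>\<bar> * \<bar>1 + cos (sqrt 2 * x)\<bar>"
          by (simp add: abs_mult)
        also have "\<dots> \<le> \<bar>A / 2 - \<omega>\<bar> * 2"
        proof (rule mult_left_mono)
          show "\<bar>1 + cos (sqrt 2 * x)\<bar> \<le> 2"
            using cos_ge_minus_one[of "sqrt 2 * x"] cos_le_one[of "sqrt 2 * x"] by linarith
        qed auto
        also have "\<dots> = \<bar>(A / 2 - \<omega>) * 2\<bar>" by (simp only: abs_mult abs_numeral)
        also have "\<dots> \<le> d \<delta>" using A\<omega> by simp
        finally show ?thesis using True by simp
      next
        case False
        then show ?thesis by (auto simp: csq_def)
      qed
      finally have "(norm (q x - complex_of_real (csq \<omega> x)))\<^sup>2 \<le>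
          (norm (q x - complex_of_real (csq (A / 2) x)) + d \<delta> * indicator {-hw<..<hw} x)\<^sup>2"
        by (intro power_mono) auto
      also have "\<dots> \<le> 2 * (norm (q x - complex_of_real (csq (A / 2) x)))\<^sup>2 + 2 * (d \<delta> * indicator {-hw<..<hw} x)\<^sup>2"
      proof -
        have "(u + v)\<^sup>2 \<le> 2 * u\<^sup>2 + 2 * v\<^sup>2" for u v :: real
          using sum_squares_bound[of u v] by (simp add: power2_sum)
        then show ?thesis .
      qed
      also have "(d \<delta> * indicator {-hw<..<hw} x)\<^sup>2 = (d \<delta>)\<^sup>2 * indicator {-hw<..<hw} x"
        by (simp add: power_mult_distrib indicator_def)
      finally show ?thesis by (simp only: mult.assoc)
    qed
    have "(LBINT x. (norm (q x - complex_of_real (csq \<omega> x)))\<^sup>2) \<le>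
        (LBINT x. 2 * (norm (q x - complex_of_real (csq (A / 2) x)))\<^sup>2 + 2 * (d \<delta>)\<^sup>2 * indicator {-hw<..<hw} x)"
      using pw by (intro integral_mono integrable_bounded_support bounded_support_intros bs)
    also have "\<dots> = 2 * (LBINT x. (norm (q x - complex_of_real (csq (A / 2) x)))\<^sup>2) + 2 * (d \<delta>)\<^sup>2 * (2 * hw)"
    proof -
      have "integrable lborel (\<lambda>x. (norm (q x - complex_of_real (csq (A / 2) x)))\<^sup>2)"
        "integrable lborel (indicator {-hw<..<hw} :: real \<Rightarrow> real)"
        by (intro integrable_bounded_support bounded_support_intros bs)+
      moreover have "(LBINT x. indicator {-hw<..<hw} x :: real) = 2 * hw"
        using hw_pos by simp
      ultimately show ?thesis by simp
    qed
    also have "(LBINT x. (norm (q x - complex_of_real (csq (A / 2) x)))\<^sup>2) \<le>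
        2 * A * (m - hw * A) + 2 * hw * (4 * A * sqrt (E * D \<delta>) + 5 * A\<^sup>2 * \<eta>)"
      unfolding m_def E_def by (rule L2_distance_bound[OF p ab A(1) A' q0 D1 \<eta>(1,2) refl])
    also have "\<dots> \<le> 2 * M \<delta> * (hw * sqrt (D \<delta> / hw)) + 2 * hw * (4 * M \<delta> * sqrt (E * D \<delta>) + 5 * (M \<delta>)\<^sup>2 * \<eta>)"
    proof (rule add_mono)
      have "2 * A * (m - hw * A) \<le> 2 * A * (hw * sqrt (D \<delta> / hw))"
        using mA A(1) by (intro mult_left_mono) auto
      also have "\<dots> \<le> 2 * M \<delta> * (hw * sqrt (D \<delta> / hw))"
        using AM hw_pos D0 by (intro mult_right_mono) auto
      finally show "2 * A * (m - hw * A) \<le> 2 * M \<delta> * (hw * sqrt (D \<delta> / hw))" .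
      have "E > 0" by (simp add: E_def)
      then have "4 * A * sqrt (E * D \<delta>) \<le> 4 * M \<delta> * sqrt (E * D \<delta>)"
        using AM D0 by (intro mult_right_mono) auto
      moreover have "5 * A\<^sup>2 * \<eta> \<le> 5 * (M \<delta>)\<^sup>2 * \<eta>"
        using AM A(1) \<eta> by (intro mult_right_mono mult_left_mono power_mono) auto
      ultimately show "2 * hw * (4 * A * sqrt (E * D \<delta>) + 5 * A\<^sup>2 * \<eta>)
          \<le> 2 * hw * (4 * M \<delta> * sqrt (E * D \<delta>) + 5 * (M \<delta>)\<^sup>2 * \<eta>)"
        using hw_pos by (intro mult_left_mono add_mono) auto
    qed
    finally have "(LBINT x. (norm (q x - complex_of_real (csq \<omega> x)))\<^sup>2) \<le> \<Psi> \<delta>"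
      by (simp add: \<Psi>_def algebra_simps)
    then show "(LBINT x. (norm (q x - complex_of_real (csq \<omega> x)))\<^sup>2) \<le> \<epsilon>"
      using \<delta>(1) by linarith
  qed (use \<delta> in auto)
qed

section \<open>Orbital stability\<close>

lemma profile_cmult:
  assumes p: "profile a b q q'" and "z \<noteq> 0"
  shows "profile a b (\<lambda>x. z * q x) (\<lambda>x. z * q' x)"
  unfolding profile_def
proof (intro conjI ballI allI impI)
  show "continuous_on UNIV (\<lambda>x. z * q x)" "continuous_on {a<..<b} (\<lambda>x. z * q' x)"
    by (intro continuous_on_mult_left profileD(2,3)[OF p])+
  obtain C where "\<forall>x. norm (q' x) \<le> C"
    using profile_bounded[OF p] by blast
  then have "norm (z * q' x) \<le> norm z * C" for x
    by (simp add: norm_mult mult_left_mono)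
  then show "bounded (range (\<lambda>x. z * q' x))"
    unfolding bounded_iff by blast
  show "((\<lambda>x. z * q x) has_vector_derivative z * q' x) (at x)" if "x \<in> {a<..<b}" for x
    by (intro has_vector_derivative_mult_right profileD(5)[OF p that])
qed (use profileD[OF p] \<open>z \<noteq> 0\<close> in auto)

lemma LBINT_shift:
  fixes f :: "real \<Rightarrow> real"
  shows "(LBINT x. f (x + h)) = (LBINT x. f x)"
  using lborel_integral_real_affine[of 1 f h] by (simp add: add.commute)

lemma profile_energy_shift:
  "profile_energy (\<lambda>x. q (x + h)) (\<lambda>x. q' (x + h)) = profile_energy q q'"
  unfolding profile_energy_def
  using LBINT_shift[of "\<lambda>x. (norm (q x))\<^sup>2" h] LBINT_shift[of "\<lambda>x. (norm (q' x))\<^sup>2" h] by simp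

text \<open>Here \<delta> comes to depend on \<open>x0\<close>: passing from L^2 to L^1 costs the
  length of the supports.\<close>

lemma orbital_stability:
  assumes "x0 > 0" "\<omega> > 0" "\<epsilon> > 0"
  shows "\<exists>\<delta>>0. \<forall>q q'. profile (-x0) x0 q q' \<and> profile_energy q q' \<le> - hw * \<omega>\<^sup>2 + \<delta> \<and>
    \<bar>(LBINT x. norm (q x)) - 2 * hw * \<omega>\<bar> \<le> \<delta> \<longrightarrow>
    (\<exists>z h. norm z = 1 \<and> (LBINT x. norm (q (x + h) - z * complex_of_real (csq \<omega> x))) \<le> \<epsilon> \<and>
      (LBINT x. (norm (q' (x + h) - z * complex_of_real (csq' \<omega> x)))\<^sup>2) \<le> \<epsilon>\<^sup>2)"
proof -
  \<comment> \<open>With the maximum moved to 0 the support of the profile lies in (-2 x0, 2 x0);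
    adding hw covers the compacton as well.\<close>
  define l where "l = 2 * x0 + hw"
  \<comment> \<open>The L^1 distance will be bounded by 2 l \<tau> + \<epsilon>1/\<tau>, the squared
    distance of the derivatives by 4 \<delta> + 4 \<omega> \<delta> + 2 \<epsilon>1. The constants
    make each contribution at most half of its target.\<close>
  define \<tau> where "\<tau> = \<epsilon> / (4 * l)"
  define \<epsilon>1 where "\<epsilon>1 = min (\<tau> * \<epsilon> / 2) (\<epsilon>\<^sup>2 / 4)"
  have l: "l > 0" using assms hw_pos by (simp add: l_def)
  then have \<tau>: "\<tau> > 0" "\<tau> * (2 * l) = \<epsilon> / 2" using assms by (auto simp: \<tau>_def)
  have \<epsilon>1: "\<epsilon>1 > 0" "\<epsilon>1 / \<tau> \<le> \<epsilon> / 2" "2 * \<epsilon>1 \<le> \<epsilon>\<^sup>2 / 2"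
  proof -
    show "\<epsilon>1 > 0" using assms \<tau> by (simp add: \<epsilon>1_def)
    have "\<epsilon>1 \<le> \<tau> * \<epsilon> / 2" by (simp add: \<epsilon>1_def)
    then show "\<epsilon>1 / \<tau> \<le> \<epsilon> / 2" using \<tau>(1) by (simp add: field_simps)
    show "2 * \<epsilon>1 \<le> \<epsilon>\<^sup>2 / 2" by (simp add: \<epsilon>1_def)
  qed
  obtain \<delta>1 where \<delta>1: "\<delta>1 > 0" and st: "\<And>a b q q' A. profile a b q q' \<Longrightarrow> a < 0 \<Longrightarrow> 0 < b \<Longrightarrow> 0 < A \<Longrightarrow>
      (\<forall>x. norm (q x) \<le> A) \<Longrightarrow> q 0 = complex_of_real A \<Longrightarrow> profile_energy q q' \<le> - hw * \<omega>\<^sup>2 + \<delta>1 \<Longrightarrow>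
      \<bar>(LBINT x. norm (q x)) - 2 * hw * \<omega>\<bar> \<le> \<delta>1 \<Longrightarrow>
      (LBINT x. (norm (q x - complex_of_real (csq \<omega> x)))\<^sup>2) \<le> \<epsilon>1"
    using L2_stability[OF \<open>\<omega> > 0\<close> \<epsilon>1(1)] by blast
  define \<delta> where "\<delta> = min \<delta>1 (\<epsilon>\<^sup>2 / (8 * (1 + \<omega>)))"
  have \<delta>: "\<delta> > 0" "\<delta> \<le> \<delta>1" "4 * \<delta> + 4 * \<omega> * \<delta> \<le> \<epsilon>\<^sup>2 / 2"
  proof -
    show "\<delta> > 0" "\<delta> \<le> \<delta>1" using assms \<delta>1 by (auto simp: \<delta>_def)
    have "\<delta> \<le> \<epsilon>\<^sup>2 / (8 * (1 + \<omega>))" by (simp add: \<delta>_def)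
    then show "4 * \<delta> + 4 * \<omega> * \<delta> \<le> \<epsilon>\<^sup>2 / 2"
      using \<open>\<omega> > 0\<close> by (simp add: field_simps)
  qed
  show ?thesis
  proof (intro exI[of _ \<delta>] conjI allI impI; (elim conjE)?)
    fix q q'
    assume p: "profile (-x0) x0 q q'" and en: "profile_energy q q' \<le> - hw * \<omega>\<^sup>2 + \<delta>"
      and ma: "\<bar>(LBINT x. norm (q x)) - 2 * hw * \<omega>\<bar> \<le> \<delta>"
    have "\<exists>h\<in>{-x0..x0}. \<forall>x\<in>{-x0..x0}. norm (q x) \<le> norm (q h)"
      using \<open>x0 > 0\<close> by (intro continuous_attains_sup continuous_on_norm profileD(2)[OF p]) auto
    then obtain h where h: "h \<in> {-x0..x0}" "\<forall>x\<in>{-x0..x0}. norm (q x) \<le> norm (q h)" by blast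
    define A where "A = norm (q h)"
    have max: "norm (q x) \<le> A" for x
      using h(2) profileD(6)[OF p, of x] by (cases "x \<in> {-x0..x0}") (auto simp: A_def)
    have A: "A > 0"
    proof -
      have "0 < norm (q 0)" using profileD(4)[OF p, of 0] \<open>x0 > 0\<close> by simp
      then show ?thesis using max[of 0] by linarith
    qed
    have hx: "-x0 < h" "h < x0"
    proof -
      have "q h \<noteq> 0" using A by (auto simp: A_def)
      then have "h \<in> {-x0<..<x0}" using profileD(6)[OF p, of h] by blast
      then show "-x0 < h" "h < x0" by auto
    qed
    define z where "z = q h / complex_of_real A"
    have z: "norm z = 1" "cnj z \<noteq> 0" "cnj z * z = 1" "z * cnj z = 1"
    proof -
      show n: "norm z = 1" using A by (simp add: z_def norm_divide A_def)
      then show "cnj z \<noteq> 0" by auto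
      show "z * cnj z = 1" using n by (simp add: complex_norm_square[symmetric])
      then show "cnj z * z = 1" by (simp add: mult.commute)
    qed
    define r where "r x = cnj z * q (x + h)" for x
    define r' where "r' x = cnj z * q' (x + h)" for x
    have pr: "profile (-x0 - h) (x0 - h) r r'"
      unfolding r_def r'_def by (intro profile_cmult[OF profile_shift[OF p]] z)
    have norm_r: "norm (r x) = norm (q (x + h))" "norm (r' x) = norm (q' (x + h))" for x
      using z by (simp_all add: r_def r'_def norm_mult)
    have r0: "r 0 = complex_of_real A"
    proof -
      have "q h = complex_of_real A * z" using A by (simp add: z_def)
      then show ?thesis using z(3) by (simp add: r_def)
    qed
    have er: "profile_energy r r' = profile_energy q q'"
      using profile_energy_shift[of q h q'] by (simp add: profile_energy_def norm_r)
    have mr: "(LBINT x. norm (r x)) = (LBINT x. norm (q x))"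
      using LBINT_shift[of "\<lambda>x. norm (q x)" h] by (simp add: norm_r)
    have L2: "(LBINT x. (norm (r x - complex_of_real (csq \<omega> x)))\<^sup>2) \<le> \<epsilon>1"
      using hx A max r0 er mr en ma \<delta>(2)
      by (intro st[OF pr]) (auto simp: norm_r)
    note bs = profile_bounded_support[OF pr] bounded_support_csq[OF \<open>\<omega> > 0\<close>]
    have rot: "norm (q (x + h) - z * complex_of_real (csq \<omega> x)) = norm (r x - complex_of_real (csq \<omega> x))"
        "norm (q' (x + h) - z * complex_of_real (csq' \<omega> x)) = norm (r' x - complex_of_real (csq' \<omega> x))" for x
    proof -
      have "norm (w - z * y) = norm (cnj z * w - y)" for w y
      proof -
        have "cnj z * (w - z * y) = cnj z * w - y"
          using z(3) by (simp add: right_diff_distrib mult.assoc[symmetric])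
        then show ?thesis using z(1) by (metis complex_mod_cnj mult_1 norm_mult)
      qed
      then show "norm (q (x + h) - z * complex_of_real (csq \<omega> x)) = norm (r x - complex_of_real (csq \<omega> x))"
        "norm (q' (x + h) - z * complex_of_real (csq' \<omega> x)) = norm (r' x - complex_of_real (csq' \<omega> x))"
        by (simp_all add: r_def r'_def)
    qed
    have L1: "(LBINT x. norm (r x - complex_of_real (csq \<omega> x))) \<le> \<epsilon>"
    proof -
      let ?w = "\<lambda>x. norm (r x - complex_of_real (csq \<omega> x))"
      \<comment> \<open>Either \<open>?w x\<close> is at most \<tau>, or it is at most its square
        divided by \<tau>.\<close>
      have "(LBINT x. ?w x) \<le> (LBINT x. \<tau> * indicator {-l<..<l} x + (1 / \<tau>) * (?w x)\<^sup>2)"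
      proof (intro integral_mono integrable_bounded_support bounded_support_intros bs)
        fix x
        show "?w x \<le> \<tau> * indicator {-l<..<l} x + (1 / \<tau>) * (?w x)\<^sup>2"
        proof (cases "x \<in> {-l<..<l}")
          case True
          show ?thesis
          proof (cases "?w x \<le> \<tau>")
            case True
            then show ?thesis using \<open>x \<in> {-l<..<l}\<close> \<tau> by (simp add: add_increasing2)
          next
            case False
            then have "\<tau> * ?w x \<le> ?w x * ?w x" by (intro mult_right_mono) auto
            then have "?w x \<le> (1 / \<tau>) * (?w x)\<^sup>2" using \<tau> by (simp add: field_simps power2_eq_square)
            then show ?thesis using \<tau> by (simp add: add_increasing)
          qed
        next
          case False
          then have "x \<notin> {-x0 - h<..<x0 - h}" "x \<notin> {-hw<..<hw}"
            using hx \<open>x0 > 0\<close> hw_pos by (auto simp: l_def)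
          then have "?w x = 0" using profileD(6)[OF pr, of x] by (auto simp: csq_def)
          then show ?thesis using \<tau> by simp
        qed
      qed
      also have "\<dots> = \<tau> * (2 * l) + (1 / \<tau>) * (LBINT x. (?w x)\<^sup>2)"
      proof -
        have "integrable lborel (\<lambda>x. (?w x)\<^sup>2)" "integrable lborel (indicator {-l<..<l} :: real \<Rightarrow> real)"
          by (intro integrable_bounded_support bounded_support_intros bs)+
        moreover have "(LBINT x. indicator {-l<..<l} x :: real) = 2 * l" using l by simp
        ultimately show ?thesis by simp
      qed
      also have "\<dots> \<le> \<epsilon> / 2 + (1 / \<tau>) * \<epsilon>1"
        using L2 \<tau> by (intro add_mono mult_left_mono) auto
      also have "(1 / \<tau>) * \<epsilon>1 = \<epsilon>1 / \<tau>" by simp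
      also have "\<epsilon> / 2 + \<epsilon>1 / \<tau> \<le> \<epsilon>" using \<epsilon>1(2) by linarith
      finally show ?thesis .
    qed
    have H1: "(LBINT x. (norm (r' x - complex_of_real (csq' \<omega> x)))\<^sup>2) \<le> \<epsilon>\<^sup>2"
    proof -
      \<comment> \<open>The term of the expansion that is linear in the profile is at most its mass,
        hence close to at most 2 hw \<omega>; together with the energy bound all multiples of hw
        \<omega>^2 cancel.\<close>
      have K: "(LBINT x. indicator {-hw<..<hw} x * Re (r x)) \<le> (LBINT x. norm (r x))"
      proof (intro integral_mono integrable_bounded_support bounded_support_intros bs)
        show "indicator {-hw<..<hw} x * Re (r x) \<le> norm (r x)" for x
          using complex_Re_le_cmod[of "r x"] by (simp add: indicator_def)
      qed
      have "4 * \<omega> * (LBINT x. indicator {-hw<..<hw} x * Re (r x)) \<le> 4 * \<omega> * (2 * hw * \<omega> + \<delta>)"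
        using K ma mr \<open>\<omega> > 0\<close> by (intro mult_left_mono) auto
      then have "(LBINT x. (norm (r' x - complex_of_real (csq' \<omega> x)))\<^sup>2) \<le>
          4 * (- hw * \<omega>\<^sup>2 + \<delta>) + 2 * \<epsilon>1 + 4 * \<omega> * (2 * hw * \<omega> + \<delta>) - 4 * hw * \<omega>\<^sup>2"
        using energy_expansion[OF pr \<open>\<omega> > 0\<close>, of 1] er en L2 by simp
      also have "\<dots> = 4 * \<delta> + 4 * \<omega> * \<delta> + 2 * \<epsilon>1"
        by (simp add: power2_eq_square algebra_simps)
      also have "\<dots> \<le> \<epsilon>\<^sup>2" using \<delta>(3) \<epsilon>1(3) by simp
      finally show ?thesis .
    qed
    show "\<exists>z h. norm z = 1 \<and> (LBINT x. norm (q (x + h) - z * complex_of_real (csq \<omega> x))) \<le> \<epsilon> \<and>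
      (LBINT x. (norm (q' (x + h) - z * complex_of_real (csq' \<omega> x)))\<^sup>2) \<le> \<epsilon>\<^sup>2"
      using z(1) L1 H1 by (intro exI[of _ z] exI[of _ h]) (simp add: rot)
  qed (use \<delta> in auto)
qed

text \<open>The converse direction, used for the initial datum. The exact expansion bounds the
  energy from above once its non-negative L^2 term is dropped, so the L^2 distance need not be
  estimated.\<close>

lemma near_compacton_mass_energy:
  assumes p: "profile a b q q'" and \<omega>: "\<omega> > 0" and z: "norm z = 1"
    and L1: "(LBINT x. norm (q x - z * complex_of_real (csq \<omega> x))) \<le> \<delta>"
    and H1: "(LBINT x. (norm (q' x - z * complex_of_real (csq' \<omega> x)))\<^sup>2) \<le> \<delta>\<^sup>2"
  shows "\<bar>(LBINT x. norm (q x)) - 2 * hw * \<omega>\<bar> \<le> \<delta>"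
    and "profile_energy q q' \<le> - hw * \<omega>\<^sup>2 + \<delta>\<^sup>2 / 4 + \<omega> * \<delta>"
proof -
  note bs = profile_bounded_support[OF p] bounded_support_csq[OF \<omega>]
  let ?w = "\<lambda>x. norm (q x - z * complex_of_real (csq \<omega> x))"
  have i: "integrable lborel (\<lambda>x. norm (q x))" "integrable lborel (csq \<omega>)" "integrable lborel ?w"
    "integrable lborel (\<lambda>x. indicator {-hw<..<hw} x * Re (cnj z * q x))"
    by (intro integrable_bounded_support bounded_support_intros bs)+
  have nz: "norm (z * complex_of_real (csq \<omega> x)) = csq \<omega> x" for x
    using z csq_bounds(1)[of \<omega> x] \<omega> by (simp add: norm_mult)
  have "(LBINT x. norm (q x)) \<le> (LBINT x. csq \<omega> x + ?w x)"
    using i norm_triangle_sub[of "q _" "z * complex_of_real (csq \<omega> _)"] by (intro integral_mono) (auto simp: nz)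
  moreover have "(LBINT x. csq \<omega> x) \<le> (LBINT x. norm (q x) + ?w x)"
    using i norm_triangle_sub[of "z * complex_of_real (csq \<omega> _)" "q _"]
    by (intro integral_mono) (auto simp: nz norm_minus_commute)
  ultimately show "\<bar>(LBINT x. norm (q x)) - 2 * hw * \<omega>\<bar> \<le> \<delta>"
    using i L1 LBINT_csq[OF \<omega>] by simp
  have "(LBINT x. csq \<omega> x - ?w x) \<le> (LBINT x. indicator {-hw<..<hw} x * Re (cnj z * q x))"
  proof (rule integral_mono)
    fix x
    show "csq \<omega> x - ?w x \<le> indicator {-hw<..<hw} x * Re (cnj z * q x)"
    proof (cases "x \<in> {-hw<..<hw}")
      case True
      have "cnj z * z = 1"
        using z complex_norm_square[of z] by (simp add: mult.commute)
      then have "csq \<omega> x - Re (cnj z * q x) = Re (cnj z * (z * complex_of_real (csq \<omega> x) - q x))"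
        by (simp only: right_diff_distrib mult.assoc[symmetric]) simp
      also have "\<dots> \<le> norm (cnj z * (z * complex_of_real (csq \<omega> x) - q x))"
        by (rule complex_Re_le_cmod)
      also have "\<dots> = ?w x"
        using z by (simp add: norm_mult norm_minus_commute)
      finally show ?thesis using True by simp
    qed (auto simp: csq_def)
  qed (use i in auto)
  then have "2 * hw * \<omega> - \<delta> \<le> (LBINT x. indicator {-hw<..<hw} x * Re (cnj z * q x))"
    using i L1 LBINT_csq[OF \<omega>] by simp
  then have "4 * \<omega> * (2 * hw * \<omega> - \<delta>) \<le> 4 * \<omega> * (LBINT x. indicator {-hw<..<hw} x * Re (cnj z * q x))"
    using \<omega> by (intro mult_left_mono) auto
  moreover have "0 \<le> (LBINT x. (?w x)\<^sup>2)"
    by (intro Bochner_Integration.integral_nonneg) auto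
  ultimately have "4 * profile_energy q q' \<le> \<delta>\<^sup>2 - 4 * \<omega> * (2 * hw * \<omega> - \<delta>) + 4 * hw * \<omega>\<^sup>2"
    using energy_expansion[OF p \<omega> z] H1 by linarith
  then show "profile_energy q q' \<le> - hw * \<omega>\<^sup>2 + \<delta>\<^sup>2 / 4 + \<omega> * \<delta>"
    by (simp add: power2_eq_square algebra_simps)
qed

text \<open>A time slice of the solution is regular enough for its square to be a profile, and it
  carries the conserved mass and energy of the datum. The two energies agree because |q| = |u|^2 and
  |q_x|^2 = 4 |u u_x|^2.\<close>

lemma lwp_solution_profile:
  assumes sol: "lwp_solution 1 x0 u0 T u" and "x0 > 0" and t: "t \<in> {0..T}"
  obtains q' where "profile (-x0) x0 (\<lambda>x. (u t x)\<^sup>2) q'"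
    "(LBINT x. norm ((u t x)\<^sup>2)) = mass u0"
    "profile_energy (\<lambda>x. (u t x)\<^sup>2) q' = energy 1 u0"
proof -
  have cont: "continuous_on UNIV (u t)"
  proof -
    have "continuous_on ({0..T} \<times> UNIV) (\<lambda>(t, x). u t x)"
      using sol by (simp add: lwp_solution_def)
    then have "continuous_on UNIV (\<lambda>x. (\<lambda>(t, x). u t x) (t, x))"
      by (rule continuous_on_compose2) (use t in \<open>auto intro!: continuous_intros\<close>)
    then show ?thesis by simp
  qed
  have "nonzero_smooth_supported x0 (u t)" "has_weak_deriv 1 (u t) (weak_deriv 1 (u t))"
    "Linf_norm (weak_deriv 1 (u t)) < \<infinity>" "weak_deriv 1 (u t) \<in> borel_measurable lborel"
    using sol t by (auto simp: lwp_solution_def continuous_into_def)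
  from square_profile[OF \<open>x0 > 0\<close> cont this]
  obtain q' where q': "profile (-x0) x0 (\<lambda>x. (u t x)\<^sup>2) q'"
    and ae: "AE x in lborel. 4 * (norm (u t x * weak_deriv 1 (u t) x))\<^sup>2 = (norm (q' x))\<^sup>2" .
  have [measurable]: "u t \<in> borel_measurable borel" "weak_deriv 1 (u t) \<in> borel_measurable borel"
    using cont borel_measurable_continuous_onI \<open>weak_deriv 1 (u t) \<in> borel_measurable lborel\<close> by auto
  note [measurable] = profile_measurable[OF q']
  have "(LBINT x. 4 * (norm (u t x * weak_deriv 1 (u t) x))\<^sup>2) = (LBINT x. (norm (q' x))\<^sup>2)"
    by (rule integral_cong_AE) (use ae in \<open>auto simp del: One_nat_def\<close>)
  then have "profile_energy (\<lambda>x. (u t x)\<^sup>2) q' = energy 1 (u t)"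
    by (simp add: profile_energy_def energy_def norm_power power_mult[symmetric])
  moreover have "(LBINT x. norm ((u t x)\<^sup>2)) = mass (u t)"
    by (simp add: mass_def norm_power)
  moreover have "mass (u t) = mass u0" "energy 1 (u t) = energy 1 u0"
    using sol t by (auto simp: lwp_solution_def)
  ultimately show ?thesis
    using q' by (intro that) auto
qed

theorem theorem1p3:
  fixes \<mu> x0 \<omega> \<epsilon> :: real
  assumes "\<mu> = 1" and "x0 > 0" and "\<omega> > 0" and "\<epsilon> > 0"
  shows "\<exists>\<delta>::real. \<delta> > 0 \<and>
    (\<forall>u0\<in>initial_data x0.
      (INF (\<theta>::real, h::real)\<in>UNIV.
         L1_H1dot_norm (\<lambda>x. (u0 (x + h))\<^sup>2
           - exp (2 * \<i> * complex_of_real \<theta>) * (compacton \<omega> x)\<^sup>2)) \<le> ennreal \<delta>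
      \<longrightarrow> (\<forall>T u. T > 0 \<and> lwp_solution \<mu> x0 u0 T u \<longrightarrow>
        (SUP t\<in>{0..T}. INF (\<theta>::real, h::real)\<in>UNIV.
           L1_H1dot_norm (\<lambda>x. (u t (x + h))\<^sup>2
             - exp (- 2 * \<i> * complex_of_real (t * \<omega>) + 2 * \<i> * complex_of_real \<theta>)
               * (compacton \<omega> x)\<^sup>2)) \<le> ennreal \<epsilon>))"
proof -
  have csq: "(compacton \<omega> x)\<^sup>2 = complex_of_real (csq \<omega> x)" for x
    using compacton_sq[OF \<open>\<omega> > 0\<close>] .
  \<comment> \<open>One half for the L^1 part of the norm, one half for the derivative.\<close>
  have "\<epsilon> / 2 > 0" using \<open>\<epsilon> > 0\<close> by simp
  from orbital_stability[OF \<open>x0 > 0\<close> \<open>\<omega> > 0\<close> this]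
  obtain \<delta>0 where \<delta>0: "\<delta>0 > 0" and stable: "\<And>q q'. profile (-x0) x0 q q' \<Longrightarrow>
      profile_energy q q' \<le> - hw * \<omega>\<^sup>2 + \<delta>0 \<Longrightarrow> \<bar>(LBINT x. norm (q x)) - 2 * hw * \<omega>\<bar> \<le> \<delta>0 \<Longrightarrow>
      \<exists>z h. norm z = 1 \<and> (LBINT x. norm (q (x + h) - z * complex_of_real (csq \<omega> x))) \<le> \<epsilon> / 2 \<and>
        (LBINT x. (norm (q' (x + h) - z * complex_of_real (csq' \<omega> x)))\<^sup>2) \<le> (\<epsilon> / 2)\<^sup>2"
    by blast
  \<comment> \<open>The infimum provides a translate and a phase at distance below 2 \<delta>. The
    mass then deviates by at most 2 \<delta>, and the energy exceeds - hw \<omega>^2 by at most (2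
    \<delta>)^2/4 + 2 \<omega> \<delta>, where the square is absorbed by \<delta> because \<delta>
    is at most 1.\<close>
  define \<delta> where "\<delta> = min 1 (\<delta>0 / (2 + 2 * \<omega>))"
  have \<delta>: "\<delta> > 0" "\<delta> \<le> 1" "2 * \<delta> + 2 * \<omega> * \<delta> \<le> \<delta>0"
  proof -
    show "\<delta> > 0" "\<delta> \<le> 1" using \<delta>0 \<open>\<omega> > 0\<close> by (auto simp: \<delta>_def)
    have "\<delta> \<le> \<delta>0 / (2 + 2 * \<omega>)" by (simp add: \<delta>_def)
    then show "2 * \<delta> + 2 * \<omega> * \<delta> \<le> \<delta>0" using \<open>\<omega> > 0\<close> by (simp add: field_simps)
  qed
  show ?thesis
  proof (intro exI[of _ \<delta>] conjI ballI impI allI SUP_least)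
    fix u0 T u t
    assume u0: "u0 \<in> initial_data x0"
      and near: "(INF (\<theta>::real, h::real)\<in>UNIV. L1_H1dot_norm (\<lambda>x. (u0 (x + h))\<^sup>2
           - exp (2 * \<i> * complex_of_real \<theta>) * (compacton \<omega> x)\<^sup>2)) \<le> ennreal \<delta>"
      and sol': "T > 0 \<and> lwp_solution \<mu> x0 u0 T u" and t: "t \<in> {0..T}"
    have sol: "lwp_solution 1 x0 u0 T u" and "0 \<in> {0..T}" using sol' \<open>\<mu> = 1\<close> by auto
    have [measurable]: "u0 \<in> borel_measurable borel" using u0 by (simp add: initial_data_def)
    have conserved: "\<bar>mass u0 - 2 * hw * \<omega>\<bar> \<le> \<delta>0" "energy 1 u0 \<le> - hw * \<omega>\<^sup>2 + \<delta>0"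
    proof -
      have "ennreal \<delta> < ennreal (2 * \<delta>)" using \<delta> by (simp add: ennreal_less_iff)
      with near obtain \<theta> h where less: "L1_H1dot_norm (\<lambda>x. (u0 (x + h))\<^sup>2
           - exp (2 * \<i> * complex_of_real \<theta>) * (compacton \<omega> x)\<^sup>2) < ennreal (2 * \<delta>)"
        by (auto simp: INF_less_iff dest!: order.strict_trans1)
      obtain q' where p: "profile (-x0) x0 (\<lambda>x. (u 0 x)\<^sup>2) q'"
        and mass: "(LBINT x. norm ((u 0 x)\<^sup>2)) = mass u0"
        and energy: "profile_energy (\<lambda>x. (u 0 x)\<^sup>2) q' = energy 1 u0"
        using lwp_solution_profile[OF sol \<open>x0 > 0\<close> \<open>0 \<in> {0..T}\<close>] by blast
      note ph = profile_shift[OF p, of h]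
      define z where "z = exp (2 * \<i> * complex_of_real \<theta>)"
      have z: "norm z = 1" by (simp add: z_def)
      note [measurable] = profile_measurable(1)[OF p]
      \<comment> \<open>The hypothesis measures \<open>u0\<close>, whereas the profile belongs to
        \<open>u 0\<close>; the null set on which they differ is carried through the
        translation.\<close>
      have "AE x in lborel. u 0 x = u0 x" using sol by (simp add: lwp_solution_def)
      then have "AE x in lborel. (u 0 x)\<^sup>2 = (u0 x)\<^sup>2" by eventually_elim simp
      then have "AE x in lborel. (u 0 (h + 1 * x))\<^sup>2 = (u0 (h + 1 * x))\<^sup>2"
        by (intro AE_borel_affine) auto
      then have "AE x in lborel. (u0 (x + h))\<^sup>2 - z * (compacton \<omega> x)\<^sup>2 = (u 0 (x + h))\<^sup>2 - z * complex_of_real (csq \<omega> x)"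
        by eventually_elim (simp add: csq add.commute)
      moreover have "(\<lambda>x. (u0 (x + h))\<^sup>2 - z * (compacton \<omega> x)\<^sup>2) \<in> borel_measurable borel"
        unfolding csq using profile_measurable(1)[OF csq_profile[OF \<open>\<omega> > 0\<close>]] by measurable
      ultimately have "ennreal (LBINT x. norm ((u 0 (x + h))\<^sup>2 - z * complex_of_real (csq \<omega> x))) +
          ennreal (sqrt (LBINT x. (norm (q' (x + h) - z * complex_of_real (csq' \<omega> x)))\<^sup>2)) < ennreal (2 * \<delta>)"
        using less L1_H1dot_norm_profile_diff[OF ph csq_profile[OF \<open>\<omega> > 0\<close>]] by (simp add: z_def)
      moreover
      have nn: "0 \<le> (LBINT x. norm ((u 0 (x + h))\<^sup>2 - z * complex_of_real (csq \<omega> x)))"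
        "0 \<le> (LBINT x. (norm (q' (x + h) - z * complex_of_real (csq' \<omega> x)))\<^sup>2)"
        by (intro Bochner_Integration.integral_nonneg; simp)+
      ultimately have lt: "(LBINT x. norm ((u 0 (x + h))\<^sup>2 - z * complex_of_real (csq \<omega> x))) +
          sqrt (LBINT x. (norm (q' (x + h) - z * complex_of_real (csq' \<omega> x)))\<^sup>2) < 2 * \<delta>"
        by (simp add: ennreal_plus[symmetric] ennreal_less_iff del: ennreal_plus)
      have L1: "(LBINT x. norm ((u 0 (x + h))\<^sup>2 - z * complex_of_real (csq \<omega> x))) \<le> 2 * \<delta>"
        using lt nn real_sqrt_ge_zero[OF nn(2)] by linarith
      have H1: "(LBINT x. (norm (q' (x + h) - z * complex_of_real (csq' \<omega> x)))\<^sup>2) \<le> (2 * \<delta>)\<^sup>2"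
        using lt nn by (intro sqrt_le_D) linarith
      note bounds = near_compacton_mass_energy[OF ph \<open>\<omega> > 0\<close> z L1 H1]
      have "(LBINT x. norm ((u 0 (x + h))\<^sup>2)) = mass u0"
        using LBINT_shift[of "\<lambda>x. norm ((u 0 x)\<^sup>2)" h] mass by simp
      moreover have "2 * \<delta> \<le> \<delta>0" using \<delta> \<open>\<omega> > 0\<close> by (smt (verit) mult_pos_pos)
      ultimately show "\<bar>mass u0 - 2 * hw * \<omega>\<bar> \<le> \<delta>0" using bounds(1) by simp
      have "(2 * \<delta>)\<^sup>2 / 4 \<le> \<delta>" using \<delta> by (simp add: power2_eq_square mult_left_le)
      then show "energy 1 u0 \<le> - hw * \<omega>\<^sup>2 + \<delta>0"
        using bounds(2) energy \<delta> profile_energy_shift[of "\<lambda>x. (u 0 x)\<^sup>2" h q'] by simp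
    qed
    obtain q' where p: "profile (-x0) x0 (\<lambda>x. (u t x)\<^sup>2) q'"
      and "(LBINT x. norm ((u t x)\<^sup>2)) = mass u0" "profile_energy (\<lambda>x. (u t x)\<^sup>2) q' = energy 1 u0"
      using lwp_solution_profile[OF sol \<open>x0 > 0\<close> t] by blast
    with stable[OF p] conserved obtain z h where z: "norm z = 1"
      and L1: "(LBINT x. norm ((u t (x + h))\<^sup>2 - z * complex_of_real (csq \<omega> x))) \<le> \<epsilon> / 2"
      and H1: "(LBINT x. (norm (q' (x + h) - z * complex_of_real (csq' \<omega> x)))\<^sup>2) \<le> (\<epsilon> / 2)\<^sup>2"
      by auto
    note ph = profile_shift[OF p, of h]
    \<comment> \<open>Half the argument, because the phase enters as 2 \<theta>; t \<omega> undoes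
      the prescribed rotation, which the infimum over \<theta> absorbs.\<close>
    define \<theta> where "\<theta> = Arg z / 2 + t * \<omega>"
    have z_eq: "exp (- 2 * \<i> * complex_of_real (t * \<omega>) + 2 * \<i> * complex_of_real \<theta>) = z"
    proof -
      have "- 2 * \<i> * complex_of_real (t * \<omega>) + 2 * \<i> * complex_of_real \<theta> = \<i> * complex_of_real (Arg z)"
        by (simp add: \<theta>_def algebra_simps)
      moreover have "z \<noteq> 0" using z by auto
      ultimately show ?thesis
        using Arg_eq[of z] z by (simp add: is_Arg_def)
    qed
    have "L1_H1dot_norm (\<lambda>x. (u t (x + h))\<^sup>2 - z * (compacton \<omega> x)\<^sup>2) =
        ennreal (LBINT x. norm ((u t (x + h))\<^sup>2 - z * complex_of_real (csq \<omega> x))) +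
        ennreal (sqrt (LBINT x. (norm (q' (x + h) - z * complex_of_real (csq' \<omega> x)))\<^sup>2))"
      by (rule L1_H1dot_norm_profile_diff[OF ph csq_profile[OF \<open>\<omega> > 0\<close>]])
        (use profile_measurable(1)[OF ph] profile_measurable(1)[OF csq_profile[OF \<open>\<omega> > 0\<close>]] in \<open>auto simp: csq\<close>)
    also have "\<dots> \<le> ennreal (\<epsilon> / 2) + ennreal (\<epsilon> / 2)"
      using L1 real_sqrt_le_mono[OF H1] \<open>\<epsilon> > 0\<close> by (intro add_mono ennreal_leI) auto
    also have "\<dots> = ennreal \<epsilon>"
      using \<open>\<epsilon> > 0\<close> by (simp add: ennreal_plus[symmetric] del: ennreal_plus)
    finally show "(INF (\<theta>::real, h::real)\<in>UNIV. L1_H1dot_norm (\<lambda>x. (u t (x + h))\<^sup>2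
             - exp (- 2 * \<i> * complex_of_real (t * \<omega>) + 2 * \<i> * complex_of_real \<theta>)
               * (compacton \<omega> x)\<^sup>2)) \<le> ennreal \<epsilon>"
      by (intro INF_lower2[of "(\<theta>, h)"]) (simp_all add: z_eq[simplified])
  qed (use \<delta> in auto)
qed

end
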